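(* There is an open dense subset $\mathcal{P}$ of the space of polygons such that for every $\gamma\in\mathcal{P}$ the following hold. The space $I(\gamma)$ is a piecewise smooth $1$-manifold whose arc components are proper. Moreover, the aspect ratio function $\rho:I(\gamma)\to(0,\infty)$ is injective in a neighborhood of each smooth point of $I(\gamma)$, and $\rho^{-1}(1)$ consists entirely of smooth points.
   Context: A polygon is a polygonal Jordan loop in $\mathbb{R}^2$. For each $N\ge 3$ the space of labeled $N$-gons is topologized as a subset of $\mathbb{R}^{2N}$ by listing vertices; an open dense subset $\mathcal{P}$ of polygons means a family of sets $\mathcal{P}(N)$, $N\geq 3$, with $\mathcal{P}(N)$ open and dense in the space of labeled $N$-gons. Rectangles are non-degenerate. $I(\gamma)\subset(\mathbb{R}^2)^4=\mathbb{R}^8$ is the space of labeled rectangles $(R_0,R_1,R_2,R_3)$ with all vertices on $\gamma$, labeled counterclockwise around the rectangle. The aspect ratio is $\rho(R)=|R_2-R_1|/|R_1-R_0|$. A piecewise smooth $1$-manifold is a topological $1$-manifold (without boundary) that is a smooth curve in $\mathbb{R}^8$ away from a locally finite set of points; the smooth points are those at which it is smooth. An arc component of $I(\gamma)$ is a connected component of $I(\gamma)$ homeomorphic to an (open) arc. An arc component is proper if, as one moves towards either of its ends, the aspect ratio tends either to $0$ or to $\infty$, the rectangles at each end accumulate on a chord of $\gamma$ (a non-degenerate segment with endpoints on $\gamma$), and the two chords so obtained at the two ends are distinct. *)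

theory Defs
  imports "HOL-Analysis.Analysis"
begin

section \<open>Polygons\<close>

text \<open>
  A labeled \<open>N\<close>-gon is given by its vertices \<open>v 0, ..., v (N - 1)\<close>, as an extensional function
  on \<open>{..<N}\<close>. The loop below runs affinely over the edge from \<open>v i\<close> to \<open>v (i + 1)\<close>
  (indices mod \<open>N\<close>) while \<open>t\<close> runs from \<open>i / N\<close> to \<open>(i + 1) / N\<close>.
\<close>

definition polygon_loop :: "nat \<Rightarrow> (nat \<Rightarrow> real^2) \<Rightarrow> real \<Rightarrow> real^2" where
  "polygon_loop N v t =
     (let i = nat \<lfloor>real N * t\<rfloor>
      in linepath (v (i mod N)) (v (Suc i mod N)) (frac (real N * t)))"

text \<open>The loop is closed by construction, so \<^const>\<open>simple_path\<close> says that it is a Jordan loop.\<close>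

definition labeled_polygons :: "nat \<Rightarrow> (nat \<Rightarrow> real^2) set" where
  "labeled_polygons N = {v \<in> {..<N} \<rightarrow>\<^sub>E UNIV. simple_path (polygon_loop N v)}"

definition polygon_space :: "nat \<Rightarrow> (nat \<Rightarrow> real^2) topology" where
  "polygon_space N =
     subtopology (product_topology (\<lambda>_. euclidean) {..<N}) (labeled_polygons N)"

definition polygon_curve :: "nat \<Rightarrow> (nat \<Rightarrow> real^2) \<Rightarrow> (real^2) set" where
  "polygon_curve N v = path_image (polygon_loop N v)"

section \<open>Inscribed rectangles\<close>

text \<open>
  A labeled quadruple of points in the plane is an element \<open>R\<close> of \<open>real^2^4\<close> with entries
  \<open>R $ 0\<close>, \<open>R $ 1\<close>, \<open>R $ 2\<close>, \<open>R $ 3\<close>. It is a rectangle if it is a parallelogram with a right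
  angle at \<open>R $ 1\<close>. The last condition says that \<open>(R $ 1 - R $ 0, R $ 2 - R $ 1)\<close> is a positively
  oriented basis, so it expresses both non-degeneracy and the counterclockwise labeling.
\<close>

definition ccw_rectangle :: "real^2^4 \<Rightarrow> bool" where
  "ccw_rectangle R \<longleftrightarrow>
     R $ 1 - R $ 0 = R $ 2 - R $ 3 \<and>
     (R $ 1 - R $ 0) \<bullet> (R $ 2 - R $ 1) = 0 \<and>
     0 < (R $ 1 - R $ 0) $ 1 * (R $ 2 - R $ 1) $ 2 - (R $ 1 - R $ 0) $ 2 * (R $ 2 - R $ 1) $ 1"

definition inscribed_rectangles :: "(real^2) set \<Rightarrow> (real^2^4) set" where
  "inscribed_rectangles \<gamma> = {R. ccw_rectangle R \<and> (\<forall>i. R $ i \<in> \<gamma>)}"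

definition aspect_ratio :: "real^2^4 \<Rightarrow> real" where
  "aspect_ratio R = norm (R $ 2 - R $ 1) / norm (R $ 1 - R $ 0)"

section \<open>Piecewise smooth 1-manifolds\<close>

text \<open>
  Only meant for open \<open>S\<close>, on which \<open>D n\<close> is the \<open>n\<close>-th derivative of \<open>c\<close>; this is
  infinite differentiability.
\<close>

definition smooth_curve_on :: "(real \<Rightarrow> 'a::real_normed_vector) \<Rightarrow> real set \<Rightarrow> bool" where
  "smooth_curve_on c S \<longleftrightarrow>
     (\<exists>D. D 0 = c \<and> (\<forall>n::nat. \<forall>t\<in>S. (D n has_vector_derivative D (Suc n) t) (at t)))"

text \<open>
  Near a smooth point the whole of \<open>M\<close> is a regularly parametrized, embedded, smooth open arc.
\<close>

definition smooth_point :: "'a::euclidean_space set \<Rightarrow> 'a \<Rightarrow> bool" where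
  "smooth_point M p \<longleftrightarrow> p \<in> M \<and>
     (\<exists>U c c'. open U \<and> p \<in> U \<and>
        homeomorphism {0<..<1} (M \<inter> U) c c' \<and>
        smooth_curve_on c {0<..<1} \<and>
        (\<forall>t\<in>{0<..<1}. vector_derivative c (at t) \<noteq> 0))"

text \<open>
  The Hausdorff and second countability axioms hold automatically for subsets of a Euclidean space.
\<close>

definition topological_1_manifold :: "'a::euclidean_space set \<Rightarrow> bool" where
  "topological_1_manifold M \<longleftrightarrow>
     (\<forall>p\<in>M. \<exists>U. open U \<and> p \<in> U \<and> (M \<inter> U) homeomorphic {0<..<1::real})"

definition piecewise_smooth_1_manifold :: "'a::euclidean_space set \<Rightarrow> bool" where
  "piecewise_smooth_1_manifold M \<longleftrightarrow> topological_1_manifold M \<and>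
     (\<forall>p\<in>M. \<exists>U. open U \<and> p \<in> U \<and> finite {q \<in> M \<inter> U. \<not> smooth_point M q})"

section \<open>Proper arc components\<close>

definition arc_components :: "'a::euclidean_space set \<Rightarrow> 'a set set" where
  "arc_components M = {A \<in> components M. A homeomorphic {0<..<1::real}}"

definition chord :: "(real^2) set \<Rightarrow> (real^2) set \<Rightarrow> bool" where
  "chord \<gamma> K \<longleftrightarrow> (\<exists>a\<in>\<gamma>. \<exists>b\<in>\<gamma>. a \<noteq> b \<and> K = closed_segment a b)"

text \<open>Convergence of the sets \<open>S t\<close> to \<open>K\<close> along \<open>F\<close> with respect to the Hausdorff distance.\<close>

definition hausdorff_tendsto :: "('b \<Rightarrow> 'a::metric_space set) \<Rightarrow> 'a set \<Rightarrow> 'b filter \<Rightarrow> bool" where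
  "hausdorff_tendsto S K F \<longleftrightarrow>
     (\<forall>\<epsilon>>0. \<forall>\<^sub>F t in F.
        (\<forall>x\<in>S t. \<exists>y\<in>K. dist x y < \<epsilon>) \<and> (\<forall>y\<in>K. \<exists>x\<in>S t. dist y x < \<epsilon>))"

text \<open>
  Here \<open>F\<close> describes one end of an arc of labeled rectangles parametrized by \<open>c\<close>. The rectangle
  with vertices \<open>R $ i\<close>, as a subset of the plane, is the convex hull of its vertices.
\<close>

definition ends_at_chord ::
    "(real^2) set \<Rightarrow> (real \<Rightarrow> real^2^4) \<Rightarrow> real filter \<Rightarrow> (real^2) set \<Rightarrow> bool" where
  "ends_at_chord \<gamma> c F K \<longleftrightarrow>
     (((\<lambda>t. aspect_ratio (c t)) \<longlongrightarrow> 0) F \<or> filterlim (\<lambda>t. aspect_ratio (c t)) at_top F) \<and>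
     chord \<gamma> K \<and> hausdorff_tendsto (\<lambda>t. convex hull (range (\<lambda>i. c t $ i))) K F"

definition proper_arc :: "(real^2) set \<Rightarrow> (real^2^4) set \<Rightarrow> bool" where
  "proper_arc \<gamma> A \<longleftrightarrow>
     (\<exists>c c' K K'. homeomorphism {0<..<1} A c c' \<and>
        ends_at_chord \<gamma> c (at_right 0) K \<and> ends_at_chord \<gamma> c (at_left 1) K' \<and> K \<noteq> K')"

end

theory Submission
  imports Defs
begin

text \<open>
  Write a rectangle with first corner \<open>p\<close>, first side \<open>w\<close> and aspect ratio \<open>r\<close> as
  \<open>(p, p + w, p + w + r J w, p + r J w)\<close>, where \<open>J\<close> is the rotation by a right angle. For fixed \<open>r\<close>
  it is a linear condition on \<open>(p, w)\<close> that the corners lie on four given lines. The lines of the two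
  corners next to \<open>p\<close>, if not perpendicular, determine \<open>w\<close> from \<open>p\<close> and \<open>r\<close>; the line of the opposite
  corner then gives one equation, affine in \<open>p\<close> and quadratic in \<open>r\<close> (\<open>three_lines_iff\<close>). As \<open>p\<close> runs over the first line,
  this equation is \<open>A(r) = s D(r)\<close> in the parameter \<open>s\<close> of \<open>p\<close>. If the quadratic polynomials \<open>A\<close> and
  \<open>D\<close> have no common positive root, then the rectangle is determined by \<open>r\<close> and is a rational
  function of it. So away from the vertices of the polygon \<open>I(\<gamma>)\<close> is a smooth curve on which the
  aspect ratio itself is a parameter (\<open>nonvertex_smooth\<close>).

  A generic polygon has no inscribed rectangle with two corners at vertices. If one corner \<open>p\<close> is at
  a vertex, the quadratic equation for \<open>r\<close> has a simple root there, so the rectangle follows \<open>p\<close> along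
  the two edges: \<open>I(\<gamma>)\<close> is still a topological curve (\<open>corner_chart\<close>). It is not smooth there: a
  velocity would have to vanish at \<open>p\<close>, because \<open>p\<close> turns, and then everywhere, because the root is
  simple (\<open>corner_not_smooth\<close>). Such corner rectangles are isolated and their aspect ratio is not 1.

  All genericity conditions say that certain polynomials in the coordinates of the vertices do not
  vanish. Such a condition is open and, as soon as the polynomial is not identically zero, dense:
  restrict it to a segment. That it is not identically zero is seen on polygons with all edges tangent
  to a parabola, where everything is explicit in the slopes (\<open>slots_disc\<close> and its companions). Many
  combinatorial patterns occur, since two corners can lie on one edge and a vertex lies on two; a
  pattern is only considered if some inscribed rectangle could realize it.

  Concerning the ends of an arc: rectangles with aspect ratio in a compact part of \<open>(0, \<infinity>)\<close> form a
  compact set, because small rectangles would have their corners on two edges only. So the aspect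
  ratio tends to \<open>0\<close> or \<open>\<infinity>\<close> at each end (\<open>end_dichotomy\<close>). The possible limits \<open>(a, b, b, a)\<close> are
  finitely many, as each of \<open>a\<close>, \<open>b\<close> is a vertex or a foot of a perpendicular from a vertex
  (\<open>limit_flat\<close>); so the limit exists. Near such a limit the aspect ratio is injective (\<open>flat_inj\<close>).
  Suppose both ends of an arc had the same chord. By the intermediate value theorem a rectangle near
  one end would then be a relabeling of a rectangle near the other end. Since these are different points
  of the arc, a nontrivial power of the cyclic relabeling would map the arc to itself. A homeomorphism of finite order dividing 4 of an open
  interval has a fixed point, but no rectangle is fixed by a nontrivial relabeling (\<open>no_rotation\<close>).
\<close>

section \<open>Plane vectors and rectangles\<close>

definition perp :: "real^2 \<Rightarrow> real^2" where
  "perp w = vector [- (w $ 2), w $ 1]"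

definition cross2 :: "real^2 \<Rightarrow> real^2 \<Rightarrow> real" where
  "cross2 u w = u $ 1 * w $ 2 - u $ 2 * w $ 1"

lemma perp_nth [simp]: "perp w $ 1 = - (w $ 2)" "perp w $ 2 = w $ 1"
  by (simp_all add: perp_def)

lemma inner2: "(u::real^2) \<bullet> w = u $ 1 * w $ 1 + u $ 2 * w $ 2"
  by (simp add: inner_vec_def sum_2)

lemma eq2_iff: "(u::real^2) = w \<longleftrightarrow> u $ 1 = w $ 1 \<and> u $ 2 = w $ 2"
  by (simp add: vec_eq_iff forall_2)

lemmas plane_simps = inner2 cross2_def eq2_iff

lemma zero2_iff: "(u::real^2) = 0 \<longleftrightarrow> (u $ 1)\<^sup>2 + (u $ 2)\<^sup>2 = 0"
  by (simp add: eq2_iff sum_power2_eq_zero_iff)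

lemma norm2_sq: "(norm (u::real^2))\<^sup>2 = (u $ 1)\<^sup>2 + (u $ 2)\<^sup>2"
  by (simp only: power2_norm_eq_inner inner2) (simp add: power2_eq_square)

lemma norm_perp [simp]: "norm (perp w) = norm w"
  by (simp add: norm_eq_sqrt_inner inner2 add.commute)

lemma continuous_on_perp [continuous_intros]:
  "continuous_on S f \<Longrightarrow> continuous_on S (\<lambda>x. perp (f x))"
proof -
  assume f: "continuous_on S f"
  have eq: "(\<lambda>x. perp (f x)) = (\<lambda>x. \<chi> i. if i = 1 then - (f x $ 2) else f x $ 1)"
    by (auto simp: fun_eq_iff vec_eq_iff forall_2)
  have "continuous_on S (\<lambda>x. if i = 1 then - (f x $ 2) else f x $ 1)" for i :: 2
    using f by (cases "i = 1") (auto intro!: continuous_intros)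
  then show ?thesis
    unfolding eq by (rule continuous_on_vec_lambda)
qed

lemma continuous_on_cross2 [continuous_intros]:
  "continuous_on S f \<Longrightarrow> continuous_on S g \<Longrightarrow> continuous_on S (\<lambda>x. cross2 (f x) (g x))"
  unfolding cross2_def by (intro continuous_intros)

lemma cross2_simps:
  "cross2 (a + b) c = cross2 a c + cross2 b c" "cross2 a (b + c) = cross2 a b + cross2 a c"
  "cross2 (a - b) c = cross2 a c - cross2 b c" "cross2 a (b - c) = cross2 a b - cross2 a c"
  "cross2 (r *\<^sub>R a) b = r * cross2 a b" "cross2 a (r *\<^sub>R b) = r * cross2 a b"
  "cross2 (- a) b = - cross2 a b" "cross2 a (- b) = - cross2 a b"
  "cross2 a a = 0" "cross2 0 a = 0" "cross2 a 0 = 0"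
  "cross2 a (perp b) = a \<bullet> b" "a \<bullet> perp b = - cross2 a b"
  by (simp_all add: plane_simps algebra_simps)

lemma cross2_commute: "cross2 a b = - cross2 b a"
  by (simp add: cross2_def)

text \<open>Lagrange's identity: a vector is determined by its cross and inner products.\<close>

lemma lagrange2: "(cross2 a b)\<^sup>2 + (a \<bullet> b)\<^sup>2 = (norm a)\<^sup>2 * (norm b)\<^sup>2"
  unfolding norm2_sq by (simp add: plane_simps power2_eq_square algebra_simps)

lemma cross2_inner_eq_0:
  assumes "cross2 a b = 0" "a \<bullet> b = 0" "a \<noteq> 0" shows "b = 0"
  using lagrange2[of a b] assms by simp

lemma cross2_eq_0_imp_parallel:
  assumes "cross2 a b = 0" "a \<noteq> 0"
  obtains x where "b = x *\<^sub>R a"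
proof
  have "cross2 a (b - ((a \<bullet> b) / (a \<bullet> a)) *\<^sub>R a) = 0" "a \<bullet> (b - ((a \<bullet> b) / (a \<bullet> a)) *\<^sub>R a) = 0"
    using assms by (simp_all add: cross2_simps inner_diff_right)
  from cross2_inner_eq_0[OF this assms(2)] show "b = ((a \<bullet> b) / (a \<bullet> a)) *\<^sub>R a"
    by simp
qed

lemma four_eq_0: "(4::4) = 0"
  by simp

lemma forall_4': "(\<forall>i::4. P i) \<longleftrightarrow> P 0 \<and> P 1 \<and> P 2 \<and> P 3"
  unfolding forall_4 four_eq_0 by blast

definition rect :: "real^2 \<Rightarrow> real^2 \<Rightarrow> real \<Rightarrow> real^2^4" where
  "rect p w r = (\<chi> i. if i = 0 then p else if i = 1 then p + w
     else if i = 2 then p + w + r *\<^sub>R perp w else p + r *\<^sub>R perp w)"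

lemma rect_nth [simp]:
  "rect p w r $ 0 = p" "rect p w r $ 1 = p + w"
  "rect p w r $ 2 = p + w + r *\<^sub>R perp w" "rect p w r $ 3 = p + r *\<^sub>R perp w"
  by (simp_all add: rect_def)

lemma ccw_rectangle_rect:
  assumes "w \<noteq> 0" "r > 0" shows "ccw_rectangle (rect p w r)"
proof -
  have "0 < (w $ 1)\<^sup>2 + (w $ 2)\<^sup>2"
    using assms(1) unfolding zero2_iff by (smt (verit) sum_power2_ge_zero)
  then have "0 < r * ((w $ 1)\<^sup>2 + (w $ 2)\<^sup>2)"
    using assms(2) by simp
  then show ?thesis
    by (simp add: ccw_rectangle_def inner2 power2_eq_square algebra_simps)
qed

lemma ccw_rectangleE:
  assumes "ccw_rectangle R"
  obtains p w r where "w \<noteq> 0" "r > 0" "R = rect p w r"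
proof -
  define w x where "w = R $ 1 - R $ 0" and "x = R $ 2 - R $ 1"
  have R: "R $ 2 - R $ 3 = w" "w \<bullet> x = 0" "0 < cross2 w x"
    using assms unfolding ccw_rectangle_def w_def x_def cross2_def by metis+
  have w0: "w \<noteq> 0"
    using R(3) by (auto simp: cross2_simps)
  define r where "r = cross2 w x / (w \<bullet> w)"
  have "cross2 w (x - r *\<^sub>R perp w) = 0" "w \<bullet> (x - r *\<^sub>R perp w) = 0"
    using R w0 by (auto simp: cross2_simps r_def inner_diff_right)
  from cross2_inner_eq_0[OF this w0] have x: "x = r *\<^sub>R perp w" by simp
  have "R = rect (R $ 0) w r"
    unfolding vec_eq_iff forall_4' rect_nth x[symmetric] using R(1)
    by (auto simp: w_def x_def algebra_simps)
  moreover have "r > 0" using R(3) w0 by (simp add: r_def)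
  ultimately show ?thesis using w0 that by blast
qed

lemma aspect_ratio_rect:
  assumes "w \<noteq> 0" "r > 0" shows "aspect_ratio (rect p w r) = r"
  using assms by (simp add: aspect_ratio_def)

section \<open>Rectangles with corners on four given lines\<close>

text \<open>
  The coefficients of the quadratic equation for the aspect ratio. The \<open>d i\<close> are the directions of the
  lines of the corners 1, 2, 3 and \<open>e i\<close> is \<open>cross2 (d i) (x - p)\<close> for any \<open>x\<close> on that line and the
  corner 0 at \<open>p\<close>; \<open>side_vec\<close> is the side from corner 0 to corner 1.
\<close>

definition quadA where "quadA d1 d2 d3 e1 e2 e3 = (e1::real) * cross2 d2 d3"
definition quadB where "quadB d1 d2 d3 e1 e2 e3 = - (e1::real) * (d2 \<bullet> d3) + e2 * (d1 \<bullet> d3) - e3 * (d1 \<bullet> d2)"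
definition quadC where "quadC d1 d2 d3 e1 e2 e3 = (e3::real) * cross2 d1 d2"
definition side_vec :: "real^2 \<Rightarrow> real^2 \<Rightarrow> real \<Rightarrow> real \<Rightarrow> real \<Rightarrow> real^2" where
  "side_vec d1 d3 e1 e3 r = (1 / (d1 \<bullet> d3)) *\<^sub>R (e1 *\<^sub>R perp d3 + (e3 / r) *\<^sub>R d1)"

text \<open>
  The equations say that the corners \<open>p + w\<close>, \<open>p + w + r J w\<close> and \<open>p + r J w\<close> lie on the three lines. The
  first and the last one prescribe the cross product of \<open>w\<close> with \<open>d1\<close> and its inner product with \<open>d3\<close>,
  which determines \<open>w\<close> unless the two directions are perpendicular; substituting it in the middle one
  and clearing the denominator \<open>r\<close> leaves the quadratic equation.
\<close>

lemma three_lines_iff: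
  assumes "d1 \<bullet> d3 \<noteq> 0" "r \<noteq> 0"
  shows "cross2 d1 w = e1 \<and> cross2 d2 w + r * (d2 \<bullet> w) = e2 \<and> r * (d3 \<bullet> w) = e3 \<longleftrightarrow>
     w = side_vec d1 d3 e1 e3 r \<and>
     quadA d1 d2 d3 e1 e2 e3 * r\<^sup>2 + quadB d1 d2 d3 e1 e2 e3 * r + quadC d1 d2 d3 e1 e2 e3 = 0"
    (is "?L \<longleftrightarrow> ?R")
proof -
  define w0 where "w0 = side_vec d1 d3 e1 e3 r"
  have c1: "cross2 d1 w0 = e1" and c3: "r * (d3 \<bullet> w0) = e3"
    using assms by (auto simp: w0_def side_vec_def cross2_simps inner_simps inner_commute)
  have uniq: "w = w0" if "cross2 d1 w = e1" "r * (d3 \<bullet> w) = e3"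
  proof -
    have 1: "cross2 d1 (w - w0) = 0" and 2: "d3 \<bullet> (w - w0) = 0"
      using that c1 c3 assms by (auto simp: cross2_simps inner_diff_right)
    from assms have "d1 \<noteq> 0" by auto
    with 1 obtain x where x: "w - w0 = x *\<^sub>R d1"
      by (rule cross2_eq_0_imp_parallel)
    with 2 assms show ?thesis by (simp add: inner_commute)
  qed
  have "r * (d1 \<bullet> d3) * (cross2 d2 w0 + r * (d2 \<bullet> w0) - e2) =
    - (quadA d1 d2 d3 e1 e2 e3 * r\<^sup>2 + quadB d1 d2 d3 e1 e2 e3 * r + quadC d1 d2 d3 e1 e2 e3)"
  proof -
    have "(d1 \<bullet> d3) * cross2 d2 w0 = e1 * (d2 \<bullet> d3) + (e3 / r) * cross2 d2 d1"
      "(d1 \<bullet> d3) * (d2 \<bullet> w0) = - e1 * cross2 d2 d3 + (e3 / r) * (d2 \<bullet> d1)"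
      using assms by (simp_all add: w0_def side_vec_def cross2_simps inner_simps)
    moreover have "r * (d1 \<bullet> d3) * (cross2 d2 w0 + r * (d2 \<bullet> w0) - e2)
      = r * ((d1 \<bullet> d3) * cross2 d2 w0) + r * (r * ((d1 \<bullet> d3) * (d2 \<bullet> w0))) - r * (d1 \<bullet> d3) * e2"
      by (simp add: algebra_simps)
    ultimately have "r * (d1 \<bullet> d3) * (cross2 d2 w0 + r * (d2 \<bullet> w0) - e2)
      = r * (e1 * (d2 \<bullet> d3) + (e3 / r) * cross2 d2 d1) + r * (r * (- e1 * cross2 d2 d3 + (e3 / r) * (d2 \<bullet> d1))) - r * (d1 \<bullet> d3) * e2"
      by (simp only:)
    also have "\<dots> = - (quadA d1 d2 d3 e1 e2 e3 * r\<^sup>2 + quadB d1 d2 d3 e1 e2 e3 * r + quadC d1 d2 d3 e1 e2 e3)"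
      using assms cross2_commute[of d1 d2]
      by (simp add: quadA_def quadB_def quadC_def power2_eq_square field_simps inner_commute)
    finally show ?thesis .
  qed
  then have "cross2 d2 w0 + r * (d2 \<bullet> w0) = e2 \<longleftrightarrow>
     quadA d1 d2 d3 e1 e2 e3 * r\<^sup>2 + quadB d1 d2 d3 e1 e2 e3 * r + quadC d1 d2 d3 e1 e2 e3 = 0"
    using assms by (smt (verit) mult_eq_0_iff)
  then show ?thesis
    using c1 c3 uniq unfolding w0_def[symmetric] by blast
qed

section \<open>The cyclic relabeling\<close>

text \<open>
  The symmetry of the problem: it inverts the aspect ratio and reduces statements about any corner to
  corner 0, and ends with ratio tending to \<open>\<infinity>\<close> to ends with ratio tending to \<open>0\<close>.
\<close>

definition cyc :: "real^2^4 \<Rightarrow> real^2^4" where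
  "cyc R = (\<chi> i. R $ (i + 1))"

lemma cyc_nth [simp]: "cyc R $ 0 = R $ 1" "cyc R $ 1 = R $ 2" "cyc R $ 2 = R $ 3" "cyc R $ 3 = R $ 0"
  unfolding cyc_def by (simp, simp, simp, simp, metis four_eq_0)

lemma cyc4 [simp]: "cyc (cyc (cyc (cyc R))) = R"
  by (simp add: vec_eq_iff forall_4')

lemma inj_cyc: "cyc R = cyc S \<longleftrightarrow> R = S"
  by (metis cyc4)

lemma linear_cyc: "linear cyc"
  by (auto simp: linear_iff cyc_def vec_eq_iff)

lemma perp_perp [simp]: "perp (perp w) = - w" and perp_scale: "perp (r *\<^sub>R w) = r *\<^sub>R perp w"
  by (simp_all add: eq2_iff)

lemma cyc_rect: "r \<noteq> 0 \<Longrightarrow> cyc (rect p w r) = rect (p + w) (r *\<^sub>R perp w) (1 / r)"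
  by (auto simp: vec_eq_iff[of "cyc _"] forall_4' perp_scale)

lemma ccw_rectangle_cyc: "ccw_rectangle R \<Longrightarrow> ccw_rectangle (cyc R)"
proof (erule ccw_rectangleE)
  fix p w :: "real^2" and r :: real
  assume "w \<noteq> 0" "r > 0" "R = rect p w r"
  moreover from this have "perp w \<noteq> 0" by (metis norm_perp norm_eq_zero)
  ultimately show "ccw_rectangle (cyc R)"
    by (auto simp: cyc_rect intro!: ccw_rectangle_rect)
qed

lemma aspect_ratio_cyc: "ccw_rectangle R \<Longrightarrow> aspect_ratio (cyc R) = 1 / aspect_ratio R"
proof (erule ccw_rectangleE)
  fix p w :: "real^2" and r :: real
  assume "w \<noteq> 0" "r > 0" "R = rect p w r"
  moreover from this have "perp w \<noteq> 0" by (metis norm_perp norm_eq_zero)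
  ultimately show "aspect_ratio (cyc R) = 1 / aspect_ratio R"
    by (auto simp: cyc_rect aspect_ratio_rect)
qed

lemma inscribed_rectangles_cyc: "R \<in> inscribed_rectangles \<gamma> \<Longrightarrow> cyc R \<in> inscribed_rectangles \<gamma>"
  unfolding inscribed_rectangles_def mem_Collect_eq
  by (metis ccw_rectangle_cyc cyc_def vec_lambda_beta)

lemma cyc_image_inscribed: "cyc ` inscribed_rectangles \<gamma> = inscribed_rectangles \<gamma>"
proof -
  have "R \<in> cyc ` inscribed_rectangles \<gamma>" if "R \<in> inscribed_rectangles \<gamma>" for R
    using that inscribed_rectangles_cyc by (intro image_eqI[of _ _ "cyc (cyc (cyc R))"]) auto
  then show ?thesis using inscribed_rectangles_cyc by blast
qed

section \<open>Edges of a simple polygon\<close>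

definition dir :: "nat \<Rightarrow> (nat \<Rightarrow> real^2) \<Rightarrow> nat \<Rightarrow> real^2" where
  "dir N v k = v (Suc k mod N) - v k"

definition edge :: "nat \<Rightarrow> (nat \<Rightarrow> real^2) \<Rightarrow> nat \<Rightarrow> (real^2) set" where
  "edge N v k = closed_segment (v k) (v (Suc k mod N))"

definition edge_pt :: "nat \<Rightarrow> (nat \<Rightarrow> real^2) \<Rightarrow> nat \<Rightarrow> real \<Rightarrow> real^2" where
  "edge_pt N v k x = v k + x *\<^sub>R dir N v k"

lemma edge_pt_0 [simp]: "edge_pt N v k 0 = v k"
  and edge_pt_1 [simp]: "edge_pt N v k 1 = v (Suc k mod N)"
  by (simp_all add: edge_pt_def dir_def)

lemma edge_eq: "edge N v k = edge_pt N v k ` {0..1}"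
proof -
  have "(1 - u) *\<^sub>R v k + u *\<^sub>R v (Suc k mod N) = edge_pt N v k u" for u
    by (simp add: edge_pt_def dir_def algebra_simps)
  then show ?thesis
    by (auto simp: edge_def closed_segment_image_interval)
qed

lemma edge_pt_in_edge: "0 \<le> x \<Longrightarrow> x \<le> 1 \<Longrightarrow> edge_pt N v k x \<in> edge N v k"
  by (simp add: edge_eq)

lemma polygon_loop_at:
  assumes "k < N" "0 \<le> x" "x \<le> 1"
  shows "polygon_loop N v ((real k + x) / real N) = edge_pt N v k x"
proof (cases "x = 1")
  case True
  have 1: "nat \<lfloor>real k + 1\<rfloor> = Suc k" by linarith
  have 2: "frac (real k + 1) = 0"
    by (metis frac_of_int of_int_of_nat_eq of_nat_1 of_nat_add)
  have 3: "real N * ((real k + x) / real N) = real k + 1" using assms True by simp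
  show ?thesis
    unfolding polygon_loop_def Let_def 3 1 2 by (simp add: True linepath_def)
next
  case False
  then have x: "0 \<le> x" "x < 1" using assms by auto
  then have "\<lfloor>real k + x\<rfloor> = int k" by linarith
  then have 1: "nat \<lfloor>real k + x\<rfloor> = k" and 2: "frac (real k + x) = x"
    by (simp_all add: frac_def)
  have 3: "real N * ((real k + x) / real N) = real k + x" using assms by simp
  show ?thesis
    unfolding polygon_loop_def Let_def 3 1 2
    using assms by (simp add: linepath_def edge_pt_def dir_def algebra_simps)
qed

lemma unit_interval_split:
  assumes "N > 0" "0 \<le> t" "t < 1"
  obtains k x where "k < N" "0 \<le> x" "x < 1" "t = (real k + x) / real N"
proof
  have *: "0 \<le> real N * t" "real N * t < real N"
    using assms by auto
  then show "nat \<lfloor>real N * t\<rfloor> < N"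
    using assms(1) by (simp add: nat_less_iff floor_less_iff)
  show "0 \<le> frac (real N * t)" "frac (real N * t) < 1"
    by (simp_all add: frac_lt_1)
  show "t = (real (nat \<lfloor>real N * t\<rfloor>) + frac (real N * t)) / real N"
    using * assms by (simp add: frac_def)
qed

lemma polygon_curve_eq:
  assumes "N > 0" shows "polygon_curve N v = (\<Union>k<N. edge N v k)"
proof
  have 01: "(real k + x) / real N \<in> {0..1}" if "k < N" "0 \<le> x" "x \<le> 1" for k x
  proof -
    have "real k + 1 \<le> real N" using that(1) by linarith
    then show ?thesis using that by auto
  qed
  show "(\<Union>k<N. edge N v k) \<subseteq> polygon_curve N v"
  proof (clarsimp simp: edge_eq)
    fix k x assume "k < N" "0 \<le> x" "x \<le> (1::real)"
    then show "edge_pt N v k x \<in> polygon_curve N v"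
      using 01[of k x] polygon_loop_at[of k N x v] unfolding polygon_curve_def path_image_def
      by (metis image_eqI)
  qed
  show "polygon_curve N v \<subseteq> (\<Union>k<N. edge N v k)"
  proof
    fix q assume "q \<in> polygon_curve N v"
    then obtain t where t: "0 \<le> t" "t \<le> 1" "q = polygon_loop N v t"
      by (auto simp: polygon_curve_def path_image_def)
    show "q \<in> (\<Union>k<N. edge N v k)"
    proof (cases "t = 1")
      case True
      then have "q = edge_pt N v (N - 1) 1"
        using t(3) polygon_loop_at[of "N-1" N 1 v] assms by (simp add: of_nat_diff)
      then show ?thesis using assms by (force simp: edge_eq)
    next
      case False
      with t have "t < 1" by auto
      from unit_interval_split[OF assms t(1) this] obtain k x
        where "k < N" "0 \<le> x" "x < 1" "t = (real k + x) / real N" by blast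
      then show ?thesis
        using t(3) polygon_loop_at[of k N x v] edge_pt_in_edge[of x N v k] by auto
    qed
  qed
qed

lemma path_polygon_loop:
  assumes "N > 0" shows "path (polygon_loop N v)"
proof -
  define S where "S k = {real k / real N .. (real k + 1) / real N}" for k
  have "continuous_on (S k) (polygon_loop N v)" if "k < N" for k
  proof -
    have "continuous_on (S k) (\<lambda>t. edge_pt N v k (real N * t - real k))"
      unfolding edge_pt_def by (intro continuous_intros)
    moreover have "polygon_loop N v t = edge_pt N v k (real N * t - real k)" if "t \<in> S k" for t
    proof -
      have "real k \<le> real N * t" "real N * t \<le> real k + 1"
        using that assms by (auto simp: S_def field_simps)
      then show ?thesis
        using polygon_loop_at[of k N "real N * t - real k" v] \<open>k < N\<close> assms by simp
    qed
    ultimately show ?thesis by (metis (no_types, lifting) continuous_on_cong)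
  qed
  then have "continuous_on (\<Union>k<N. S k) (polygon_loop N v)"
    by (intro continuous_on_closed_Union) (auto simp: S_def)
  moreover have "{0..1} \<subseteq> (\<Union>k<N. S k)"
  proof
    fix t :: real assume t: "t \<in> {0..1}"
    show "t \<in> (\<Union>k<N. S k)"
    proof (cases "t = 1")
      case True
      then have "t \<in> S (N - 1)" using assms by (auto simp: S_def of_nat_diff field_simps)
      then show ?thesis using assms by auto
    next
      case False
      with t have "0 \<le> t" "t < 1" by auto
      from unit_interval_split[OF assms this] obtain k x
        where "k < N" "0 \<le> x" "x < 1" "t = (real k + x) / real N" by blast
      then have "t \<in> S k" by (auto simp: S_def divide_right_mono)
      then show ?thesis using \<open>k < N\<close> by auto
    qed
  qed
  ultimately show ?thesis
    unfolding path_def by (rule continuous_on_subset)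
qed

text \<open>
  The loop without its final parameter is parametrized by the pairs \<open>(i, x)\<close> with \<open>x < 1\<close>.
\<close>

lemma simple_polygon_iff:
  assumes "N > 0"
  shows "simple_path (polygon_loop N v) \<longleftrightarrow>
    (\<forall>i<N. \<forall>j<N. \<forall>x y. 0 \<le> x \<and> x < 1 \<and> 0 \<le> y \<and> y < 1 \<and>
       edge_pt N v i x = edge_pt N v j y \<longrightarrow> i = j \<and> x = y)" (is "?L \<longleftrightarrow> ?R")
proof
  assume L: ?L
  show ?R
  proof (intro allI impI)
    fix i j x y
    assume ij: "i < N" "j < N" and xy: "0 \<le> x \<and> x < 1 \<and> 0 \<le> y \<and> y < 1 \<and>
       edge_pt N v i x = edge_pt N v j y"
    have i1: "real i + x < real N" "real j + y < real N" using ij xy by linarith+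
    let ?s = "(real i + x) / real N" and ?t = "(real j + y) / real N"
    have st: "?s \<in> {0..1}" "?t \<in> {0..1}" "?s < 1" "?t < 1"
      using i1 xy by auto
    have "polygon_loop N v ?s = polygon_loop N v ?t"
      using polygon_loop_at[of i N x v] polygon_loop_at[of j N y v] ij xy by simp
    with L st have "?s = ?t"
      unfolding simple_path_def loop_free_def by fastforce
    then have e: "real i + x = real j + y" using assms by simp
    then have "i = j" using xy by linarith
    with e show "i = j \<and> x = y" by simp
  qed
next
  assume R: ?R
  have inj: "s = t" if st: "0 \<le> s" "s < 1" "0 \<le> t" "t < 1" and eq: "polygon_loop N v s = polygon_loop N v t" for s t
  proof -
    obtain i x where i: "i < N" "0 \<le> x" "x < 1" "s = (real i + x) / real N"
      using unit_interval_split[OF assms st(1,2)] by blast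
    obtain j y where j: "j < N" "0 \<le> y" "y < 1" "t = (real j + y) / real N"
      using unit_interval_split[OF assms st(3,4)] by blast
    have "edge_pt N v i x = edge_pt N v j y"
      using eq i j polygon_loop_at[of i N x v] polygon_loop_at[of j N y v] by simp
    with R i j have "i = j \<and> x = y" by blast
    with i j show ?thesis by simp
  qed
  have 1: "polygon_loop N v 1 = polygon_loop N v 0"
    using polygon_loop_at[of 0 N 0 v] polygon_loop_at[of "N-1" N 1 v] assms
    by (simp add: of_nat_diff)
  have "loop_free (polygon_loop N v)"
    unfolding loop_free_def
  proof (intro ballI impI)
    fix s t :: real
    assume st: "s \<in> {0..1}" "t \<in> {0..1}" and eq: "polygon_loop N v s = polygon_loop N v t"
    consider "s = 1" "t = 1" | "s = 1" "t < 1" | "s < 1" "t = 1" | "s < 1" "t < 1"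
      using st by fastforce
    then show "s = t \<or> s = 0 \<and> t = 1 \<or> s = 1 \<and> t = 0"
    proof cases
      case 2
      with inj[of 0 t] st eq 1 show ?thesis by force
    next
      case 3
      with inj[of s 0] st eq 1 show ?thesis by force
    next
      case 4
      with inj[of s t] st eq show ?thesis by force
    qed simp
  qed
  then show ?L
    using path_polygon_loop[OF assms] by (simp add: simple_path_def)
qed

definition adjacent :: "nat \<Rightarrow> nat \<Rightarrow> nat \<Rightarrow> bool" where
  "adjacent N i j \<longleftrightarrow> j = Suc i mod N \<or> i = Suc j mod N"

lemma Suc_mod_inj:
  assumes "i < N" "j < N" "Suc i mod N = Suc j mod N" shows "i = j"
  using assms by (auto simp: mod_Suc split: if_splits)

text \<open>
  A common point of two edges has the same coordinates on both. These agree only if on one edge it is the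
  final point \<open>x = 1\<close>, which has coordinate \<open>0\<close> on the next edge.
\<close>

lemma edges_meet:
  assumes N: "N > 0" and s: "simple_path (polygon_loop N v)"
    and ij: "i < N" "j < N" "i \<noteq> j" and q: "q \<in> edge N v i" "q \<in> edge N v j"
  shows "(j = Suc i mod N \<and> q = v j) \<or> (i = Suc j mod N \<and> q = v i)"
proof -
  note R = s[unfolded simple_polygon_iff[OF N], rule_format]
  have norm: "\<exists>i' x'. i' < N \<and> 0 \<le> x' \<and> x' < 1 \<and> q = edge_pt N v i' x' \<and>
      (i' = i \<or> i' = Suc i mod N \<and> x' = 0)" if iN: "i < N" and "q \<in> edge N v i" for i
  proof -
    obtain x where x: "0 \<le> x" "x \<le> 1" "q = edge_pt N v i x"
      using \<open>q \<in> edge N v i\<close> by (auto simp: edge_eq)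
    show ?thesis
    proof (cases "x = 1")
      case True
      then show ?thesis using x N by (intro exI[of _ "Suc i mod N"] exI[of _ 0]) auto
    next
      case False
      then show ?thesis using x iN by (intro exI[of _ i] exI[of _ x]) auto
    qed
  qed
  obtain i' x' where i': "i' < N" "0 \<le> x'" "x' < 1" "q = edge_pt N v i' x'"
      "i' = i \<or> i' = Suc i mod N \<and> x' = 0" using norm[OF ij(1) q(1)] by blast
  obtain j' y' where j': "j' < N" "0 \<le> y'" "y' < 1" "q = edge_pt N v j' y'"
      "j' = j \<or> j' = Suc j mod N \<and> y' = 0" using norm[OF ij(2) q(2)] by blast
  have "i' = j'" "x' = y'" using R[of i' j' x' y'] i' j' by auto
  with i' j' ij Suc_mod_inj[of i N j] show ?thesis by auto
qed

lemma vertex_inj: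
  assumes N: "N > 0" and s: "simple_path (polygon_loop N v)" and "i < N" "j < N" "v i = v j"
  shows "i = j"
  using s[unfolded simple_polygon_iff[OF N], rule_format, of i j 0 0] assms(3-) by auto

text \<open>
  Consecutive edges of a simple polygon do not fold back, so the angle between their directions
  is less than \<open>\<pi>\<close>; this and the disjointness of the other pairs characterize simplicity, and
  both are open conditions.
\<close>

definition open_simple :: "nat \<Rightarrow> (nat \<Rightarrow> real^2) \<Rightarrow> bool" where
  "open_simple N v \<longleftrightarrow>
     (\<forall>i<N. 0 < norm (dir N v i) * norm (dir N v (Suc i mod N)) + dir N v i \<bullet> dir N v (Suc i mod N)) \<and>
     (\<forall>i<N. \<forall>j<N. i \<noteq> j \<longrightarrow> \<not> adjacent N i j \<longrightarrow> edge N v i \<inter> edge N v j = {})"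

text \<open>
  If the angle condition fails, equality holds in the Cauchy-Schwarz inequality, so the next edge runs
  back along the previous one and the two meet near their common vertex.
\<close>

lemma simple_imp_open_simple:
  assumes N: "N \<ge> 3" and s: "simple_path (polygon_loop N v)"
  shows "open_simple N v"
  unfolding open_simple_def
proof (intro conjI allI impI)
  have N0: "N > 0" using N by simp
  note R = s[unfolded simple_polygon_iff[OF N0], rule_format]
  fix i assume i: "i < N"
  let ?j = "Suc i mod N" let ?a = "dir N v i" let ?b = "dir N v ?j"
  have j: "?j < N" "?j \<noteq> i" using N i by (auto simp: mod_Suc split: if_splits)
  show "0 < norm ?a * norm ?b + ?a \<bullet> ?b"
  proof (rule ccontr)
    assume "\<not> ?thesis"
    then have "?a \<bullet> (- ?b) \<ge> norm ?a * norm (- ?b)" by simp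
    then have "?a \<bullet> (- ?b) = norm ?a * norm (- ?b)"
      using norm_cauchy_schwarz[of ?a "- ?b"] by linarith
    then have eq: "norm ?a *\<^sub>R (- ?b) = norm ?b *\<^sub>R ?a"
      unfolding norm_cauchy_schwarz_eq by simp
    \<comment> \<open>small enough for both parameters of the common point to be in \<open>[0, 1)\<close>\<close>
    define t where "t = 1 / (1 + norm ?a + norm ?b)"
    have den: "1 + norm ?a + norm ?b > 0" by (smt (verit) norm_ge_zero)
    have "?b \<noteq> 0"
    proof
      assume "?b = 0"
      then have "v (Suc ?j mod N) = v ?j" by (simp add: dir_def)
      from vertex_inj[OF N0 s _ _ this] have "Suc ?j mod N = ?j" using N by simp
      then show False using N j by (auto simp: mod_Suc split: if_splits)
    qed
    then have "norm ?b > 0" by simp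
    have t0: "t > 0" using den by (simp add: t_def)
    have "t * norm ?b < 1" "t * norm ?a < 1" 
      using den \<open>norm ?b > 0\<close> by (auto simp: t_def divide_less_eq) (smt (verit) norm_ge_zero)+
    moreover have "t * norm ?b > 0" "t * norm ?a \<ge> 0" using t0 \<open>norm ?b > 0\<close> by auto
    moreover have "edge_pt N v i (1 - t * norm ?b) = edge_pt N v ?j (t * norm ?a)"
    proof -
      have "v i + (1 - t * norm ?b) *\<^sub>R ?a = v ?j - t *\<^sub>R (norm ?b *\<^sub>R ?a)"
        by (simp add: dir_def algebra_simps)
      also have "\<dots> = v ?j + (t * norm ?a) *\<^sub>R ?b"
        by (subst eq[symmetric]) simp
      finally show ?thesis by (simp add: edge_pt_def)
    qed
    ultimately have "i = ?j" using R[of i ?j "1 - t * norm ?b" "t * norm ?a"] i j by auto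
    with j show False by simp
  qed
next
  fix i j assume "i < N" "j < N" "i \<noteq> j" "\<not> adjacent N i j"
  then show "edge N v i \<inter> edge N v j = {}"
    using edges_meet[of N v i j] N s by (auto simp: adjacent_def)
qed

lemma open_simple_imp_simple:
  assumes N: "N \<ge> 3" and s: "open_simple N v"
  shows "simple_path (polygon_loop N v)"
proof -
  have N0: "N > 0" using N by simp
  have angle: "0 < norm (dir N v i) * norm (dir N v (Suc i mod N)) + dir N v i \<bullet> dir N v (Suc i mod N)"
    if "i < N" for i using s that by (auto simp: open_simple_def)
  then have nz: "dir N v i \<noteq> 0" if "i < N" for i using that by fastforce
  have fold: False if i: "i < N" and xy: "0 \<le> x" "x < 1" "0 \<le> y" "y < 1"
      and eq: "edge_pt N v i x = edge_pt N v (Suc i mod N) y" for i x y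
  proof -
    let ?j = "Suc i mod N" let ?a = "dir N v i" let ?b = "dir N v ?j"
    have "(1 - x) *\<^sub>R ?a = - (y *\<^sub>R ?b)"
      using eq by (simp add: edge_pt_def dir_def[of N v i] algebra_simps)
    moreover have "?a = (1 / (1 - x)) *\<^sub>R ((1 - x) *\<^sub>R ?a)" using xy by simp
    ultimately have "?a = (1 / (1 - x)) *\<^sub>R (- (y *\<^sub>R ?b))" by (simp only:)
    then have "?a = - (y / (1 - x)) *\<^sub>R ?b" by simp
    moreover have "y / (1 - x) \<ge> 0" using xy by simp
    ultimately obtain l where l: "l \<ge> 0" "?a = - l *\<^sub>R ?b" by blast
    then have "norm ?a * norm ?b + ?a \<bullet> ?b = 0"
      by (simp add: power2_norm_eq_inner[symmetric] power2_eq_square)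
    with angle[OF i] show False by simp
  qed
  show ?thesis
    unfolding simple_polygon_iff[OF N0]
  proof (intro allI impI)
    fix i j x y
    assume ij: "i < N" "j < N" and xy: "0 \<le> x \<and> x < 1 \<and> 0 \<le> y \<and> y < 1 \<and> edge_pt N v i x = edge_pt N v j y"
    have "i = j"
    proof (rule ccontr)
      assume ne: "i \<noteq> j"
      show False
      proof (cases "adjacent N i j")
        case True
        then show ?thesis using fold[of i x y] fold[of j y x] ij xy by (auto simp: adjacent_def)
      next
        case False
        then have "edge N v i \<inter> edge N v j = {}" using s ij ne by (auto simp: open_simple_def)
        moreover have "edge_pt N v i x \<in> edge N v i" "edge_pt N v j y \<in> edge N v j"
          using xy edge_pt_in_edge[of x N v i] edge_pt_in_edge[of y N v j] by simp_all
        ultimately show ?thesis using xy by auto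
      qed
    qed
    moreover from this xy nz[OF ij(1)] have "x = y" by (simp add: edge_pt_def)
    ultimately show "i = j \<and> x = y" by blast
  qed
qed

lemma continuous_on_coord [continuous_intros]: "continuous_on S (\<lambda>v::nat \<Rightarrow> real^2. v k)"
  by (rule continuous_on_subset[OF continuous_on_product_coordinates]) simp

text \<open>
  Disjoint compact segments have a positive distance, which survives a small perturbation.
\<close>

lemma open_disjoint_edges: "open {v. edge N v i \<inter> edge N v j = {}}"
proof (subst open_subopen, clarify)
  fix v assume dis: "edge N v i \<inter> edge N v j = {}"
  obtain d where d: "d > 0" "\<And>x y. x \<in> edge N v i \<Longrightarrow> y \<in> edge N v j \<Longrightarrow> d \<le> dist x y"
    using separate_compact_closed[of "edge N v i" "edge N v j"] dis by (auto simp: edge_def)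
  define T where "T = {u. \<forall>k\<in>{i, Suc i mod N, j, Suc j mod N}. dist (u k) (v k) < d / 2}"
  have close: "dist (edge_pt N u k x) (edge_pt N v k x) < d / 2"
    if "dist (u k) (v k) < d / 2" "dist (u (Suc k mod N)) (v (Suc k mod N)) < d / 2" "0 \<le> x" "x \<le> 1" for u k x
  proof -
    have "edge_pt N u k x - edge_pt N v k x = (1 - x) *\<^sub>R (u k - v k) + x *\<^sub>R (u (Suc k mod N) - v (Suc k mod N))"
      by (simp add: edge_pt_def dir_def algebra_simps)
    then have "norm (edge_pt N u k x - edge_pt N v k x) \<le> (1 - x) * norm (u k - v k) + x * norm (u (Suc k mod N) - v (Suc k mod N))"
      using that(3,4) norm_triangle_ineq[of "(1 - x) *\<^sub>R (u k - v k)" "x *\<^sub>R (u (Suc k mod N) - v (Suc k mod N))"] by simp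
    also have "\<dots> < d / 2"
      using that by (intro convex_bound_lt) (auto simp: dist_norm)
    finally show ?thesis by (simp add: dist_norm)
  qed
  have "open T"
  proof -
    have "T = (\<Inter>k\<in>{i, Suc i mod N, j, Suc j mod N}. {u. dist (u k) (v k) < d / 2})"
      by (auto simp: T_def)
    moreover have "open {u. dist (u k) (v k) < d / 2}" for k
      by (intro open_Collect_less continuous_intros)
    ultimately show ?thesis by (simp add: open_INT open_Int)
  qed
  moreover have "v \<in> T" using d by (auto simp: T_def)
  moreover have "T \<subseteq> {v. edge N v i \<inter> edge N v j = {}}"
  proof (clarsimp simp: edge_eq disjoint_iff)
    fix u x y assume u: "u \<in> T" and xy: "0 \<le> x" "x \<le> 1" "0 \<le> y" "y \<le> (1::real)"
      and eq: "edge_pt N u i x = edge_pt N u j y"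
    have "dist (edge_pt N u i x) (edge_pt N v i x) < d / 2" "dist (edge_pt N u j y) (edge_pt N v j y) < d / 2"
      using u xy unfolding T_def by (blast intro: close)+
    then have "dist (edge_pt N v i x) (edge_pt N v j y) < d"
      using eq dist_triangle_half_l by (metis dist_commute)
    moreover have "d \<le> dist (edge_pt N v i x) (edge_pt N v j y)"
      using xy by (intro d(2)) (auto simp: edge_eq)
    ultimately show False by simp
  qed
  ultimately show "\<exists>T. open T \<and> v \<in> T \<and> T \<subseteq> {v. edge N v i \<inter> edge N v j = {}}" by blast
qed

lemma open_open_simple: "open {v. open_simple N v}"
proof -
  have "{v. open_simple N v} =
     (\<Inter>i\<in>{..<N}. {v. 0 < norm (dir N v i) * norm (dir N v (Suc i mod N)) + dir N v i \<bullet> dir N v (Suc i mod N)}) \<inter>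
     (\<Inter>i\<in>{..<N}. \<Inter>j\<in>{j. j < N \<and> i \<noteq> j \<and> \<not> adjacent N i j}. {v. edge N v i \<inter> edge N v j = {}})"
    by (auto simp: open_simple_def)
  also have "open \<dots>"
    by (intro open_Int open_INT finite_lessThan ballI open_Collect_less open_disjoint_edges)
      (auto simp: dir_def intro!: continuous_intros)
  finally show ?thesis .
qed

lemma labeled_polygons_eq:
  assumes "N \<ge> 3" shows "labeled_polygons N = ({..<N} \<rightarrow>\<^sub>E UNIV) \<inter> {v. open_simple N v}"
  unfolding labeled_polygons_def
  using simple_imp_open_simple[OF assms] open_simple_imp_simple[OF assms] by blast

text \<open>
  The topology of the space of \<open>N\<close>-gons is inherited from that of all functions: the functions
  with undefined values off \<open>{..<N}\<close> embed continuously.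
\<close>

lemma openin_vertex_space:
  fixes N :: nat
  assumes "open W"
  shows "openin (product_topology (\<lambda>_. euclidean :: (real^2) topology) {..<N}) (({..<N} \<rightarrow>\<^sub>E UNIV) \<inter> W)"
proof -
  let ?X = "product_topology (\<lambda>_. euclidean :: (real^2) topology) {..<N::nat}"
  have "continuous_map ?X (euclidean :: (real^2) topology) (\<lambda>v::nat \<Rightarrow> real^2. v k)" for k :: nat
  proof (cases "k < N")
    case True
    then show ?thesis
      using continuous_map_product_projection[of k "{..<N}" "\<lambda>_. euclidean :: (real^2) topology"] by simp
  next
    case False
    have "continuous_map ?X (euclidean :: (real^2) topology) (\<lambda>v. undefined)" by simp
    then show ?thesis
      by (rule continuous_map_eq) (use False in \<open>auto simp: PiE_def extensional_def\<close>)
  qed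
  then have "continuous_map ?X (euclidean :: (nat \<Rightarrow> real^2) topology) (\<lambda>v. v)"
    by (metis continuous_map_componentwise_UNIV euclidean_product_topology)
  from openin_continuous_map_preimage[OF this, of W] assms
  have "openin ?X {x \<in> topspace ?X. x \<in> W}" by simp
  moreover have "{x \<in> topspace ?X. x \<in> W} = ({..<N} \<rightarrow>\<^sub>E UNIV) \<inter> W" by auto
  ultimately show ?thesis by simp
qed

section \<open>Generic polygons\<close>

inductive_set vpoly :: "nat \<Rightarrow> ((nat \<Rightarrow> real^2) \<Rightarrow> real) set" for N where
  const: "(\<lambda>_. c) \<in> vpoly N"
| coord: "k < N \<Longrightarrow> (\<lambda>v. v k $ i) \<in> vpoly N"
| add: "f \<in> vpoly N \<Longrightarrow> g \<in> vpoly N \<Longrightarrow> (\<lambda>v. f v + g v) \<in> vpoly N"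
| mult: "f \<in> vpoly N \<Longrightarrow> g \<in> vpoly N \<Longrightarrow> (\<lambda>v. f v * g v) \<in> vpoly N"

lemma vpoly_minus: "f \<in> vpoly N \<Longrightarrow> (\<lambda>v. - f v) \<in> vpoly N"
  using vpoly.mult[OF vpoly.const[of "-1"]] by simp

lemma vpoly_diff: "f \<in> vpoly N \<Longrightarrow> g \<in> vpoly N \<Longrightarrow> (\<lambda>v. f v - g v) \<in> vpoly N"
  using vpoly.add[OF _ vpoly_minus] by simp

lemma vpoly_power2: "f \<in> vpoly N \<Longrightarrow> (\<lambda>v. (f v)\<^sup>2) \<in> vpoly N"
  by (simp add: power2_eq_square vpoly.mult)

lemmas vpoly_intros = vpoly.intros vpoly_minus vpoly_diff vpoly_power2

lemma vpoly_continuous: "G \<in> vpoly N \<Longrightarrow> continuous_on UNIV G"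
  by (induction rule: vpoly.induct) (auto intro!: continuous_intros)

text \<open>
  Restricted to \<open>{..<N}\<close>, so that the segment stays in the space of extensional functions.
\<close>

definition segment_to :: "nat \<Rightarrow> (nat \<Rightarrow> real^2) \<Rightarrow> (nat \<Rightarrow> real^2) \<Rightarrow> real \<Rightarrow> nat \<Rightarrow> real^2" where
  "segment_to N v w s = (\<lambda>k\<in>{..<N}. v k + s *\<^sub>R (w k - v k))"

lemma vpoly_on_segment:
  "G \<in> vpoly N \<Longrightarrow> \<exists>p. \<forall>s. G (segment_to N v w s) = poly p s"
proof (induction rule: vpoly.induct)
  case (const c)
  show ?case by (intro exI[of _ "[:c:]"]) simp
next
  case (coord k i)
  then show ?case
    by (intro exI[of _ "[:v k $ i, w k $ i - v k $ i:]"]) (simp add: segment_to_def)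
next
  case (add f g)
  then obtain p q where "\<forall>s. f (segment_to N v w s) = poly p s" "\<forall>s. g (segment_to N v w s) = poly q s" by blast
  then show ?case by (intro exI[of _ "p + q"]) simp
next
  case (mult f g)
  then obtain p q where "\<forall>s. f (segment_to N v w s) = poly p s" "\<forall>s. g (segment_to N v w s) = poly q s" by blast
  then show ?case by (intro exI[of _ "p * q"]) simp
qed

lemma vpoly_cong: "G \<in> vpoly N \<Longrightarrow> (\<And>k. k < N \<Longrightarrow> u k = w k) \<Longrightarrow> G u = G w"
  by (induction rule: vpoly.induct) auto

text \<open>
  On the segment towards a point where \<open>G\<close> does not vanish, \<open>G\<close> is a nonzero polynomial in one
  variable, so it is nonzero arbitrarily close to the start.
\<close>

lemma vpoly_perturb:
  fixes N :: nat
  assumes T: "openin (product_topology (\<lambda>_. euclidean :: (real^2) topology) {..<N}) T" "v \<in> T"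
    and G: "G \<in> vpoly N" "G w \<noteq> 0"
  obtains u where "u \<in> T" "G u \<noteq> 0"
proof -
  let ?X = "product_topology (\<lambda>_. euclidean :: (real^2) topology) {..<N}"
  have cm: "continuous_map euclideanreal ?X (segment_to N v w)"
    unfolding continuous_map_componentwise segment_to_def
    by (auto simp: restrict_def extensional_def intro!: continuous_intros)
  have vX: "v \<in> topspace ?X" using openin_subset[OF T(1)] T(2) by blast
  have v0: "segment_to N v w 0 = v"
    using vX by (auto simp: segment_to_def PiE_iff extensional_def fun_eq_iff)
  have "open {s. segment_to N v w s \<in> T}"
    using openin_continuous_map_preimage[OF cm T(1)] by simp
  moreover have "0 \<in> {s. segment_to N v w s \<in> T}" using v0 T(2) by simp
  ultimately obtain e where e: "e > 0" "ball 0 e \<subseteq> {s. segment_to N v w s \<in> T}"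
    by (meson open_contains_ball)
  obtain p where p: "\<forall>s. G (segment_to N v w s) = poly p s"
    using vpoly_on_segment[OF G(1)] by blast
  have "G (segment_to N v w 1) = G w"
    by (rule vpoly_cong[OF G(1)]) (simp add: segment_to_def)
  then have "p \<noteq> 0" using p G(2) by auto
  then have "finite {s. poly p s = 0}" by (rule poly_roots_finite)
  moreover have "infinite {0<..<e}" using e(1) by simp
  ultimately obtain s where "s \<in> {0<..<e}" "poly p s \<noteq> 0"
    by (metis (mono_tags, lifting) finite_subset mem_Collect_eq subsetI)
  then have "segment_to N v w s \<in> T" "G (segment_to N v w s) \<noteq> 0"
    using e p by (auto simp: subset_iff dist_norm)
  then show ?thesis using that by blast
qed

lemma vpoly_perturb_finite:
  fixes N :: nat
  assumes "finite \<G>" "\<G> \<subseteq> vpoly N" "\<And>G. G \<in> \<G> \<Longrightarrow> \<exists>w. G w \<noteq> 0"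
    and "openin (product_topology (\<lambda>_. euclidean :: (real^2) topology) {..<N}) T" "v \<in> T"
  shows "\<exists>u\<in>T. \<forall>G\<in>\<G>. G u \<noteq> 0"
  using assms(1-3)
proof (induction \<G> rule: finite_induct)
  case empty
  then show ?case using assms(5) by auto
next
  case (insert G \<G>)
  then obtain u where u: "u \<in> T" "\<forall>G\<in>\<G>. G u \<noteq> 0" by auto
  let ?X = "product_topology (\<lambda>_. euclidean :: (real^2) topology) {..<N}"
  define W where "W = (\<Inter>G\<in>\<G>. {v. G v \<noteq> 0})"
  have "open W"
    unfolding W_def using insert.hyps(1) insert.prems(1)
    by (intro open_INT ballI open_Collect_neq vpoly_continuous continuous_on_const) auto
  then have "openin ?X (T \<inter> (({..<N} \<rightarrow>\<^sub>E UNIV) \<inter> W))"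
    using assms(4) openin_vertex_space by blast
  moreover have "u \<in> T \<inter> (({..<N} \<rightarrow>\<^sub>E UNIV) \<inter> W)"
    using u openin_subset[OF assms(4)] by (auto simp: W_def)
  moreover obtain w where "G w \<noteq> 0" "G \<in> vpoly N" using insert.prems by auto
  ultimately obtain u' where "u' \<in> T \<inter> (({..<N} \<rightarrow>\<^sub>E UNIV) \<inter> W)" "G u' \<noteq> 0"
    using vpoly_perturb by metis
  then show ?case by (auto simp: W_def)
qed

text \<open>
  Polygons form an open set in the space of vertex functions, so perturbations of a polygon remain
  polygons.
\<close>

lemma open_dense_nonvanishing:
  assumes N: "N \<ge> 3" and fin: "finite \<G>" and sub: "\<G> \<subseteq> vpoly N" and nz: "\<And>G. G \<in> \<G> \<Longrightarrow> \<exists>w. G w \<noteq> 0"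
  defines "P \<equiv> {v \<in> labeled_polygons N. \<forall>G\<in>\<G>. G v \<noteq> 0}"
  shows "openin (polygon_space N) P" "polygon_space N closure_of P = topspace (polygon_space N)"
proof -
  let ?X = "product_topology (\<lambda>_. euclidean :: (real^2) topology) {..<N}"
  have L: "openin ?X (labeled_polygons N)"
    unfolding labeled_polygons_eq[OF N] by (intro openin_vertex_space open_open_simple)
  have W: "open (\<Inter>G\<in>\<G>. {v. G v \<noteq> 0})"
    using fin sub by (intro open_INT ballI open_Collect_neq vpoly_continuous continuous_on_const) auto
  have "P = labeled_polygons N \<inter> (({..<N} \<rightarrow>\<^sub>E UNIV) \<inter> (\<Inter>G\<in>\<G>. {v. G v \<noteq> 0}))"
    by (auto simp: P_def labeled_polygons_def)
  then have "openin ?X P" using L openin_vertex_space[OF W] by auto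
  moreover have "P \<subseteq> labeled_polygons N" by (auto simp: P_def)
  ultimately show "openin (polygon_space N) P"
    unfolding polygon_space_def by (simp add: L openin_open_subtopology)
  show "polygon_space N closure_of P = topspace (polygon_space N)"
    unfolding dense_intersects_open
  proof (intro allI impI)
    fix T assume T: "openin (polygon_space N) T \<and> T \<noteq> {}"
    then have "openin ?X T" and TL: "T \<subseteq> labeled_polygons N"
      unfolding polygon_space_def by (auto simp: L openin_open_subtopology)
    moreover obtain v where "v \<in> T" using T by auto
    ultimately obtain u where "u \<in> T" "\<forall>G\<in>\<G>. G u \<noteq> 0"
      using vpoly_perturb_finite[OF fin sub nz] by blast
    then show "P \<inter> T \<noteq> {}" using TL by (auto simp: P_def)
  qed
qed

subsection \<open>The polynomials\<close>

text \<open>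
  For a nondegenerate edge \<open>k\<close> this vanishes exactly when \<open>q\<close> is on its line.
\<close>

definition side :: "nat \<Rightarrow> (nat \<Rightarrow> real^2) \<Rightarrow> nat \<Rightarrow> real^2 \<Rightarrow> real" where
  "side N v k q = cross2 (dir N v k) (v k - q)"

text \<open>
  The coefficients of the quadratic for a rectangle with corner 0 at \<open>q\<close> and corners 1, 2, 3 on the
  edges \<open>a\<close>, \<open>b\<close>, \<open>c\<close>, followed by minus their derivatives when \<open>q\<close> moves along edge \<open>k\<close>.
\<close>

definition ptA where "ptA N v q a b c =
  quadA (dir N v a) (dir N v b) (dir N v c) (side N v a q) (side N v b q) (side N v c q)"
definition ptB where "ptB N v q a b c =
  quadB (dir N v a) (dir N v b) (dir N v c) (side N v a q) (side N v b q) (side N v c q)"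
definition ptC where "ptC N v q a b c =
  quadC (dir N v a) (dir N v b) (dir N v c) (side N v a q) (side N v b q) (side N v c q)"

definition dirA where "dirA N v k a b c = quadA (dir N v a) (dir N v b) (dir N v c)
  (cross2 (dir N v a) (dir N v k)) (cross2 (dir N v b) (dir N v k)) (cross2 (dir N v c) (dir N v k))"
definition dirB where "dirB N v k a b c = quadB (dir N v a) (dir N v b) (dir N v c)
  (cross2 (dir N v a) (dir N v k)) (cross2 (dir N v b) (dir N v k)) (cross2 (dir N v c) (dir N v k))"
definition dirC where "dirC N v k a b c = quadC (dir N v a) (dir N v b) (dir N v c)
  (cross2 (dir N v a) (dir N v k)) (cross2 (dir N v b) (dir N v k)) (cross2 (dir N v c) (dir N v k))"

text \<open>
  The conditions of genericity. In this order: nonparallel edges; chords between vertices are neither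
  perpendicular nor parallel to edges; midpoints of such chords are not on lines of edges; simple roots when a
  corner is at a vertex; no square with a corner at a vertex; three minors and the resultant of the
  two quadratics of an edge, which exclude a common root; no rectangle with two corners, adjacent or
  opposite, at vertices.
\<close>

definition g_cross where "g_cross N k l v = cross2 (dir N v k) (dir N v l)"
definition g_perp where "g_perp N k i j v = dir N v k \<bullet> (v i - v j)"
definition g_par where "g_par N k i j v = cross2 (dir N v k) (v i - v j)"
definition g_mid where "g_mid N k i j v = side N v k (v i) + side N v k (v j)"
definition g_disc where "g_disc N j a b c v = (ptB N v (v j) a b c)\<^sup>2 - 4 * ptA N v (v j) a b c * ptC N v (v j) a b c"
definition g_square where "g_square N j a b c v = ptA N v (v j) a b c + ptB N v (v j) a b c + ptC N v (v j) a b c"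
definition g_minAB where "g_minAB N k a b c v = ptA N v (v k) a b c * dirB N v k a b c - ptB N v (v k) a b c * dirA N v k a b c"
definition g_minBC where "g_minBC N k a b c v = ptB N v (v k) a b c * dirC N v k a b c - ptC N v (v k) a b c * dirB N v k a b c"
definition g_minAC where "g_minAC N k a b c v = ptA N v (v k) a b c * dirC N v k a b c - ptC N v (v k) a b c * dirA N v k a b c"
definition g_res where "g_res N k a b c v = (g_minAC N k a b c v)\<^sup>2 - g_minAB N k a b c v * g_minBC N k a b c v"
definition g_adj where "g_adj N i j a b v =
  side N v a (v j) * (dir N v b \<bullet> (v j - v i)) - side N v b (v i) * (dir N v a \<bullet> (v j - v i))"
definition g_diag where "g_diag N i j a b v =
  (let w = side N v a (v i) *\<^sub>R dir N v b + side N v b (v j) *\<^sub>R dir N v a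
   in cross2 (dir N v a) (dir N v b) * ((v j - v i) \<bullet> w) - w \<bullet> w)"

definition gens :: "nat \<Rightarrow> ((nat \<Rightarrow> real^2) \<Rightarrow> real) set" where
  "gens N = (\<Union>i<N. \<Union>j<N. \<Union>k<N. \<Union>l<N.
     {g_cross N i j, g_perp N k i j, g_par N k i j, g_mid N k i j, g_disc N i j k l, g_square N i j k l,
      g_minAB N i j k l, g_minBC N i j k l, g_res N i j k l, g_adj N i j k l, g_diag N i j k l})"

text \<open>
  For degenerate index patterns some of these polynomials are identically zero; there the condition is
  void, and the finite family can be indexed uniformly.
\<close>

definition generic :: "nat \<Rightarrow> (nat \<Rightarrow> real^2) \<Rightarrow> bool" where
  "generic N v \<longleftrightarrow> v \<in> labeled_polygons N \<and> (\<forall>G\<in>gens N. (\<exists>w. G w \<noteq> 0) \<longrightarrow> G v \<noteq> 0)"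

lemma gens_vpoly:
  assumes "N > 0" shows "gens N \<subseteq> vpoly N"
proof -
  have d: "(\<lambda>v. dir N v k $ i) \<in> vpoly N" if "k < N" for k i
    using that assms by (simp add: dir_def vpoly_intros)
  note defs = side_def cross2_def inner2 ptA_def ptB_def ptC_def dirA_def dirB_def dirC_def quadA_def quadB_def
    quadC_def g_cross_def g_perp_def g_par_def g_mid_def g_disc_def g_square_def g_minAB_def g_minBC_def
    g_minAC_def g_res_def g_adj_def g_diag_def Let_def vector_minus_component vector_add_component vector_scaleR_component real_scaleR_def
  have "g_cross N i j \<in> vpoly N" "g_perp N k i j \<in> vpoly N" "g_par N k i j \<in> vpoly N" "g_mid N k i j \<in> vpoly N"
    "g_disc N i j k l \<in> vpoly N" "g_square N i j k l \<in> vpoly N" "g_minAB N i j k l \<in> vpoly N" "g_minBC N i j k l \<in> vpoly N"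
    "g_res N i j k l \<in> vpoly N" "g_adj N i j k l \<in> vpoly N" "g_diag N i j k l \<in> vpoly N"
    if "i < N" "j < N" "k < N" "l < N" for i j k l
    unfolding defs[abs_def] by (intro vpoly_intros d that)+
  then show ?thesis
    unfolding gens_def by (intro UN_least) (simp only: lessThan_iff insert_subset empty_subsetI simp_thms)
qed

lemma open_dense_generic:
  assumes "N \<ge> 3"
  shows "openin (polygon_space N) {v. generic N v}"
    "polygon_space N closure_of {v. generic N v} = topspace (polygon_space N)"
proof -
  have "finite (gens N)" by (simp add: gens_def)
  then have fin: "finite {G \<in> gens N. \<exists>w. G w \<noteq> 0}" by simp
  have sub: "{G \<in> gens N. \<exists>w. G w \<noteq> 0} \<subseteq> vpoly N" using gens_vpoly[of N] assms by fastforce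
  have eq: "{v. generic N v} = {v \<in> labeled_polygons N. \<forall>G\<in>{G \<in> gens N. \<exists>w. G w \<noteq> 0}. G v \<noteq> 0}"
    unfolding generic_def by blast
  show "openin (polygon_space N) {v. generic N v}"
    unfolding eq by (rule open_dense_nonvanishing[OF assms fin sub]) blast
  show "polygon_space N closure_of {v. generic N v} = topspace (polygon_space N)"
    unfolding eq by (rule open_dense_nonvanishing[OF assms fin sub]) blast
qed

subsection \<open>Polygons whose sides are tangent to a parabola\<close>

text \<open>
  Vertex \<open>k\<close> is on the edges \<open>prv N k\<close> and \<open>k\<close>.
\<close>

definition prv :: "nat \<Rightarrow> nat \<Rightarrow> nat" where
  "prv N k = (k + N - 1) mod N"

lemma prv_less: "N > 0 \<Longrightarrow> prv N k < N"
  by (simp add: prv_def)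

lemma prv_Suc: "k < N \<Longrightarrow> prv N (Suc k mod N) = k"
  by (cases "Suc k = N") (auto simp: prv_def)

lemma Suc_prv: "k < N \<Longrightarrow> Suc (prv N k) mod N = k"
  by (cases k) (auto simp: prv_def)

lemma prv_neq: "N \<ge> 3 \<Longrightarrow> k < N \<Longrightarrow> prv N k \<noteq> k" "N \<ge> 3 \<Longrightarrow> k < N \<Longrightarrow> prv N k \<noteq> Suc k mod N"
  by (cases k; auto simp: prv_def mod_Suc)+

lemma prv_inj: "i < N \<Longrightarrow> j < N \<Longrightarrow> prv N i = prv N j \<Longrightarrow> i = j"
  by (metis Suc_prv)

lemma prv_prv: "N \<ge> 3 \<Longrightarrow> i < N \<Longrightarrow> j < N \<Longrightarrow> i = prv N j \<Longrightarrow> prv N i \<noteq> j"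
  by (metis Suc_prv prv_neq(2) prv_less less_le_trans zero_less_numeral)

definition slope_vec :: "real \<Rightarrow> real^2" where "slope_vec x = vector [1, x]"

lemma slope_vec_nth [simp]: "slope_vec x $ 1 = 1" "slope_vec x $ 2 = x"
  by (simp_all add: slope_vec_def)

lemma cross2_slope: "cross2 (slope_vec x) (slope_vec y) = y - x"
  and inner_slope: "slope_vec x \<bullet> slope_vec y = 1 + x * y"
  by (simp_all add: plane_simps)

text \<open>
  The line \<open>y = m x - m\<^sup>2\<close> is tangent to \<open>4 y = x\<^sup>2\<close>; the tangents of slopes \<open>m\<close> and \<open>n\<close>
  meet at \<open>(m + n, m n)\<close>. Edge \<open>k\<close> of the following polygon lies on the tangent of slope \<open>m k\<close>.
\<close>

definition tangent_polygon :: "nat \<Rightarrow> (nat \<Rightarrow> real) \<Rightarrow> nat \<Rightarrow> real^2" where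
  "tangent_polygon N m k = vector [m (prv N k) + m k, m (prv N k) * m k]"

text \<open>
  The direction of edge \<open>k\<close> is this multiple of \<open>(1, m k)\<close>. The polynomials are homogeneous in each edge,
  so these factors come out.
\<close>

definition tsc :: "nat \<Rightarrow> (nat \<Rightarrow> real) \<Rightarrow> nat \<Rightarrow> real" where
  "tsc N m k = m (Suc k mod N) - m (prv N k)"

lemma tangent_nth [simp]: "tangent_polygon N m k $ 1 = m (prv N k) + m k"
  "tangent_polygon N m k $ 2 = m (prv N k) * m k"
  by (simp_all add: tangent_polygon_def)

lemma tsc_nz: "N \<ge> 3 \<Longrightarrow> inj m \<Longrightarrow> k < N \<Longrightarrow> tsc N m k \<noteq> 0"
  using prv_neq(2)[of N k] by (auto simp: tsc_def inj_def)

lemma dir_tangent: "k < N \<Longrightarrow> dir N (tangent_polygon N m) k = tsc N m k *\<^sub>R slope_vec (m k)"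
  by (simp add: dir_def eq2_iff prv_Suc tsc_def algebra_simps)

lemma side_tangent: "k < N \<Longrightarrow> side N (tangent_polygon N m) k (tangent_polygon N m j) =
    tsc N m k * (- ((m k - m (prv N j)) * (m k - m j)))"
  unfolding side_def by (simp add: dir_tangent) (simp add: cross2_def algebra_simps)

lemma quad_tangent:
  "quadA (x *\<^sub>R slope_vec m1) (y *\<^sub>R slope_vec m2) (z *\<^sub>R slope_vec m3) (x * e1) (y * e2) (z * e3) = (x * y * z) * (e1 * (m3 - m2))"
  "quadB (x *\<^sub>R slope_vec m1) (y *\<^sub>R slope_vec m2) (z *\<^sub>R slope_vec m3) (x * e1) (y * e2) (z * e3) =
     (x * y * z) * (- e1 * (1 + m2 * m3) + e2 * (1 + m1 * m3) - e3 * (1 + m1 * m2))"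
  "quadC (x *\<^sub>R slope_vec m1) (y *\<^sub>R slope_vec m2) (z *\<^sub>R slope_vec m3) (x * e1) (y * e2) (z * e3) = (x * y * z) * (e3 * (m2 - m1))"
  by (simp_all add: quadA_def quadB_def quadC_def cross2_simps cross2_slope inner_slope inner_simps algebra_simps)

text \<open>
  The quadratic coefficients of a tangent polygon without the homogeneity factors, as functions of the
  slopes; \<open>tE m s t\<close> measures the vertex on the tangents of slopes \<open>s\<close>, \<open>t\<close> against the tangent of
  slope \<open>m\<close>.
\<close>

definition tA :: "real \<Rightarrow> real \<Rightarrow> real \<Rightarrow> real \<Rightarrow> real \<Rightarrow> real \<Rightarrow> real" where "tA m1 m2 m3 e1 e2 e3 = e1 * (m3 - m2)"
definition tB :: "real \<Rightarrow> real \<Rightarrow> real \<Rightarrow> real \<Rightarrow> real \<Rightarrow> real \<Rightarrow> real" where "tB m1 m2 m3 e1 e2 e3 = - e1 * (1 + m2 * m3) + e2 * (1 + m1 * m3) - e3 * (1 + m1 * m2)"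
definition tC :: "real \<Rightarrow> real \<Rightarrow> real \<Rightarrow> real \<Rightarrow> real \<Rightarrow> real \<Rightarrow> real" where "tC m1 m2 m3 e1 e2 e3 = e3 * (m2 - m1)"
definition tE :: "real \<Rightarrow> real \<Rightarrow> real \<Rightarrow> real" where "tE m s t = - ((m - s) * (m - t))"

lemmas t_defs = tA_def tB_def tC_def tE_def

context
  fixes N :: nat and m :: "nat \<Rightarrow> real" and w T
  defines "w \<equiv> tangent_polygon N m" and "T \<equiv> tsc N m"
begin

lemma pt_tangent:
  assumes "a < N" "b < N" "c < N"
  shows "ptA N w (w j) a b c = (T a * T b * T c) * tA (m a) (m b) (m c)
     (tE (m a) (m (prv N j)) (m j)) (tE (m b) (m (prv N j)) (m j)) (tE (m c) (m (prv N j)) (m j))"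
  "ptB N w (w j) a b c = (T a * T b * T c) * tB (m a) (m b) (m c)
     (tE (m a) (m (prv N j)) (m j)) (tE (m b) (m (prv N j)) (m j)) (tE (m c) (m (prv N j)) (m j))"
  "ptC N w (w j) a b c = (T a * T b * T c) * tC (m a) (m b) (m c)
     (tE (m a) (m (prv N j)) (m j)) (tE (m b) (m (prv N j)) (m j)) (tE (m c) (m (prv N j)) (m j))"
  using assms by (simp_all only: ptA_def ptB_def ptC_def w_def T_def dir_tangent side_tangent quad_tangent t_defs)

lemma dir_poly_tangent:
  assumes "k < N" "a < N" "b < N" "c < N"
  shows "dirA N w k a b c = (T a * T b * T c) * (T k * tA (m a) (m b) (m c) (m k - m a) (m k - m b) (m k - m c))"
  "dirB N w k a b c = (T a * T b * T c) * (T k * tB (m a) (m b) (m c) (m k - m a) (m k - m b) (m k - m c))"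
  "dirC N w k a b c = (T a * T b * T c) * (T k * tC (m a) (m b) (m c) (m k - m a) (m k - m b) (m k - m c))"
proof -
  have c: "cross2 (T x *\<^sub>R slope_vec (m x)) (T k *\<^sub>R slope_vec (m k)) = T x * (T k * (m k - m x))" for x
    by (simp add: cross2_simps cross2_slope)
  show "dirA N w k a b c = (T a * T b * T c) * (T k * tA (m a) (m b) (m c) (m k - m a) (m k - m b) (m k - m c))"
    "dirB N w k a b c = (T a * T b * T c) * (T k * tB (m a) (m b) (m c) (m k - m a) (m k - m b) (m k - m c))"
    "dirC N w k a b c = (T a * T b * T c) * (T k * tC (m a) (m b) (m c) (m k - m a) (m k - m b) (m k - m c))"
    using assms c
    by (simp_all only: dirA_def dirB_def dirC_def w_def dir_tangent T_def[symmetric] quad_tangent t_defs)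
      (simp_all add: algebra_simps)
qed

text \<open>
  Adding to the value at a vertex a multiple of the part along the edge does not change the minors,
  so the vertex may be replaced by the point of tangency.
\<close>

lemma minors_tangent:
  assumes "k < N" "a < N" "b < N" "c < N"
  defines "e \<equiv> \<lambda>x. - (m x - m k)\<^sup>2" and "f \<equiv> \<lambda>x. m k - m x" and "S \<equiv> (T a * T b * T c)\<^sup>2 * T k"
  shows "g_minAB N k a b c w = S *
     (tA (m a) (m b) (m c) (e a) (e b) (e c) * tB (m a) (m b) (m c) (f a) (f b) (f c)
      - tB (m a) (m b) (m c) (e a) (e b) (e c) * tA (m a) (m b) (m c) (f a) (f b) (f c))"
  "g_minBC N k a b c w = S *
     (tB (m a) (m b) (m c) (e a) (e b) (e c) * tC (m a) (m b) (m c) (f a) (f b) (f c)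
      - tC (m a) (m b) (m c) (e a) (e b) (e c) * tB (m a) (m b) (m c) (f a) (f b) (f c))"
  "g_minAC N k a b c w = S *
     (tA (m a) (m b) (m c) (e a) (e b) (e c) * tC (m a) (m b) (m c) (f a) (f b) (f c)
      - tC (m a) (m b) (m c) (e a) (e b) (e c) * tA (m a) (m b) (m c) (f a) (f b) (f c))"
proof -
  define l where "l = m k - m (prv N k)"
  have E: "tE (m x) (m (prv N k)) (m k) = e x + l * f x" for x
    by (simp add: tE_def e_def f_def l_def power2_eq_square algebra_simps)
  have lin: "tA m1 m2 m3 (e a + l * f a) (e b + l * f b) (e c + l * f c) = tA m1 m2 m3 (e a) (e b) (e c) + l * tA m1 m2 m3 (f a) (f b) (f c)"
    "tB m1 m2 m3 (e a + l * f a) (e b + l * f b) (e c + l * f c) = tB m1 m2 m3 (e a) (e b) (e c) + l * tB m1 m2 m3 (f a) (f b) (f c)"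
    "tC m1 m2 m3 (e a + l * f a) (e b + l * f b) (e c + l * f c) = tC m1 m2 m3 (e a) (e b) (e c) + l * tC m1 m2 m3 (f a) (f b) (f c)" for m1 m2 m3
    by (simp_all add: tA_def tB_def tC_def algebra_simps)
  have alg: "s * (x + l * x') * (s * (t * y')) - s * (y + l * y') * (s * (t * x')) = s\<^sup>2 * t * (x * y' - y * x')" for s t x y x' y' :: real
    by (simp add: power2_eq_square algebra_simps)
  have fk: "m k - m x = f x" for x by (simp add: f_def)
  note d = dir_poly_tangent[OF assms(1-4), unfolded fk]
  show "g_minAB N k a b c w = S *
     (tA (m a) (m b) (m c) (e a) (e b) (e c) * tB (m a) (m b) (m c) (f a) (f b) (f c)
      - tB (m a) (m b) (m c) (e a) (e b) (e c) * tA (m a) (m b) (m c) (f a) (f b) (f c))"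
    by (simp only: g_minAB_def pt_tangent[OF assms(2-4)] d E lin alg S_def)
  show "g_minBC N k a b c w = S *
     (tB (m a) (m b) (m c) (e a) (e b) (e c) * tC (m a) (m b) (m c) (f a) (f b) (f c)
      - tC (m a) (m b) (m c) (e a) (e b) (e c) * tB (m a) (m b) (m c) (f a) (f b) (f c))"
    by (simp only: g_minBC_def pt_tangent[OF assms(2-4)] d E lin alg S_def)
  show "g_minAC N k a b c w = S *
     (tA (m a) (m b) (m c) (e a) (e b) (e c) * tC (m a) (m b) (m c) (f a) (f b) (f c)
      - tC (m a) (m b) (m c) (e a) (e b) (e c) * tA (m a) (m b) (m c) (f a) (f b) (f c))"
    by (simp only: g_minAC_def pt_tangent[OF assms(2-4)] d E lin alg S_def)
qed

end

text \<open>Slopes with prescribed values at up to six slots, of which earlier ones take precedence.\<close>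

definition slots :: "nat \<Rightarrow> nat \<Rightarrow> nat \<Rightarrow> nat \<Rightarrow> nat \<Rightarrow> nat \<Rightarrow> nat \<Rightarrow> real" where
  "slots i j k l a b = (\<lambda>x. real x + 6)(b := 5, a := 4, l := 3, k := 2, j := 1, i := 0)"

lemma inj_slots: "inj (slots i j k l a b)"
  unfolding slots_def by (intro inj_on_fun_updI) (auto simp: inj_def)

lemma slots_at:
  "slots i j k l a b i = 0" "j \<noteq> i \<Longrightarrow> slots i j k l a b j = 1"
  "k \<noteq> i \<Longrightarrow> k \<noteq> j \<Longrightarrow> slots i j k l a b k = 2"
  "l \<noteq> i \<Longrightarrow> l \<noteq> j \<Longrightarrow> l \<noteq> k \<Longrightarrow> slots i j k l a b l = 3"
  "a \<noteq> i \<Longrightarrow> a \<noteq> j \<Longrightarrow> a \<noteq> k \<Longrightarrow> a \<noteq> l \<Longrightarrow> slots i j k l a b a = 4"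
  "b \<noteq> i \<Longrightarrow> b \<noteq> j \<Longrightarrow> b \<noteq> k \<Longrightarrow> b \<noteq> l \<Longrightarrow> b \<noteq> a \<Longrightarrow> slots i j k l a b b = 5"
  by (simp_all add: slots_def)

lemma generic_nonzero:
  assumes "generic N v" "G \<in> gens N" "G w \<noteq> 0" shows "G v \<noteq> 0"
  using assms by (auto simp: generic_def)

lemma mem_gens:
  assumes "i < N" "j < N" "k < N" "l < N"
  shows "g_cross N i j \<in> gens N" "g_perp N k i j \<in> gens N" "g_par N k i j \<in> gens N" "g_mid N k i j \<in> gens N"
    "g_disc N i j k l \<in> gens N" "g_square N i j k l \<in> gens N" "g_minAB N i j k l \<in> gens N" "g_minBC N i j k l \<in> gens N"
    "g_res N i j k l \<in> gens N" "g_adj N i j k l \<in> gens N" "g_diag N i j k l \<in> gens N"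
proof -
  let ?S = "\<lambda>i j k l. {g_cross N i j, g_perp N k i j, g_par N k i j, g_mid N k i j, g_disc N i j k l, g_square N i j k l,
      g_minAB N i j k l, g_minBC N i j k l, g_res N i j k l, g_adj N i j k l, g_diag N i j k l}"
  have "?S i j k l \<subseteq> gens N"
    unfolding gens_def by (intro order_trans[OF _ UN_upper[of i]] order_trans[OF _ UN_upper[of j]]
      order_trans[OF _ UN_upper[of k]] UN_upper) (use assms in simp_all)
  then show "g_cross N i j \<in> gens N" "g_perp N k i j \<in> gens N" "g_par N k i j \<in> gens N" "g_mid N k i j \<in> gens N"
    "g_disc N i j k l \<in> gens N" "g_square N i j k l \<in> gens N" "g_minAB N i j k l \<in> gens N" "g_minBC N i j k l \<in> gens N"
    "g_res N i j k l \<in> gens N" "g_adj N i j k l \<in> gens N" "g_diag N i j k l \<in> gens N"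
    by simp_all
qed

text \<open>
  Here and in \<open>slots_square\<close>, \<open>p\<close> and \<open>j\<close> are the two edges at a vertex and \<open>a\<close>, \<open>b\<close>, \<open>c\<close> the edges of the other
  corners. Small integer slopes witness at once every pattern of coincidences that the assumptions
  leave open; each pattern is a numerical evaluation.
\<close>

lemma slots_disc:
  fixes p j a b c :: nat
  assumes "p \<noteq> j" and H: "\<not> (a = b \<and> b = c)" "a = b \<longrightarrow> a \<notin> {p, j} \<and> c \<notin> {p, j}" "b = c \<longrightarrow> b \<notin> {p, j} \<and> a \<notin> {p, j}"
    "a = c \<longrightarrow> a \<notin> {p, j}" "\<not> (a \<in> {p, j} \<and> c \<in> {p, j})"
  defines "m \<equiv> slots p j a b c 0"
  defines "e \<equiv> \<lambda>x. tE (m x) (m p) (m j)"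
  shows "(tB (m a) (m b) (m c) (e a) (e b) (e c))\<^sup>2 -
    4 * tA (m a) (m b) (m c) (e a) (e b) (e c) * tC (m a) (m b) (m c) (e a) (e b) (e c) \<noteq> 0"
proof -
  have 0: "m p = 0" "m j = 1" using assms(1) by (simp_all add: m_def slots_at)
  have 1: "a = p \<or> a = j \<or> (a \<noteq> p \<and> a \<noteq> j \<and> m a = 2)"
    by (auto simp: m_def slots_def)
  have 2: "b = p \<or> b = j \<or> b = a \<or> (b \<noteq> p \<and> b \<noteq> j \<and> b \<noteq> a \<and> m b = 3)"
    by (auto simp: m_def slots_def)
  have 3: "c = p \<or> c = j \<or> c = a \<or> c = b \<or> (c \<noteq> p \<and> c \<noteq> j \<and> c \<noteq> a \<and> c \<noteq> b \<and> m c = 4)"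
    by (auto simp: m_def slots_def)
  show ?thesis
    using 1 2 3
    apply (elim disjE)
    apply (insert assms(1) H 0)
    apply (simp_all add: e_def t_defs)
    done
qed

lemma slots_square:
  fixes p j a b c :: nat
  assumes "p \<noteq> j" and H: "\<not> (a = b \<and> b = c)" "a = b \<longrightarrow> a \<notin> {p, j} \<and> c \<notin> {p, j}" "b = c \<longrightarrow> b \<notin> {p, j} \<and> a \<notin> {p, j}"
    "a = c \<longrightarrow> a \<notin> {p, j}" "\<not> (a \<in> {p, j} \<and> c \<in> {p, j})"
  defines "m \<equiv> slots p a j b c 0"
  defines "e \<equiv> \<lambda>x. tE (m x) (m p) (m j)"
  shows "tA (m a) (m b) (m c) (e a) (e b) (e c) + tB (m a) (m b) (m c) (e a) (e b) (e c)
    + tC (m a) (m b) (m c) (e a) (e b) (e c) \<noteq> 0"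
proof -
  have 0: "m p = 0"  using assms(1) by (simp_all add: m_def slots_at)
  have 1: "a = p \<or> a = j \<and> m j = 1 \<or> (a \<noteq> p \<and> a \<noteq> j \<and> m a = 1)"
    by (auto simp: m_def slots_def)
  have j2: "a \<noteq> j \<longrightarrow> m j = 2" using assms(1) by (auto simp: m_def slots_def)
  have 2: "b = p \<or> b = j \<or> b = a \<or> (b \<noteq> p \<and> b \<noteq> j \<and> b \<noteq> a \<and> m b = 3)"
    by (auto simp: m_def slots_def)
  have 3: "c = p \<or> c = j \<or> c = a \<or> c = b \<or> (c \<noteq> p \<and> c \<noteq> j \<and> c \<noteq> a \<and> c \<noteq> b \<and> m c = 4)"
    by (auto simp: m_def slots_def)
  show ?thesis
    using 1 2 3
    apply (elim disjE)
    apply (insert assms(1) H 0 j2)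
    apply (simp_all add: e_def t_defs)
    done
qed

text \<open>
  If corners 0 and 1 or corners 2 and 3 share an edge, both quadratics lose their leading coefficient; if
  1 and 2 or 3 and 0 share an edge, they lose the constant one. Then a minor of the remaining
  coefficients takes the role of the resultant.
\<close>

lemma slots_minors:
  fixes k a b c :: nat
  defines "m \<equiv> slots k a b c 0 0"
  defines "e \<equiv> \<lambda>x. - (m x - m k)\<^sup>2" and "f \<equiv> \<lambda>x. m k - m x"
  defines "XA \<equiv> tA (m a) (m b) (m c) (e a) (e b) (e c)" and "XB \<equiv> tB (m a) (m b) (m c) (e a) (e b) (e c)"
    and "XC \<equiv> tC (m a) (m b) (m c) (e a) (e b) (e c)"
    and "YA \<equiv> tA (m a) (m b) (m c) (f a) (f b) (f c)" and "YB \<equiv> tB (m a) (m b) (m c) (f a) (f b) (f c)"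
    and "YC \<equiv> tC (m a) (m b) (m c) (f a) (f b) (f c)"
  shows "k \<noteq> c \<Longrightarrow> b \<noteq> c \<Longrightarrow> k = a \<Longrightarrow> b \<noteq> a \<Longrightarrow> XB * YC - XC * YB \<noteq> 0"
    "k \<noteq> a \<Longrightarrow> k \<noteq> b \<Longrightarrow> a \<noteq> b \<Longrightarrow> b = c \<Longrightarrow> XB * YC - XC * YB \<noteq> 0"
    "k \<noteq> a \<Longrightarrow> k \<noteq> c \<Longrightarrow> a \<noteq> c \<Longrightarrow> a = b \<Longrightarrow> XA * YB - XB * YA \<noteq> 0"
    "k \<noteq> a \<Longrightarrow> k \<noteq> b \<Longrightarrow> a \<noteq> b \<Longrightarrow> k = c \<Longrightarrow> XA * YB - XB * YA \<noteq> 0"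
    "k \<noteq> a \<Longrightarrow> a \<noteq> b \<Longrightarrow> b \<noteq> c \<Longrightarrow> c \<noteq> k \<Longrightarrow> \<not> (k = b \<and> a = c) \<Longrightarrow>
       (XA * YC - XC * YA)\<^sup>2 - (XA * YB - XB * YA) * (XB * YC - XC * YB) \<noteq> 0"
  unfolding XA_def XB_def XC_def YA_def YB_def YC_def e_def f_def m_def
      apply (simp add: slots_at t_defs)
     apply (simp add: slots_at t_defs)
    apply (simp add: slots_at t_defs)
   apply (simp add: slots_at t_defs)
  apply (cases "k = b"; cases "a = c"; simp add: slots_at t_defs)
  done

text \<open>
  From here on \<open>p\<close>, \<open>i\<close> and \<open>q\<close>, \<open>j\<close> are the edges at two vertices; these may be neighbours and share an
  edge.
\<close>

lemma slots_two_vertices: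
  fixes p i q j k :: nat
  assumes "p \<noteq> i" "q \<noteq> j" "i \<noteq> j" "p \<noteq> q" "\<not> (p = j \<and> i = q)"
  defines "m \<equiv> slots p i q j k 0"
  shows "(m p + m i) - (m q + m j) + m k * (m p * m i - m q * m j) \<noteq> 0"
    "\<not> (k \<in> {p, i} \<and> k \<in> {q, j}) \<Longrightarrow> tE (m k) (m p) (m i) - tE (m k) (m q) (m j) \<noteq> 0"
    "\<not> (k \<in> {p, i} \<and> k \<in> {q, j}) \<Longrightarrow> tE (m k) (m p) (m i) + tE (m k) (m q) (m j) \<noteq> 0"
proof -
  have 0: "m p = 0" "m i = 1" using assms(1) by (simp_all add: m_def slots_at)
  have 1: "q = i \<or> (q \<noteq> p \<and> q \<noteq> i \<and> m q = 2)"
    using assms(4) by (auto simp: m_def slots_def)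
  have 2: "j = p \<or> (j \<noteq> p \<and> j \<noteq> i \<and> m j = 3)"
    using assms(2,3) by (auto simp: m_def slots_def)
  have 3: "k = p \<or> k = i \<or> k = q \<or> k = j \<or> (k \<noteq> p \<and> k \<noteq> i \<and> k \<noteq> q \<and> k \<noteq> j \<and> m k = 4)"
    by (auto simp: m_def slots_def)
  show "(m p + m i) - (m q + m j) + m k * (m p * m i - m q * m j) \<noteq> 0"
    using 1 2 3
    apply (elim disjE)
    apply (insert assms(1-5) 0)
    apply simp_all
    done
  assume K: "\<not> (k \<in> {p, i} \<and> k \<in> {q, j})"
  show "tE (m k) (m p) (m i) - tE (m k) (m q) (m j) \<noteq> 0"
    using 1 2 3
    apply (elim disjE)
    apply (insert assms(1-5) 0 K)
    apply (simp_all add: tE_def)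
    done
  show "tE (m k) (m p) (m i) + tE (m k) (m q) (m j) \<noteq> 0"
    using 1 2 3
    apply (elim disjE)
    apply (insert assms(1-5) 0 K)
    apply (simp_all add: tE_def)
    done
qed

lemma slots_adj:
  fixes p i q j a b :: nat
  assumes "p \<noteq> i" "q \<noteq> j" "i \<noteq> j" "p \<noteq> q" "\<not> (p = j \<and> i = q)" "a \<noteq> b" "a \<notin> {q, j}" "b \<notin> {p, i}"
  defines "m \<equiv> slots p i q j a b"
  defines "S \<equiv> (m q + m j) - (m p + m i)" and "P \<equiv> m q * m j - m p * m i"
  shows "tE (m a) (m q) (m j) * (S + m b * P) - tE (m b) (m p) (m i) * (S + m a * P) \<noteq> 0"
proof -
  have 0: "m p = 0" "m i = 1" using assms(1) by (simp_all add: m_def slots_at)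
  have 1: "q = i \<or> (q \<noteq> p \<and> q \<noteq> i \<and> m q = 2)"
    using assms(4) by (auto simp: m_def slots_def)
  have 2: "j = p \<or> (j \<noteq> p \<and> j \<noteq> i \<and> m j = 3)"
    using assms(2,3) by (auto simp: m_def slots_def)
  have 3: "a = p \<or> a = i \<or> (a \<noteq> p \<and> a \<noteq> i \<and> m a = 4)"
    using assms(7) by (auto simp: m_def slots_def)
  have 4: "b = q \<or> b = j \<or> (b \<noteq> q \<and> b \<noteq> j \<and> m b = 5)"
    using assms(6,8) by (auto simp: m_def slots_def)
  show ?thesis
    using 1 2 3 4
    apply (elim disjE)
    apply (insert assms(1-8) 0)
    apply (simp_all add: S_def P_def tE_def)
    done
qed

lemma slots_diag:
  fixes p i q j a b :: nat
  assumes "p \<noteq> i" "q \<noteq> j" "i \<noteq> j" "p \<noteq> q" "\<not> (p = j \<and> i = q)" "a \<noteq> b"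
    and H: "\<not> (a \<in> {p, i} \<and> a \<in> {q, j})" "\<not> (b \<in> {p, i} \<and> b \<in> {q, j})"
    "\<not> (a \<in> {p, i, q, j} \<and> b \<in> {p, i, q, j})"
  defines "m \<equiv> slots p i q j a b"
  defines "S \<equiv> (m q + m j) - (m p + m i)" and "P \<equiv> m q * m j - m p * m i"
    and "e1 \<equiv> tE (m a) (m p) (m i)" and "e3 \<equiv> tE (m b) (m q) (m j)"
  shows "(m b - m a) * (S * (e1 + e3) + P * (e1 * m b + e3 * m a)) - ((e1 + e3)\<^sup>2 + (e1 * m b + e3 * m a)\<^sup>2) \<noteq> 0"
proof -
  have 0: "m p = 0" "m i = 1" using assms(1) by (simp_all add: m_def slots_at)
  have 1: "q = i \<or> (q \<noteq> p \<and> q \<noteq> i \<and> m q = 2)"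
    using assms(4) by (auto simp: m_def slots_def)
  have 2: "j = p \<or> (j \<noteq> p \<and> j \<noteq> i \<and> m j = 3)"
    using assms(2,3) by (auto simp: m_def slots_def)
  have "(a \<notin> {p, i, q, j} \<and> m a = 4 \<and> b \<notin> {p, i, q, j} \<and> m b = 5) \<or>
    (a \<in> {p, i, q, j} \<and> b \<notin> {p, i, q, j} \<and> m b = 5) \<or> (a \<notin> {p, i, q, j} \<and> m a = 4 \<and> b \<in> {p, i, q, j})"
    using H assms(6) by (auto simp: m_def slots_def)
  then have 3: "(m a = 4 \<and> m b = 5) \<or> a = p \<and> m b = 5 \<or> a = i \<and> m b = 5 \<or> a = q \<and> m b = 5 \<or> a = j \<and> m b = 5 \<or>
     m a = 4 \<and> b = p \<or> m a = 4 \<and> b = i \<or> m a = 4 \<and> b = q \<or> m a = 4 \<and> b = j"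
    by auto
  show ?thesis
    using 1 2 3
    apply (elim disjE)
    apply (insert assms(1-5) H(1,2) 0)
    apply (simp_all add: S_def P_def e1_def e3_def tE_def)
    done
qed

subsection \<open>What genericity says\<close>

locale generic_polygon =
  fixes N :: nat and v :: "nat \<Rightarrow> real^2"
  assumes N3: "N \<ge> 3" and gen: "generic N v"
begin

abbreviation "d \<equiv> dir N v"
abbreviation "E \<equiv> edge N v"
abbreviation "e \<equiv> side N v"
abbreviation "\<gamma> \<equiv> polygon_curve N v"
abbreviation "I \<equiv> inscribed_rectangles \<gamma>"

lemma N0: "N > 0" using N3 by simp

lemma tsc_slots_nz: "k < N \<Longrightarrow> tsc N (slots i j x l a b) k \<noteq> 0"
  by (rule tsc_nz[OF N3 inj_slots])

lemma two_vertex_slots: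
  assumes "i < N" "j < N" "i \<noteq> j"
  shows "prv N i \<noteq> i" "prv N j \<noteq> j" "prv N i \<noteq> prv N j" "\<not> (prv N i = j \<and> i = prv N j)"
  using prv_neq(1)[OF N3 assms(1)] prv_neq(1)[OF N3 assms(2)] prv_inj[OF assms(1,2)] prv_prv[OF N3 assms(1,2)] assms(3)
  by auto

lemma cross_nz:
  assumes "k < N" "l < N" "k \<noteq> l" shows "cross2 (d k) (d l) \<noteq> 0"
proof -
  let ?m = "slots k l 0 0 0 0"
  have "g_cross N k l (tangent_polygon N ?m) = tsc N ?m k * (tsc N ?m l * (?m l - ?m k))"
    using assms by (simp add: g_cross_def dir_tangent cross2_simps cross2_slope)
  moreover have "?m l - ?m k \<noteq> 0" using assms inj_slots[unfolded inj_def, of k l 0 0 0 0] by force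
  ultimately have "g_cross N k l (tangent_polygon N ?m) \<noteq> 0" using assms tsc_slots_nz by simp
  from generic_nonzero[OF gen mem_gens(1)[OF assms(1,2) assms(1,2)] this]
  show ?thesis by (simp add: g_cross_def)
qed

lemma perp_nz:
  assumes "k < N" "i < N" "j < N" "i \<noteq> j" shows "d k \<bullet> (v i - v j) \<noteq> 0"
proof -
  let ?m = "slots (prv N i) i (prv N j) j k 0"
  have "g_perp N k i j (tangent_polygon N ?m) = tsc N ?m k *
     ((?m (prv N i) + ?m i) - (?m (prv N j) + ?m j) + ?m k * (?m (prv N i) * ?m i - ?m (prv N j) * ?m j))"
    using assms by (simp add: g_perp_def dir_tangent inner2 distrib_left)
  then have "g_perp N k i j (tangent_polygon N ?m) \<noteq> 0"
    using slots_two_vertices(1)[OF two_vertex_slots(1,2)[OF assms(2-4)] assms(4) two_vertex_slots(3,4)[OF assms(2-4)], of k]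
      assms tsc_slots_nz by simp
  from generic_nonzero[OF gen mem_gens(2)[OF assms(2,3,1,1)] this]
  show ?thesis by (simp add: g_perp_def)
qed

lemma par_nz:
  assumes "k < N" "i < N" "j < N" "i \<noteq> j" and not_edge: "\<not> (k \<in> {prv N i, i} \<and> k \<in> {prv N j, j})"
  shows "cross2 (d k) (v i - v j) \<noteq> 0"
proof -
  let ?m = "slots (prv N i) i (prv N j) j k 0"
  have "g_par N k i j (tangent_polygon N ?m) = - tsc N ?m k *
     (tE (?m k) (?m (prv N i)) (?m i) - tE (?m k) (?m (prv N j)) (?m j))"
    using assms by (simp add: g_par_def dir_tangent cross2_simps) (simp add: cross2_def tE_def algebra_simps)
  then have "g_par N k i j (tangent_polygon N ?m) \<noteq> 0"
    using slots_two_vertices(2)[OF two_vertex_slots(1,2)[OF assms(2-4)] assms(4) two_vertex_slots(3,4)[OF assms(2-4)] not_edge]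
      assms tsc_slots_nz by simp
  from generic_nonzero[OF gen mem_gens(3)[OF assms(2,3,1,1)] this]
  show ?thesis by (simp add: g_par_def)
qed

lemma mid_nz:
  assumes "k < N" "i < N" "j < N" "i \<noteq> j" and not_edge: "\<not> (k \<in> {prv N i, i} \<and> k \<in> {prv N j, j})"
  shows "e k (v i) + e k (v j) \<noteq> 0"
proof -
  let ?m = "slots (prv N i) i (prv N j) j k 0"
  have "g_mid N k i j (tangent_polygon N ?m) = tsc N ?m k *
     (tE (?m k) (?m (prv N i)) (?m i) + tE (?m k) (?m (prv N j)) (?m j))"
    using assms by (simp add: g_mid_def side_tangent tE_def algebra_simps)
  then have "g_mid N k i j (tangent_polygon N ?m) \<noteq> 0"
    using slots_two_vertices(3)[OF two_vertex_slots(1,2)[OF assms(2-4)] assms(4) two_vertex_slots(3,4)[OF assms(2-4)] not_edge]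
      assms tsc_slots_nz by simp
  from generic_nonzero[OF gen mem_gens(4)[OF assms(2,3,1,1)] this]
  show ?thesis by (simp add: g_mid_def)
qed

text \<open>
  The patterns of edges possible for corners 1, 2, 3 of a rectangle with corner 0 at vertex \<open>j\<close>: at most
  two corners on an edge, no two parallel sides on edges, and the two edges at the vertex do not both
  carry a neighbouring corner.
\<close>

definition corner_pattern :: "nat \<Rightarrow> nat \<Rightarrow> nat \<Rightarrow> nat \<Rightarrow> bool" where
  "corner_pattern j a b c \<longleftrightarrow> \<not> (a = b \<and> b = c) \<and> (a = b \<longrightarrow> a \<notin> {prv N j, j} \<and> c \<notin> {prv N j, j}) \<and>
    (b = c \<longrightarrow> b \<notin> {prv N j, j} \<and> a \<notin> {prv N j, j}) \<and> (a = c \<longrightarrow> a \<notin> {prv N j, j}) \<and>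
    \<not> (a \<in> {prv N j, j} \<and> c \<in> {prv N j, j})"

lemma disc_nz:
  assumes "j < N" "a < N" "b < N" "c < N" and H: "corner_pattern j a b c"
  shows "(ptB N v (v j) a b c)\<^sup>2 - 4 * ptA N v (v j) a b c * ptC N v (v j) a b c \<noteq> 0"
proof -
  let ?m = "slots (prv N j) j a b c 0"
  let ?w = "tangent_polygon N ?m" let ?T = "tsc N ?m"
  let ?e = "\<lambda>x. tE (?m x) (?m (prv N j)) (?m j)"
  let ?D = "(tB (?m a) (?m b) (?m c) (?e a) (?e b) (?e c))\<^sup>2 -
    4 * tA (?m a) (?m b) (?m c) (?e a) (?e b) (?e c) * tC (?m a) (?m b) (?m c) (?e a) (?e b) (?e c)"
  have "(s * y)\<^sup>2 - 4 * (s * x) * (s * z) = s\<^sup>2 * (y\<^sup>2 - 4 * x * z)" for s x y z :: real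
    by (simp add: power2_eq_square algebra_simps)
  then have "g_disc N j a b c ?w = (?T a * ?T b * ?T c)\<^sup>2 * ?D"
    by (simp only: g_disc_def pt_tangent[OF assms(2-4)])
  moreover have "?D \<noteq> 0"
    by (rule slots_disc[OF prv_neq(1)[OF N3 assms(1)]]) (use H in \<open>auto simp: corner_pattern_def\<close>)
  ultimately have "g_disc N j a b c ?w \<noteq> 0" using assms(2-4) tsc_slots_nz by simp
  from generic_nonzero[OF gen mem_gens(5)[OF assms(1-4)] this]
  show ?thesis by (simp add: g_disc_def)
qed

lemma square_nz:
  assumes "j < N" "a < N" "b < N" "c < N" and H: "corner_pattern j a b c"
  shows "ptA N v (v j) a b c + ptB N v (v j) a b c + ptC N v (v j) a b c \<noteq> 0"
proof -
  let ?m = "slots (prv N j) a j b c 0"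
  let ?w = "tangent_polygon N ?m" let ?T = "tsc N ?m"
  let ?e = "\<lambda>x. tE (?m x) (?m (prv N j)) (?m j)"
  let ?D = "tA (?m a) (?m b) (?m c) (?e a) (?e b) (?e c) + tB (?m a) (?m b) (?m c) (?e a) (?e b) (?e c)
    + tC (?m a) (?m b) (?m c) (?e a) (?e b) (?e c)"
  have "s * x + s * y + s * z = s * (x + y + z)" for s x y z :: real
    by (simp add: algebra_simps)
  then have "g_square N j a b c ?w = (?T a * ?T b * ?T c) * ?D"
    by (simp only: g_square_def pt_tangent[OF assms(2-4)])
  moreover have "?D \<noteq> 0"
    by (rule slots_square[OF prv_neq(1)[OF N3 assms(1)]]) (use H in \<open>auto simp: corner_pattern_def\<close>)
  ultimately have "g_square N j a b c ?w \<noteq> 0" using assms(2-4) tsc_slots_nz by simp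
  from generic_nonzero[OF gen mem_gens(6)[OF assms(1-4)] this]
  show ?thesis by (simp add: g_square_def)
qed

lemma minors_nz:
  assumes "k < N" "a < N" "b < N" "c < N"
  shows "k \<noteq> c \<Longrightarrow> b \<noteq> c \<Longrightarrow> k = a \<Longrightarrow> b \<noteq> a \<Longrightarrow> g_minBC N k a b c v \<noteq> 0"
    "k \<noteq> a \<Longrightarrow> k \<noteq> b \<Longrightarrow> a \<noteq> b \<Longrightarrow> b = c \<Longrightarrow> g_minBC N k a b c v \<noteq> 0"
    "k \<noteq> a \<Longrightarrow> k \<noteq> c \<Longrightarrow> a \<noteq> c \<Longrightarrow> a = b \<Longrightarrow> g_minAB N k a b c v \<noteq> 0"
    "k \<noteq> a \<Longrightarrow> k \<noteq> b \<Longrightarrow> a \<noteq> b \<Longrightarrow> k = c \<Longrightarrow> g_minAB N k a b c v \<noteq> 0"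
    "k \<noteq> a \<Longrightarrow> a \<noteq> b \<Longrightarrow> b \<noteq> c \<Longrightarrow> c \<noteq> k \<Longrightarrow> \<not> (k = b \<and> a = c) \<Longrightarrow> g_res N k a b c v \<noteq> 0"
proof -
  let ?m = "slots k a b c 0 0"
  let ?w = "tangent_polygon N ?m" let ?T = "tsc N ?m"
  have S: "(?T a * ?T b * ?T c)\<^sup>2 * ?T k \<noteq> 0" using assms tsc_slots_nz by simp
  have res: "(s * x)\<^sup>2 - (s * y) * (s * z) = s\<^sup>2 * (x\<^sup>2 - y * z)" for s x y z :: real
    by (simp add: power2_eq_square algebra_simps)
  note mt = minors_tangent[OF assms, of ?m]
  have BC: "g_minBC N k a b c v \<noteq> 0" if "g_minBC N k a b c ?w \<noteq> 0"
    using generic_nonzero[OF gen mem_gens(8)[OF assms] that] .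
  have AB: "g_minAB N k a b c v \<noteq> 0" if "g_minAB N k a b c ?w \<noteq> 0"
    using generic_nonzero[OF gen mem_gens(7)[OF assms] that] .
  have RE: "g_res N k a b c v \<noteq> 0" if "g_res N k a b c ?w \<noteq> 0"
    using generic_nonzero[OF gen mem_gens(9)[OF assms] that] .
  show "g_minBC N k a b c v \<noteq> 0" if "k \<noteq> c" "b \<noteq> c" "k = a" "b \<noteq> a"
    by (rule BC, unfold mt(2)) (use S slots_minors(1)[OF that] in simp)
  show "g_minBC N k a b c v \<noteq> 0" if "k \<noteq> a" "k \<noteq> b" "a \<noteq> b" "b = c"
    by (rule BC, unfold mt(2)) (use S slots_minors(2)[OF that] in simp)
  show "g_minAB N k a b c v \<noteq> 0" if "k \<noteq> a" "k \<noteq> c" "a \<noteq> c" "a = b"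
    by (rule AB, unfold mt(1)) (use S slots_minors(3)[OF that] in simp)
  show "g_minAB N k a b c v \<noteq> 0" if "k \<noteq> a" "k \<noteq> b" "a \<noteq> b" "k = c"
    by (rule AB, unfold mt(1)) (use S slots_minors(4)[OF that] in simp)
  show "g_res N k a b c v \<noteq> 0" if "k \<noteq> a" "a \<noteq> b" "b \<noteq> c" "c \<noteq> k" "\<not> (k = b \<and> a = c)"
    by (rule RE, unfold g_res_def mt res, rule no_zero_divisors)
      (use S slots_minors(5)[OF that] in simp_all)
qed

lemma adj_nz:
  assumes "i < N" "j < N" "i \<noteq> j" "a < N" "b < N" and H: "a \<noteq> b" "a \<notin> {prv N j, j}" "b \<notin> {prv N i, i}"
  shows "e a (v j) * (d b \<bullet> (v j - v i)) - e b (v i) * (d a \<bullet> (v j - v i)) \<noteq> 0"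
proof -
  let ?m = "slots (prv N i) i (prv N j) j a b"
  let ?w = "tangent_polygon N ?m" let ?T = "tsc N ?m"
  let ?S = "(?m (prv N j) + ?m j) - (?m (prv N i) + ?m i)" and ?P = "?m (prv N j) * ?m j - ?m (prv N i) * ?m i"
  let ?D = "tE (?m a) (?m (prv N j)) (?m j) * (?S + ?m b * ?P) - tE (?m b) (?m (prv N i)) (?m i) * (?S + ?m a * ?P)"
  have s: "side N ?w x (?w y) = ?T x * tE (?m x) (?m (prv N y)) (?m y)" if "x < N" for x y
    using that by (simp add: side_tangent tE_def)
  have t: "dir N ?w x \<bullet> (?w j - ?w i) = ?T x * (?S + ?m x * ?P)" if "x < N" for x
    using that by (simp add: dir_tangent inner2 distrib_left)
  have alg: "x * p * (y * q) - y * r * (x * s) = x * y * (p * q - r * s)" for x y p q r s :: real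
    by (simp add: algebra_simps)
  have "g_adj N i j a b ?w = ?T a * ?T b * ?D"
    by (simp only: g_adj_def s[OF assms(4)] s[OF assms(5)] t[OF assms(4)] t[OF assms(5)] alg)
  moreover have "?D \<noteq> 0"
    using slots_adj[OF two_vertex_slots(1,2)[OF assms(1-3)] assms(3) two_vertex_slots(3,4)[OF assms(1-3)] H] .
  ultimately have "g_adj N i j a b ?w \<noteq> 0" using assms(4,5) tsc_slots_nz by simp
  from generic_nonzero[OF gen mem_gens(10)[OF assms(1,2,4,5)] this]
  show ?thesis by (simp add: g_adj_def)
qed

lemma diag_nz:
  assumes "i < N" "j < N" "i \<noteq> j" "a < N" "b < N" "a \<noteq> b"
    and H: "\<not> (a \<in> {prv N i, i} \<and> a \<in> {prv N j, j})" "\<not> (b \<in> {prv N i, i} \<and> b \<in> {prv N j, j})"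
    "\<not> (a \<in> {prv N i, i, prv N j, j} \<and> b \<in> {prv N i, i, prv N j, j})"
  defines "w \<equiv> e a (v i) *\<^sub>R d b + e b (v j) *\<^sub>R d a"
  shows "cross2 (d a) (d b) * ((v j - v i) \<bullet> w) - w \<bullet> w \<noteq> 0"
proof -
  let ?m = "slots (prv N i) i (prv N j) j a b"
  let ?w = "tangent_polygon N ?m" let ?T = "tsc N ?m"
  let ?S = "(?m (prv N j) + ?m j) - (?m (prv N i) + ?m i)" and ?P = "?m (prv N j) * ?m j - ?m (prv N i) * ?m i"
  let ?e1 = "tE (?m a) (?m (prv N i)) (?m i)" and ?e3 = "tE (?m b) (?m (prv N j)) (?m j)"
  let ?D = "(?m b - ?m a) * (?S * (?e1 + ?e3) + ?P * (?e1 * ?m b + ?e3 * ?m a)) - ((?e1 + ?e3)\<^sup>2 + (?e1 * ?m b + ?e3 * ?m a)\<^sup>2)"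
  have s: "side N ?w x (?w y) = ?T x * tE (?m x) (?m (prv N y)) (?m y)" if "x < N" for x y
    using that by (simp add: side_tangent tE_def)
  let ?u = "?e1 *\<^sub>R slope_vec (?m b) + ?e3 *\<^sub>R slope_vec (?m a)"
  have u: "side N ?w a (?w i) *\<^sub>R dir N ?w b + side N ?w b (?w j) *\<^sub>R dir N ?w a = (?T a * ?T b) *\<^sub>R ?u"
    using assms(4,5) by (simp add: s dir_tangent scaleR_add_right algebra_simps)
  have c: "cross2 (dir N ?w a) (dir N ?w b) = (?T a * ?T b) * (?m b - ?m a)"
    using assms(4,5) by (simp add: dir_tangent cross2_simps cross2_slope)
  have "g_diag N i j a b ?w = (?T a * ?T b)\<^sup>2 * ((?m b - ?m a) * ((?w j - ?w i) \<bullet> ?u) - ?u \<bullet> ?u)"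
    unfolding g_diag_def Let_def u c by (simp add: power2_eq_square right_diff_distrib)
  also have "(?w j - ?w i) \<bullet> ?u = ?S * (?e1 + ?e3) + ?P * (?e1 * ?m b + ?e3 * ?m a)"
    unfolding inner2 by simp
  also have "?u \<bullet> ?u = (?e1 + ?e3)\<^sup>2 + (?e1 * ?m b + ?e3 * ?m a)\<^sup>2"
    unfolding inner2 by (simp add: power2_eq_square)
  finally have "g_diag N i j a b ?w = (?T a * ?T b)\<^sup>2 * ?D" .
  moreover have "?D \<noteq> 0"
    using slots_diag[OF two_vertex_slots(1,2)[OF assms(1-3)] assms(3) two_vertex_slots(3,4)[OF assms(1-3)] assms(6) H] .
  ultimately have "g_diag N i j a b ?w \<noteq> 0" using assms(4,5) tsc_slots_nz by simp
  from generic_nonzero[OF gen mem_gens(11)[OF assms(1,2,4,5)] this]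
  show ?thesis by (simp add: g_diag_def Let_def w_def)
qed

end

section \<open>Inscribed rectangles and the lines they use\<close>

context generic_polygon
begin

lemma simple: "simple_path (polygon_loop N v)"
  using gen by (simp add: generic_def labeled_polygons_def)

lemma dir_nz: "k < N \<Longrightarrow> d k \<noteq> 0"
  using cross_nz[of k "Suc k mod N"] prv_neq(1)[OF N3, of "Suc k mod N"] prv_Suc[of k N] N0
  by (auto simp: cross2_simps)

lemma dot_nz: assumes "k < N" "l < N" shows "d k \<bullet> d l \<noteq> 0"
proof -
  have "Suc l mod N \<noteq> l" using prv_neq(1)[OF N3, of "Suc l mod N"] prv_Suc[OF assms(2)] N0 by auto
  then show ?thesis using perp_nz[of k "Suc l mod N" l] assms N0 by (simp add: dir_def)
qed

lemma curve_eq: "\<gamma> = (\<Union>k<N. E k)"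
  by (rule polygon_curve_eq[OF N0])

lemma edge_param: "q \<in> E k \<Longrightarrow> \<exists>s. 0 \<le> s \<and> s \<le> 1 \<and> q = v k + s *\<^sub>R d k"
  by (auto simp: edge_eq edge_pt_def)

lemma edge_paramI: "0 \<le> s \<Longrightarrow> s \<le> 1 \<Longrightarrow> v k + s *\<^sub>R d k \<in> E k"
  by (auto simp: edge_eq edge_pt_def)

lemma side_edge: "q \<in> E k \<Longrightarrow> e k q = 0"
  by (auto simp: side_def cross2_simps dest!: edge_param)

lemma side_shift: "e k (p + u) = e k p - cross2 (d k) u"
  by (simp add: side_def cross2_simps)

lemma side_eq_0E:
  assumes "k < N" "e k q = 0" obtains s where "q = v k + s *\<^sub>R d k"
proof -
  have "cross2 (d k) (q - v k) = 0" using assms(2) by (simp add: side_def cross2_simps)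
  then obtain s where "q - v k = s *\<^sub>R d k"
    using cross2_eq_0_imp_parallel dir_nz[OF assms(1)] by blast
  then have "q = v k + s *\<^sub>R d k" by (simp add: algebra_simps)
  then show ?thesis by (rule that)
qed

abbreviation "V \<equiv> v ` {..<N}"

lemma vertex_on_line: assumes "i < N" "k < N" "e k (v i) = 0" shows "k \<in> {prv N i, i}"
proof (rule ccontr)
  assume *: "k \<notin> {prv N i, i}"
  then show False using par_nz[of k k i] assms by (auto simp: side_def)
qed

lemma vertex_in_edge: "i < N \<Longrightarrow> k \<in> {prv N i, i} \<Longrightarrow> v i \<in> E k"
  using Suc_prv[of i N] by (auto simp: edge_def)

lemma edge_ends: "k < N \<Longrightarrow> v k \<in> V" "k < N \<Longrightarrow> v (Suc k mod N) \<in> V"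
  using N0 by auto

lemma edges_meet_vertex:
  assumes "k < N" "l < N" "k \<noteq> l" "q \<in> E k" "q \<in> E l"
  obtains "l = Suc k mod N" "q = v l" "k = prv N l" | "k = Suc l mod N" "q = v k" "l = prv N k"
  using edges_meet[OF N0 simple assms] assms prv_Suc by metis

lemma unique_edge: "k < N \<Longrightarrow> l < N \<Longrightarrow> q \<in> E k \<Longrightarrow> q \<in> E l \<Longrightarrow> q \<notin> V \<Longrightarrow> k = l"
  by (metis edges_meet_vertex edge_ends(1))

lemma edge_closed: "closed (E k)" and edge_compact: "compact (E k)"
  by (simp_all add: edge_def)

lemma curve_compact: "compact \<gamma>"
  unfolding curve_eq by (intro compact_UN) (auto simp: edge_compact)

lemma local_edges:
  obtains U where "open U" "q \<in> U" "\<And>k x. k < N \<Longrightarrow> x \<in> U \<Longrightarrow> x \<in> E k \<Longrightarrow> q \<in> E k"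
proof
  let ?U = "- (\<Union>k\<in>{k. k < N \<and> q \<notin> E k}. E k)"
  show "open ?U" by (intro open_Compl closed_UN) (auto simp: edge_closed)
  show "q \<in> ?U" by auto
qed auto

lemma line_near_edge:
  assumes "k < N" "q \<in> E k" "q \<notin> V"
  obtains U where "open U" "q \<in> U" "\<And>x. x \<in> U \<Longrightarrow> e k x = 0 \<Longrightarrow> x \<in> E k"
proof
  let ?U = "{x. 0 < (x - v k) \<bullet> d k} \<inter> {x. (x - v k) \<bullet> d k < d k \<bullet> d k}"
  have dd: "d k \<bullet> d k > 0" using dir_nz[OF assms(1)] by simp
  show "open ?U" by (intro open_Int open_Collect_less continuous_intros)
  obtain s where s: "0 \<le> s" "s \<le> 1" "q = v k + s *\<^sub>R d k" using edge_param[OF assms(2)] by blast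
  have "s \<noteq> 0" "s \<noteq> 1" using s(3) assms(3) edge_ends[OF assms(1)] by (auto simp: dir_def)
  then show "q \<in> ?U" using s dd by simp
  fix x assume x: "x \<in> ?U" "e k x = 0"
  then obtain t where t: "x = v k + t *\<^sub>R d k" using side_eq_0E[OF assms(1)] by blast
  then have "0 < t * (d k \<bullet> d k)" "t * (d k \<bullet> d k) < 1 * (d k \<bullet> d k)" using x(1) by auto
  then have "0 \<le> t" "t \<le> 1" using dd by (simp add: zero_less_mult_iff, simp only: mult_less_cancel_right)+ auto
  then show "x \<in> E k" using t edge_paramI by simp
qed

text \<open>
  Near a point that is not a vertex, the polygon, its edge and the line of the edge coincide.
\<close>

lemma nonvertex_neighbourhood:
  assumes "l < N" "q \<in> E l" "q \<notin> V"
  obtains W where "open W" "q \<in> W" "\<And>x. x \<in> W \<Longrightarrow> x \<in> \<gamma> \<Longrightarrow> x \<in> E l" "\<And>x. x \<in> W \<Longrightarrow> e l x = 0 \<Longrightarrow> x \<in> E l" "W \<inter> V = {}"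
proof -
  obtain W1 where W1: "open W1" "q \<in> W1" "\<And>k x. k < N \<Longrightarrow> x \<in> W1 \<Longrightarrow> x \<in> E k \<Longrightarrow> q \<in> E k"
    using local_edges[of q] by blast
  obtain W2 where W2: "open W2" "q \<in> W2" "\<And>x. x \<in> W2 \<Longrightarrow> e l x = 0 \<Longrightarrow> x \<in> E l"
    using line_near_edge[OF assms] by blast
  have "x \<in> E l" if "x \<in> W1" "x \<in> \<gamma>" for x
    using that W1(3) unique_edge[OF _ assms(1) _ assms(2,3)] unfolding curve_eq by blast
  moreover have "open (W1 \<inter> W2 - V)" using W1(1) W2(1) by (simp add: open_Int finite_imp_closed open_Diff)
  ultimately show ?thesis using that[of "W1 \<inter> W2 - V"] W1 W2 assms(3) by auto
qed

subsection \<open>Which edges can carry the corners of a rectangle\<close>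

text \<open>
  No three corners are on one edge and no two pairs of corners are on two edges.
\<close>

definition allowed :: "nat \<Rightarrow> nat \<Rightarrow> nat \<Rightarrow> nat \<Rightarrow> bool" where
  "allowed k a b c \<longleftrightarrow> \<not> (k = a \<and> a = b) \<and> \<not> (a = b \<and> b = c) \<and> \<not> (b = c \<and> c = k) \<and> \<not> (c = k \<and> k = a) \<and>
     \<not> (k = a \<and> b = c) \<and> \<not> (a = b \<and> c = k) \<and> \<not> (k = b \<and> a = c)"

definition carried :: "nat \<Rightarrow> nat \<Rightarrow> nat \<Rightarrow> nat \<Rightarrow> real^2^4 \<Rightarrow> bool" where
  "carried k a b c R \<longleftrightarrow> k < N \<and> a < N \<and> b < N \<and> c < N \<and> R $ 0 \<in> E k \<and> R $ 1 \<in> E a \<and> R $ 2 \<in> E b \<and> R $ 3 \<in> E c"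

lemma inscribed_carried:
  assumes "R \<in> I" obtains k a b c where "carried k a b c R"
proof -
  have "R $ i \<in> (\<Union>k<N. E k)" for i
    using assms by (simp add: inscribed_rectangles_def curve_eq)
  then have "\<exists>k<N. R $ i \<in> E k" for i by auto
  then obtain K where "\<And>i. K i < N \<and> R $ i \<in> E (K i)" by metis
  then show ?thesis using that[of "K 0" "K 1" "K 2" "K 3"] by (simp add: carried_def)
qed

lemma inscribedE:
  assumes "R \<in> I" obtains p w r where "w \<noteq> 0" "r > 0" "R = rect p w r"
  using assms unfolding inscribed_rectangles_def by (auto elim: ccw_rectangleE)

lemma carried_inscribed: "carried k a b c R \<Longrightarrow> ccw_rectangle R \<Longrightarrow> R \<in> I"
  unfolding inscribed_rectangles_def carried_def curve_eq forall_4' mem_Collect_eq by blast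

lemma same_line:
  assumes "r > (0::real)"
  shows "e k p = 0 \<Longrightarrow> e k (p + w) = 0 \<Longrightarrow> cross2 (d k) w = 0"
    "e k (p + w) = 0 \<Longrightarrow> e k (p + w + r *\<^sub>R perp w) = 0 \<Longrightarrow> d k \<bullet> w = 0"
    "e k (p + w + r *\<^sub>R perp w) = 0 \<Longrightarrow> e k (p + r *\<^sub>R perp w) = 0 \<Longrightarrow> cross2 (d k) w = 0"
    "e k p = 0 \<Longrightarrow> e k (p + r *\<^sub>R perp w) = 0 \<Longrightarrow> d k \<bullet> w = 0"
  using assms by (auto simp: side_shift cross2_simps)

lemma dir_det: "k < N \<Longrightarrow> cross2 (d k) w = 0 \<Longrightarrow> d k \<bullet> w = 0 \<Longrightarrow> w = 0"
  using cross2_inner_eq_0[of "d k" w] dir_nz by blast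

lemma parallel_dirs:
  assumes "k < N" "l < N" "w \<noteq> 0" "cross2 (d k) w = 0" "cross2 (d l) w = 0" shows "k = l"
proof (rule ccontr)
  assume "k \<noteq> l"
  obtain x where "w = x *\<^sub>R d k" using cross2_eq_0_imp_parallel[OF assms(4) dir_nz[OF assms(1)]] by blast
  with assms(3,5) cross_nz[OF assms(2,1)] \<open>k \<noteq> l\<close> show False by (auto simp: cross2_simps)
qed

lemma perp_dirs:
  assumes "k < N" "l < N" "w \<noteq> 0" "d k \<bullet> w = 0" "d l \<bullet> w = 0" shows "k = l"
proof -
  have "perp w \<noteq> 0" using assms(3) by (metis norm_perp norm_eq_zero)
  then show ?thesis using parallel_dirs[of k l "perp w"] assms by (simp add: cross2_simps)
qed

lemma skew_dirs:
  assumes "k < N" "l < N" "w \<noteq> 0" "cross2 (d k) w = 0" shows "d l \<bullet> w \<noteq> 0"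
proof -
  obtain x where "w = x *\<^sub>R d k" using cross2_eq_0_imp_parallel[OF assms(4) dir_nz[OF assms(1)]] by blast
  with assms(3) dot_nz[OF assms(2,1)] show ?thesis by auto
qed

text \<open>
  The one case that needs more than directions is that of both diagonals on edges: these would
  bisect each other, but two edges meet in a common endpoint at most.
\<close>

lemma midpoint_at_end:
  assumes "q \<in> E k" "q' \<in> E k" "k < N" "midpoint q q' = v k \<or> midpoint q q' = v (Suc k mod N)"
  shows "q = q'"
proof -
  obtain s t where st: "0 \<le> s" "s \<le> 1" "q = v k + s *\<^sub>R d k" "0 \<le> t" "t \<le> 1" "q' = v k + t *\<^sub>R d k"
    using edge_param assms(1,2) by metis
  have m: "midpoint q q' = v k + ((s + t) / 2) *\<^sub>R d k"
    unfolding st(3,6) midpoint_def by (simp add: eq2_iff field_simps)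
  have "v (Suc k mod N) = v k + 1 *\<^sub>R d k" by (simp add: dir_def)
  then have "(s + t) / 2 = 0 \<or> (s + t) / 2 = 1"
    using m assms(4) dir_nz[OF assms(3)] by (metis add_cancel_right_right add_left_cancel scaleR_cancel_right scaleR_eq_0_iff)
  then have "s = t" using st by auto
  then show ?thesis using st by simp
qed

text \<open>
  Three corners on a line determine two perpendicular directions in it. Two pairs of neighbouring corners
  would make the two edges parallel.
\<close>

lemma carried_allowed:
  assumes R: "R = rect p w r" "w \<noteq> 0" "r > 0" and c: "carried k a b c R"
  shows "allowed k a b c"
proof -
  have kN: "k < N" "a < N" "b < N" "c < N" using c by (auto simp: carried_def)
  have on: "p \<in> E k" "p + w \<in> E a" "p + w + r *\<^sub>R perp w \<in> E b" "p + r *\<^sub>R perp w \<in> E c"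
    using c by (simp_all add: carried_def R(1))
  note z = on[THEN side_edge]
  have ka: "cross2 (d k) w = 0" if "k = a" using same_line(1)[OF R(3)] z that by simp
  have ab: "d a \<bullet> w = 0" if "a = b" using same_line(2)[OF R(3)] z that by simp
  have bc: "cross2 (d b) w = 0" if "b = c" using same_line(3)[OF R(3)] z that by simp
  have ck: "d c \<bullet> w = 0" if "c = k" using same_line(4)[OF R(3)] z that by simp
  have 1: "\<not> (k = a \<and> a = b)" "\<not> (a = b \<and> b = c)" "\<not> (b = c \<and> c = k)" "\<not> (c = k \<and> k = a)"
    using ka ab bc ck dir_det[of k w] dir_det[of a w] dir_det[of b w] dir_det[of c w] kN R(2) by blast+
  have 2: "\<not> (k = a \<and> b = c)"
    using 1 ka bc parallel_dirs[OF kN(1,3) R(2)] by blast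
  have 3: "\<not> (a = b \<and> c = k)"
    using 1 ab ck perp_dirs[OF kN(2,4) R(2)] by blast
  have 4: "\<not> (k = b \<and> a = c)"
  proof
    assume eq: "k = b \<and> a = c"
    define m where "m = midpoint p (p + w + r *\<^sub>R perp w)"
    have m2: "m = midpoint (p + w) (p + r *\<^sub>R perp w)" by (simp add: m_def midpoint_def algebra_simps)
    have conv: "convex (E x)" for x by (simp add: edge_def)
    have "closed_segment p (p + w + r *\<^sub>R perp w) \<subseteq> E k"
      using on eq by (intro closed_segment_subset conv) auto
    then have mk: "m \<in> E k" unfolding m_def using midpoint_in_closed_segment by blast
    have "closed_segment (p + w) (p + r *\<^sub>R perp w) \<subseteq> E a"
      using on eq by (intro closed_segment_subset conv) auto
    then have ma: "m \<in> E a" unfolding m2 using midpoint_in_closed_segment by blast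
    moreover have "k \<noteq> a" using 1 eq by auto
    ultimately have "m = v k \<or> m = v (Suc k mod N)"
      using edges_meet_vertex[OF kN(1,2) _ mk ma] by metis
    then have "p = p + w + r *\<^sub>R perp w"
      using on eq kN(1) unfolding m_def by (intro midpoint_at_end[of p k]) auto
    then have "w + r *\<^sub>R perp w = 0" by (simp add: algebra_simps)
    then have "w \<bullet> (w + r *\<^sub>R perp w) = 0" by simp
    then show False using R(2) by (simp add: inner_add_right cross2_simps)
  qed
  show ?thesis unfolding allowed_def by (intro conjI 1 2 3 4)
qed

subsection \<open>Rectangles on given lines are determined by the aspect ratio\<close>

text \<open>
  The quadratic \<open>phi q\<close> of corner 0 at \<open>q\<close> and its slope \<open>psi\<close> along edge \<open>k\<close>, up to sign (\<open>phi_affine\<close>).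
\<close>

definition phi :: "real^2 \<Rightarrow> nat \<Rightarrow> nat \<Rightarrow> nat \<Rightarrow> real \<Rightarrow> real" where
  "phi q a b c r = ptA N v q a b c * r\<^sup>2 + ptB N v q a b c * r + ptC N v q a b c"

definition psi :: "nat \<Rightarrow> nat \<Rightarrow> nat \<Rightarrow> nat \<Rightarrow> real \<Rightarrow> real" where
  "psi k a b c r = dirA N v k a b c * r\<^sup>2 + dirB N v k a b c * r + dirC N v k a b c"

definition side_of :: "real^2 \<Rightarrow> nat \<Rightarrow> nat \<Rightarrow> real \<Rightarrow> real^2" where
  "side_of p a c r = side_vec (d a) (d c) (e a p) (e c p) r"

lemma phi_affine: "phi (p + s *\<^sub>R d k) a b c r = phi p a b c r - s * psi k a b c r"
proof -
  have e: "e x (p + s *\<^sub>R d k) = e x p - s * cross2 (d x) (d k)" for x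
    by (simp add: side_shift cross2_simps)
  show ?thesis
    unfolding phi_def psi_def ptA_def ptB_def ptC_def dirA_def dirB_def dirC_def e quadA_def quadB_def quadC_def
    by (simp add: algebra_simps)
qed

lemma on_lines_iff:
  assumes "a < N" "c < N" "r > 0"
  shows "e a (p + w) = 0 \<and> e b (p + w + r *\<^sub>R perp w) = 0 \<and> e c (p + r *\<^sub>R perp w) = 0 \<longleftrightarrow>
    w = side_of p a c r \<and> phi p a b c r = 0"
proof -
  have "r \<noteq> 0" using assms(3) by simp
  from three_lines_iff[OF dot_nz[OF assms(1,2)] this, of w "e a p" "d b" "e b p" "e c p"]
  show ?thesis
    unfolding phi_def ptA_def ptB_def ptC_def side_of_def
    by (simp add: side_shift cross2_simps algebra_simps) argo
qed

text \<open>
  At a common root the minors of the two coefficient vectors are proportional to \<open>1, -r, r^2\<close>. So if one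
  of them vanishes all do, and in any case the resultant vanishes.
\<close>

lemma no_common_root:
  assumes "k < N" "a < N" "b < N" "c < N" and "allowed k a b c" "r > 0"
  shows "\<not> (phi (v k) a b c r = 0 \<and> psi k a b c r = 0)"
proof
  assume "phi (v k) a b c r = 0 \<and> psi k a b c r = 0"
  then have x: "ptA N v (v k) a b c * r\<^sup>2 + ptB N v (v k) a b c * r + ptC N v (v k) a b c = 0"
    and y: "dirA N v k a b c * r\<^sup>2 + dirB N v k a b c * r + dirC N v k a b c = 0"
    by (auto simp: phi_def psi_def)
  have alg: "x2 * y0 - x0 * y2 = - r * (x2 * y1 - x1 * y2)" "x1 * y0 - x0 * y1 = r\<^sup>2 * (x2 * y1 - x1 * y2)"
    if "x2 * r\<^sup>2 + x1 * r + x0 = 0" "y2 * r\<^sup>2 + y1 * r + y0 = 0" for x0 x1 x2 y0 y1 y2 :: real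
    using that by algebra+
  have AC: "g_minAC N k a b c v = - r * g_minAB N k a b c v" and BC: "g_minBC N k a b c v = r\<^sup>2 * g_minAB N k a b c v"
    unfolding g_minAC_def g_minAB_def g_minBC_def using alg[OF x y] by auto
  have res: "g_res N k a b c v = 0"
    unfolding g_res_def AC BC by (simp add: power2_eq_square)
  note nz = minors_nz[OF assms(1-4)]
  have ek: "e k (v k) = 0" by (simp add: side_def cross2_simps)
  consider "k = a" | "k \<noteq> a" "b = c" | "k \<noteq> a" "b \<noteq> c" "a = b" | "k \<noteq> a" "b \<noteq> c" "a \<noteq> b" "k = c"
    | "k \<noteq> a" "b \<noteq> c" "a \<noteq> b" "k \<noteq> c" by blast
  then show False
  proof cases
    case 1
    then have "g_minAB N k a b c v = 0"
      using ek by (simp add: g_minAB_def ptA_def dirA_def quadA_def cross2_simps)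
    then show False using nz(1) BC 1 assms(5) by (auto simp: allowed_def)
  next
    case 2
    then have "g_minAB N k a b c v = 0"
      by (simp add: g_minAB_def ptA_def dirA_def quadA_def cross2_simps)
    then show False using nz(2) BC 2 assms(5) by (auto simp: allowed_def)
  next
    case 3
    then have "g_minBC N k a b c v = 0"
      by (simp add: g_minBC_def ptC_def dirC_def quadC_def cross2_simps)
    then show False using nz(3) BC 3 assms(5,6) by (auto simp: allowed_def)
  next
    case 4
    then have "g_minBC N k a b c v = 0"
      using ek by (simp add: g_minBC_def ptC_def dirC_def quadC_def cross2_simps)
    then show False using nz(4) BC 4 assms(5,6) by (auto simp: allowed_def)
  next
    case 5
    then show False using nz(5) res assms(5) by (auto simp: allowed_def)
  qed
qed

text \<open>
  The solution of the affine equation \<open>phi (v k) - s * psi = 0\<close> for the position of corner 0 on edge \<open>k\<close>.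
\<close>

definition pos :: "nat \<Rightarrow> nat \<Rightarrow> nat \<Rightarrow> nat \<Rightarrow> real \<Rightarrow> real^2" where
  "pos k a b c r = v k + (phi (v k) a b c r / psi k a b c r) *\<^sub>R d k"

definition rect_at :: "nat \<Rightarrow> nat \<Rightarrow> nat \<Rightarrow> nat \<Rightarrow> real \<Rightarrow> real^2^4" where
  "rect_at k a b c r = rect (pos k a b c r) (side_of (pos k a b c r) a c r) r"

definition lined :: "nat \<Rightarrow> nat \<Rightarrow> nat \<Rightarrow> nat \<Rightarrow> real^2^4 \<Rightarrow> bool" where
  "lined k a b c R \<longleftrightarrow> e k (R $ 0) = 0 \<and> e a (R $ 1) = 0 \<and> e b (R $ 2) = 0 \<and> e c (R $ 3) = 0"

lemma carried_lined: "carried k a b c R \<Longrightarrow> lined k a b c R"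
  by (auto simp: carried_def lined_def side_edge)

text \<open>
  If \<open>psi\<close> vanished at the aspect ratio of an actual rectangle, so would \<open>phi (v k)\<close>, and the root would be
  common.
\<close>

lemma lined_rect_at:
  assumes N: "k < N" "a < N" "b < N" "c < N" and al: "allowed k a b c" and R: "R = rect p w r" "r > 0"
    and l: "lined k a b c R"
  shows "psi k a b c r \<noteq> 0" "R = rect_at k a b c r"
proof -
  have w: "w = side_of p a c r" and phi: "phi p a b c r = 0"
    using l on_lines_iff[OF N(2,4) R(2)] unfolding lined_def R(1) rect_nth by blast+
  obtain s where s: "p = v k + s *\<^sub>R d k"
    using side_eq_0E[OF N(1)] l unfolding lined_def R(1) rect_nth by blast
  have eq: "phi (v k) a b c r = s * psi k a b c r"
    using phi phi_affine[of "v k" s k a b c r] s by simp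
  show nz: "psi k a b c r \<noteq> 0"
    using no_common_root[OF N al R(2)] eq by auto
  then have "p = pos k a b c r" using s eq by (simp add: pos_def)
  then show "R = rect_at k a b c r" using R(1) w by (simp add: rect_at_def)
qed

lemma rect_at_lined:
  assumes N: "k < N" "a < N" "b < N" "c < N" and r: "r > 0" "psi k a b c r \<noteq> 0"
  shows "lined k a b c (rect_at k a b c r)"
proof -
  have "phi (pos k a b c r) a b c r = 0"
    using r unfolding pos_def phi_affine by simp
  moreover have "e k (pos k a b c r) = 0"
    by (simp add: pos_def side_def cross2_simps)
  ultimately show ?thesis
    using on_lines_iff[OF N(2,4) r(1)] unfolding lined_def rect_at_def rect_nth by blast
qed

lemma same_aspect_eq:
  assumes "R \<in> I" "R' \<in> I" "carried k a b c R" "carried k a b c R'" "aspect_ratio R = aspect_ratio R'"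
  shows "R = R'"
proof -
  obtain p w r where R: "w \<noteq> 0" "r > 0" "R = rect p w r" using assms(1) by (rule inscribedE)
  obtain p' w' r' where R': "w' \<noteq> 0" "r' > 0" "R' = rect p' w' r'" using assms(2) by (rule inscribedE)
  have "r = r'" using assms(5) R R' by (simp add: aspect_ratio_rect)
  moreover have N: "k < N" "a < N" "b < N" "c < N" using assms(3) by (auto simp: carried_def)
  moreover have "allowed k a b c" using carried_allowed R assms(3) by blast
  ultimately show ?thesis
    using lined_rect_at(2)[OF N _ R(3,2)] lined_rect_at(2)[OF N _ R'(3,2)] assms(3,4) carried_lined by metis
qed

end

section \<open>Smoothness of rational curves\<close>

definition rational_on :: "real set \<Rightarrow> (real \<Rightarrow> real) \<Rightarrow> bool" where
  "rational_on S f \<longleftrightarrow> (\<exists>p q. \<forall>t\<in>S. poly q t \<noteq> 0 \<and> f t = poly p t / poly q t)"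

lemma rational_const: "rational_on S (\<lambda>_. c)"
  unfolding rational_on_def by (intro exI[of _ "[:c:]"] exI[of _ 1]) simp

lemma rational_ident: "rational_on S (\<lambda>t. t)"
  unfolding rational_on_def by (intro exI[of _ "[:0, 1:]"] exI[of _ 1]) simp

lemma rational_add:
  assumes "rational_on S f" "rational_on S g" shows "rational_on S (\<lambda>t. f t + g t)"
proof -
  from assms obtain p q p' q' where
    "\<forall>t\<in>S. poly q t \<noteq> 0 \<and> f t = poly p t / poly q t" "\<forall>t\<in>S. poly q' t \<noteq> 0 \<and> g t = poly p' t / poly q' t"
    unfolding rational_on_def by blast
  then show ?thesis
    unfolding rational_on_def
    by (intro exI[of _ "p * q' + p' * q"] exI[of _ "q * q'"]) (simp add: add_frac_eq)
qed

lemma rational_mult: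
  assumes "rational_on S f" "rational_on S g" shows "rational_on S (\<lambda>t. f t * g t)"
proof -
  from assms obtain p q p' q' where
    "\<forall>t\<in>S. poly q t \<noteq> 0 \<and> f t = poly p t / poly q t" "\<forall>t\<in>S. poly q' t \<noteq> 0 \<and> g t = poly p' t / poly q' t"
    unfolding rational_on_def by blast
  then show ?thesis
    unfolding rational_on_def
    by (intro exI[of _ "p * p'"] exI[of _ "q * q'"]) simp
qed

lemma rational_inverse:
  assumes "rational_on S f" "\<And>t. t \<in> S \<Longrightarrow> f t \<noteq> 0" shows "rational_on S (\<lambda>t. inverse (f t))"
proof -
  from assms(1) obtain p q where "\<forall>t\<in>S. poly q t \<noteq> 0 \<and> f t = poly p t / poly q t"
    unfolding rational_on_def by blast
  then show ?thesis
    using assms(2) unfolding rational_on_def by (intro exI[of _ q] exI[of _ p]) force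
qed

lemma rational_minus: "rational_on S f \<Longrightarrow> rational_on S (\<lambda>t. - f t)"
  using rational_mult[OF rational_const[of S "-1"]] by simp

lemma rational_diff: "rational_on S f \<Longrightarrow> rational_on S g \<Longrightarrow> rational_on S (\<lambda>t. f t - g t)"
  using rational_add[OF _ rational_minus] by simp

lemma rational_divide:
  "rational_on S f \<Longrightarrow> rational_on S g \<Longrightarrow> (\<And>t. t \<in> S \<Longrightarrow> g t \<noteq> 0) \<Longrightarrow> rational_on S (\<lambda>t. f t / g t)"
  unfolding divide_inverse by (intro rational_mult rational_inverse)

lemma rational_power2: "rational_on S f \<Longrightarrow> rational_on S (\<lambda>t. (f t)\<^sup>2)"
  by (simp add: power2_eq_square rational_mult)

lemmas rational_intros = rational_const rational_ident rational_add rational_mult rational_minus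
  rational_diff rational_divide rational_power2

text \<open>
  The numerators \<open>P n\<close> of the higher derivatives, over the powers of the denominator, follow from the
  quotient rule.
\<close>

lemma rational_smooth:
  assumes S: "open S" and f: "rational_on S f"
  shows "\<exists>D. D 0 = f \<and> (\<forall>n::nat. \<forall>t\<in>S. (D n has_real_derivative D (Suc n) t) (at t))"
proof -
  obtain p q where pq: "\<And>t. t \<in> S \<Longrightarrow> poly q t \<noteq> 0" "\<And>t. t \<in> S \<Longrightarrow> f t = poly p t / poly q t"
    using f unfolding rational_on_def by blast
  define P where "P = rec_nat p (\<lambda>n r. pderiv r * q - of_nat (Suc n) * r * pderiv q)"
  have P: "P 0 = p" "P (Suc n) = pderiv (P n) * q - of_nat (Suc n) * P n * pderiv q" for n
    by (simp_all add: P_def)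
  define F where "F n t = poly (P n) t / poly q t ^ Suc n" for n t
  define D where "D n = (if n = 0 then f else F n)" for n
  have F: "(F n has_real_derivative F (Suc n) t) (at t)" if t: "t \<in> S" for n t
  proof -
    let ?q = "poly q t"
    have "(F n has_real_derivative (poly (pderiv (P n)) t * ?q ^ Suc n -
        poly (P n) t * (real (Suc n) * poly (pderiv q) t * ?q ^ n)) / (?q ^ Suc n * ?q ^ Suc n)) (at t)"
      unfolding F_def[abs_def] using pq(1)[OF t] by (auto intro!: derivative_eq_intros simp del: power_Suc)
    also have "(poly (pderiv (P n)) t * ?q ^ Suc n -
        poly (P n) t * (real (Suc n) * poly (pderiv q) t * ?q ^ n)) / (?q ^ Suc n * ?q ^ Suc n) = F (Suc n) t"
      using pq(1)[OF t] by (simp add: F_def P(2) field_simps)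
    finally show ?thesis .
  qed
  have fF: "f t = F 0 t" if "t \<in> S" for t
    using pq(2)[OF that] by (simp add: F_def P(1))
  have "(D n has_real_derivative D (Suc n) t) (at t)" if t: "t \<in> S" for n t
  proof (cases "n = 0")
    case True
    have "(f has_real_derivative F 1 t) (at t)"
      using has_field_derivative_transform_within_open[OF F[OF t, of 0] S t] fF by simp
    then show ?thesis using True by (simp add: D_def)
  qed (simp add: D_def F[OF t])
  then show ?thesis by (intro exI[of _ D]) (simp add: D_def)
qed

lemma smooth_curve_rational:
  fixes c :: "real \<Rightarrow> real^2^4"
  assumes S: "open S" and rat: "\<And>i j. rational_on S (\<lambda>t. c t $ i $ j)"
  shows "smooth_curve_on c S"
proof -
  have "\<exists>D. D 0 = (\<lambda>t. c t $ i $ j) \<and> (\<forall>n::nat. \<forall>t\<in>S. (D n has_real_derivative D (Suc n) t) (at t))" for i j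
    using rational_smooth[OF S rat] by simp
  then obtain D where D: "\<And>i j. D i j 0 = (\<lambda>t. c t $ i $ j)"
      "\<And>i j n t. t \<in> S \<Longrightarrow> (D i j n has_real_derivative D i j (Suc n) t) (at t)" by metis
  define C where "C n t = (\<Sum>i\<in>UNIV. \<Sum>j\<in>UNIV. D i j n t *\<^sub>R axis i (axis j 1) :: real^2^4)" for n t
  have "(C n has_vector_derivative C (Suc n) t) (at t)" if "t \<in> S" for n t
    unfolding C_def[abs_def]
    by (intro has_vector_derivative_sum)
      (use D(2)[OF that] has_vector_derivative_scaleR[OF D(2)[OF that] has_vector_derivative_const] in simp)
  moreover have "C 0 = c"
  proof
    fix t
    have "(\<Sum>i\<in>UNIV. \<Sum>j\<in>UNIV. x $ i $ j *\<^sub>R axis i (axis j 1)) = (x :: real^2^4)" for x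
      by (simp add: vec_eq_iff forall_4 forall_2 sum_4 sum_2 axis_def)
    then show "C 0 t = c t" by (simp add: C_def D(1))
  qed
  ultimately show ?thesis unfolding smooth_curve_on_def by blast
qed

section \<open>Rectangles whose corners avoid the vertices\<close>

context generic_polygon
begin

lemma phi_rational: "rational_on S (phi q a b c)" and psi_rational: "rational_on S (psi k a b c)"
  unfolding phi_def[abs_def] psi_def[abs_def] by (intro rational_intros)+

lemma rect_at_rational:
  assumes "a < N" "c < N" and S: "\<And>r. r \<in> S \<Longrightarrow> r \<noteq> 0 \<and> psi k a b c r \<noteq> 0"
  shows "rational_on S (\<lambda>r. rect_at k a b c r $ i $ j)"
proof -
  have p: "rational_on S (\<lambda>r. pos k a b c r $ j)" for j
    unfolding pos_def using S by (simp, intro rational_intros phi_rational psi_rational) auto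
  have e: "rational_on S (\<lambda>r. e l (pos k a b c r))" for l
    unfolding side_def cross2_def by (simp, intro rational_intros p)
  have w: "rational_on S (\<lambda>r. side_of (pos k a b c r) a c r $ j)" for j
    unfolding side_of_def side_vec_def using S dot_nz[OF assms(1,2)] by (simp, intro rational_intros e) auto
  have w': "rational_on S (\<lambda>r. r * perp (side_of (pos k a b c r) a c r) $ j)" for j
  proof (cases "j = 1")
    case True
    then show ?thesis
      by (simp, intro rational_minus rational_mult rational_ident w)
  next
    case False
    then have "j = 2" using exhaust_2[of j] by blast
    then show ?thesis by (simp, intro rational_mult rational_ident w)
  qed
  have "\<forall>i. rational_on S (\<lambda>r. rect_at k a b c r $ i $ j)"
    unfolding forall_4' rect_at_def rect_nth vector_add_component vector_scaleR_component real_scaleR_def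
    by (intro conjI rational_intros p w w')
  then show ?thesis by blast
qed

lemma rational_continuous:
  assumes "open S" "rational_on S f" shows "continuous_on S f"
proof -
  obtain D where "D 0 = f" "\<forall>n::nat. \<forall>t\<in>S. (D n has_real_derivative D (Suc n) t) (at t)"
    using rational_smooth[OF assms] by blast
  then have "\<forall>t\<in>S. isCont f t" by (metis DERIV_isCont)
  then show ?thesis by (simp add: continuous_at_imp_continuous_on)
qed

lemma rect_at_continuous:
  assumes "a < N" "c < N" "open S" and S: "\<And>r. r \<in> S \<Longrightarrow> r \<noteq> 0 \<and> psi k a b c r \<noteq> 0"
  shows "continuous_on S (rect_at k a b c)"
proof -
  have "continuous_on S (\<lambda>r. \<chi> i. \<chi> j. rect_at k a b c r $ i $ j)"
    by (intro continuous_on_vec_lambda rational_continuous rect_at_rational assms)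
  then show ?thesis by simp
qed

text \<open>
  Where no corner is a vertex of the polygon, being inscribed is locally the same as having the
  corners on four fixed lines.
\<close>

lemma local_lined:
  assumes R: "R \<in> I" "carried k a b c R" and nv: "\<And>i. R $ i \<notin> V"
  obtains U where "open U" "R \<in> U" "\<And>S. S \<in> U \<Longrightarrow> S \<in> I \<Longrightarrow> carried k a b c S"
    "\<And>S. S \<in> U \<Longrightarrow> lined k a b c S \<Longrightarrow> carried k a b c S" "\<And>S. S \<in> U \<Longrightarrow> S $ 1 \<noteq> S $ 0"
proof -
  have N: "k < N" "a < N" "b < N" "c < N" and on: "R $ 0 \<in> E k" "R $ 1 \<in> E a" "R $ 2 \<in> E b" "R $ 3 \<in> E c"
    using R(2) by (auto simp: carried_def)
  obtain W0 where W0: "open W0" "R $ 0 \<in> W0" "\<And>x. x \<in> W0 \<Longrightarrow> x \<in> \<gamma> \<Longrightarrow> x \<in> E k" "\<And>x. x \<in> W0 \<Longrightarrow> e k x = 0 \<Longrightarrow> x \<in> E k"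
    using nonvertex_neighbourhood[OF N(1) on(1) nv] by metis
  obtain W1 where W1: "open W1" "R $ 1 \<in> W1" "\<And>x. x \<in> W1 \<Longrightarrow> x \<in> \<gamma> \<Longrightarrow> x \<in> E a" "\<And>x. x \<in> W1 \<Longrightarrow> e a x = 0 \<Longrightarrow> x \<in> E a"
    using nonvertex_neighbourhood[OF N(2) on(2) nv] by metis
  obtain W2 where W2: "open W2" "R $ 2 \<in> W2" "\<And>x. x \<in> W2 \<Longrightarrow> x \<in> \<gamma> \<Longrightarrow> x \<in> E b" "\<And>x. x \<in> W2 \<Longrightarrow> e b x = 0 \<Longrightarrow> x \<in> E b"
    using nonvertex_neighbourhood[OF N(3) on(3) nv] by metis
  obtain W3 where W3: "open W3" "R $ 3 \<in> W3" "\<And>x. x \<in> W3 \<Longrightarrow> x \<in> \<gamma> \<Longrightarrow> x \<in> E c" "\<And>x. x \<in> W3 \<Longrightarrow> e c x = 0 \<Longrightarrow> x \<in> E c"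
    using nonvertex_neighbourhood[OF N(4) on(4) nv] by metis
  let ?U = "((\<lambda>S. S $ 0) -` W0 \<inter> (\<lambda>S. S $ 1) -` W1 \<inter> (\<lambda>S. S $ 2) -` W2 \<inter> (\<lambda>S. S $ 3) -` W3) \<inter> {S. S $ 1 \<noteq> S $ (0::4)}"
  have "open ?U"
    using W0(1) W1(1) W2(1) W3(1) by (intro open_Int open_vimage_vec_nth open_Collect_neq continuous_intros)
  moreover have "R \<in> ?U"
  proof -
    have "R $ 1 \<noteq> R $ 0" using inscribedE[OF R(1)] by fastforce
    then show ?thesis using W0 W1 W2 W3 by simp
  qed
  moreover have "carried k a b c S" if "S \<in> ?U" "S \<in> I" for S
    using that W0 W1 W2 W3 N unfolding carried_def inscribed_rectangles_def by simp
  moreover have "carried k a b c S" if "S \<in> ?U" "lined k a b c S" for S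
    using that W0 W1 W2 W3 N unfolding carried_def lined_def by simp
  ultimately show ?thesis using that by blast
qed

lemma rect_at_nth: "rect_at k a b c r $ 2 - rect_at k a b c r $ 1 = r *\<^sub>R perp (rect_at k a b c r $ 1 - rect_at k a b c r $ 0)"
  by (simp add: rect_at_def)

lemma perp_0: "perp 0 = 0"
  by (simp add: eq2_iff)

lemma perp_has_vector_derivative:
  assumes "(f has_vector_derivative f') F" shows "((\<lambda>t. perp (f t)) has_vector_derivative perp f') F"
proof -
  have "linear perp" by (auto simp: linear_iff eq2_iff)
  then have "bounded_linear perp" by (rule linear_conv_bounded_linear[THEN iffD1])
  then show ?thesis using assms by (rule bounded_linear.has_vector_derivative)
qed

lemma nth_has_vector_derivative:
  assumes "(f has_vector_derivative f') F" shows "((\<lambda>t. f t $ i) has_vector_derivative f' $ i) F"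
  using assms by (rule bounded_linear.has_vector_derivative[OF bounded_linear_vec_nth])

text \<open>
  The rectangles near \<open>R\<close> are those on its four lines, and there the aspect ratio is inverse to the
  rational curve \<open>rect_at\<close>. The curve is regular: in the relation \<open>R 2 - R 1 = r J (R 1 - R 0)\<close> the
  factor \<open>r\<close> moves, so not all corners can be at rest.
\<close>

lemma nonvertex_smooth:
  assumes R: "R \<in> I" and nv: "\<And>i. R $ i \<notin> V"
  shows "smooth_point I R" "\<exists>U. open U \<and> R \<in> U \<and> inj_on aspect_ratio (I \<inter> U)"
proof -
  obtain k a b c where car: "carried k a b c R" using inscribed_carried[OF R] by blast
  then have N: "k < N" "a < N" "b < N" "c < N" by (auto simp: carried_def)
  obtain U where U: "open U" "R \<in> U" "\<And>S. S \<in> U \<Longrightarrow> S \<in> I \<Longrightarrow> carried k a b c S"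
    "\<And>S. S \<in> U \<Longrightarrow> lined k a b c S \<Longrightarrow> carried k a b c S" "\<And>S. S \<in> U \<Longrightarrow> S $ 1 \<noteq> S $ 0"
    using local_lined[OF R car nv] by blast
  have "inj_on aspect_ratio (I \<inter> U)"
    by (rule inj_onI) (use same_aspect_eq U(3) in blast)
  then show "\<exists>U. open U \<and> R \<in> U \<and> inj_on aspect_ratio (I \<inter> U)" using U(1,2) by blast
  obtain p w r where r: "w \<noteq> 0" "r > 0" "R = rect p w r" using R by (rule inscribedE)
  have al: "allowed k a b c" using carried_allowed[OF r(3,1,2) car] .
  let ?c = "rect_at k a b c"
  have psi: "psi k a b c r \<noteq> 0" and Rc: "R = ?c r"
    using lined_rect_at[OF N al r(3,2) carried_lined[OF car]] by auto
  define S where "S = {x. 0 < x} \<inter> {x. psi k a b c x \<noteq> 0}"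
  have S0: "\<And>x. x \<in> S \<Longrightarrow> x \<noteq> 0 \<and> psi k a b c x \<noteq> 0" by (auto simp: S_def)
  have oS: "open S"
    unfolding S_def by (intro open_Int open_Collect_less open_Collect_neq continuous_intros
      rational_continuous psi_rational open_UNIV)
  have rS: "r \<in> S" using psi r(2) by (simp add: S_def)
  note cont = rect_at_continuous[OF N(2,4) oS S0]
  have "open (S \<inter> ?c -` U)" using cont oS U(1) by (simp add: continuous_on_open_vimage Int_commute)
  moreover have "r \<in> S \<inter> ?c -` U" using rS U(2) Rc by simp
  ultimately obtain \<epsilon> where \<epsilon>: "\<epsilon> > 0" "ball r \<epsilon> \<subseteq> S \<inter> ?c -` U" by (meson open_contains_ball)
  let ?l = "\<lambda>t. r + \<epsilon> * (2 * t - 1)"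
  have l: "?l t \<in> S \<and> ?c (?l t) \<in> U" if "t \<in> {0<..<1}" for t
  proof -
    have "\<bar>2 * t - 1\<bar> < 1" using that by auto
    then have "\<bar>\<epsilon> * (2 * t - 1)\<bar> < \<epsilon>" using \<epsilon>(1) by (simp add: abs_mult)
    then have "?l t \<in> ball r \<epsilon>" by (simp add: dist_real_def)
    then show ?thesis using \<epsilon>(2) by blast
  qed
  have cI: "?c x \<in> I \<and> aspect_ratio (?c x) = x" if x: "x \<in> S" "?c x \<in> U" for x
  proof -
    have x0: "x > 0" using x(1) by (simp add: S_def)
    have "side_of (pos k a b c x) a c x \<noteq> 0" using U(5)[OF x(2)] by (simp add: rect_at_def)
    then have "ccw_rectangle (?c x)" "aspect_ratio (?c x) = x"
      using x0 by (simp_all add: rect_at_def ccw_rectangle_rect aspect_ratio_rect)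
    moreover have "lined k a b c (?c x)" using rect_at_lined[OF N x0] S0[OF x(1)] by blast
    ultimately show ?thesis using U(4)[OF x(2)] carried_inscribed by blast
  qed
  define W where "W = {T \<in> U. \<bar>aspect_ratio T - r\<bar> < \<epsilon>}"
  have "continuous_on U (\<lambda>T. \<bar>aspect_ratio T - r\<bar>)"
    unfolding aspect_ratio_def using U(5) by (intro continuous_intros) auto
  then have "open (U \<inter> (\<lambda>T. \<bar>aspect_ratio T - r\<bar>) -` {..<\<epsilon>})"
    using U(1) by (simp add: continuous_on_open_vimage Int_commute)
  moreover have "W = U \<inter> (\<lambda>T. \<bar>aspect_ratio T - r\<bar>) -` {..<\<epsilon>}" by (auto simp: W_def)
  ultimately have oW: "open W" by simp
  have RW: "R \<in> W" using U(2) \<epsilon>(1) r by (simp add: W_def aspect_ratio_rect)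
  let ?f = "\<lambda>t. ?c (?l t)" and ?g = "\<lambda>T. ((aspect_ratio T - r) / \<epsilon> + 1) / 2"
  have fW: "?f t \<in> I \<inter> W" "?g (?f t) = t" if t: "t \<in> {0<..<1}" for t
  proof -
    have 1: "?f t \<in> I" "aspect_ratio (?f t) = ?l t" using cI l[OF t] by auto
    have "\<bar>2 * t - 1\<bar> < 1" using t by auto
    then show "?f t \<in> I \<inter> W" using 1 l[OF t] \<epsilon>(1) by (simp add: W_def abs_mult)
    show "?g (?f t) = t" unfolding 1(2) using \<epsilon>(1) by simp
  qed
  have gW: "?g T \<in> {0<..<1}" "?f (?g T) = T" if T: "T \<in> I \<inter> W" for T
  proof -
    have "\<bar>aspect_ratio T - r\<bar> < \<epsilon>" using T by (simp add: W_def)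
    then have "- \<epsilon> < aspect_ratio T - r" "aspect_ratio T - r < \<epsilon>" by linarith+
    then have "- 1 < (aspect_ratio T - r) / \<epsilon>" "(aspect_ratio T - r) / \<epsilon> < 1"
      using \<epsilon>(1) by (simp_all add: field_simps)
    then show "?g T \<in> {0<..<1}" by simp
    have lg: "?l (?g T) = aspect_ratio T" using \<epsilon>(1) by (simp add: field_simps)
    obtain p' w' r' where r': "w' \<noteq> 0" "r' > 0" "T = rect p' w' r'" using T inscribedE by blast
    have "lined k a b c T" using U(3) T carried_lined by (auto simp: W_def)
    then have "T = ?c r'" using lined_rect_at(2)[OF N al r'(3,2)] by blast
    moreover have "aspect_ratio T = r'" using r' by (simp add: aspect_ratio_rect)
    ultimately show "?f (?g T) = T" unfolding lg by simp
  qed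
  have hom: "homeomorphism {0<..<1} (I \<inter> W) ?f ?g"
  proof (rule homeomorphismI)
    show "continuous_on {0<..<1} ?f"
      by (rule continuous_on_compose2[OF cont]) (use l in \<open>auto intro!: continuous_intros\<close>)
    show "continuous_on (I \<inter> W) ?g"
      unfolding aspect_ratio_def using U(5) \<epsilon>(1) by (intro continuous_intros) (auto simp: W_def)
  qed (use fW gW in blast)+
  have smooth: "smooth_curve_on ?f {0<..<1}"
  proof (rule smooth_curve_rational)
    fix i j
    obtain p q where pq: "\<forall>t\<in>S. poly q t \<noteq> 0 \<and> ?c t $ i $ j = poly p t / poly q t"
      using rect_at_rational[OF N(2,4) S0, where i=i and j=j] unfolding rational_on_def by blast
    let ?h = "[:r - \<epsilon>, 2 * \<epsilon>:]"
    have h: "poly ?h t = ?l t" for t by (simp add: algebra_simps)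
    have "\<forall>t\<in>{0<..<1}. poly (pcompose q ?h) t \<noteq> 0 \<and> ?f t $ i $ j = poly (pcompose p ?h) t / poly (pcompose q ?h) t"
      unfolding poly_pcompose h using pq l by blast
    then show "rational_on {0<..<1} (\<lambda>t. ?f t $ i $ j)"
      unfolding rational_on_def by blast
  qed simp
  have nonzero: "vector_derivative ?f (at t) \<noteq> 0" if t: "t \<in> {0<..<1}" for t
  proof
    assume z: "vector_derivative ?f (at t) = 0"
    have "\<exists>f'. (?f has_vector_derivative f') (at t)"
      using smooth t unfolding smooth_curve_on_def by metis
    then have d0: "(?f has_vector_derivative 0) (at t)"
      using z vector_derivative_works by (metis differentiableI_vector)
    have w: "((\<lambda>t. ?f t $ 1 - ?f t $ 0) has_vector_derivative 0) (at t)"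
      and x: "((\<lambda>t. ?f t $ 2 - ?f t $ 1) has_vector_derivative 0) (at t)"
      using has_vector_derivative_diff[OF nth_has_vector_derivative[OF d0, of 1] nth_has_vector_derivative[OF d0, of 0]]
        has_vector_derivative_diff[OF nth_has_vector_derivative[OF d0, of 2] nth_has_vector_derivative[OF d0, of 1]]
      by simp_all
    have "(?l has_real_derivative 2 * \<epsilon>) (at t)" by (auto intro!: derivative_eq_intros)
    from has_vector_derivative_scaleR[OF this perp_has_vector_derivative[OF w]]
    have "((\<lambda>t. ?f t $ 2 - ?f t $ 1) has_vector_derivative (2 * \<epsilon>) *\<^sub>R perp (?f t $ 1 - ?f t $ 0)) (at t)"
      unfolding rect_at_nth by (simp add: perp_0)
    from vector_derivative_unique_at[OF this x]
    have "perp (?f t $ 1 - ?f t $ 0) = 0" using \<epsilon>(1) by simp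
    then have "?f t $ 1 - ?f t $ 0 = 0" by (metis norm_perp norm_eq_zero)
    then show False using U(5) l[OF t] by auto
  qed
  show "smooth_point I R"
    unfolding smooth_point_def using R oW RW hom smooth nonzero by blast
qed

end

section \<open>Rectangles with a corner at a vertex\<close>

text \<open>
  On a compact neighbourhood a continuous injective function is a homeomorphism onto its image, so it is
  a chart if the image contains an interval around the value at \<open>p\<close>.
\<close>

lemma chart_from_function:
  fixes M :: "'a::euclidean_space set" and f :: "'a \<Rightarrow> real"
  assumes p: "p \<in> M" "p \<in> interior B" and comp: "compact (M \<inter> B)"
    and f: "continuous_on UNIV f" "inj_on f (M \<inter> B)" and \<delta>: "\<delta> > 0" "{f p - \<delta>..f p + \<delta>} \<subseteq> f ` (M \<inter> B)"
  shows "\<exists>U. open U \<and> p \<in> U \<and> U \<subseteq> B \<and> (M \<inter> U) homeomorphic {0<..<1::real}"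
proof -
  have pB: "p \<in> M \<inter> B" using p interior_subset by blast
  obtain g where hom: "homeomorphism (M \<inter> B) (f ` (M \<inter> B)) f g"
    using homeomorphism_compact[OF comp continuous_on_subset[OF f(1) subset_UNIV] refl f(2)] by blast
  let ?J = "{f p - \<delta><..<f p + \<delta>}"
  have J: "?J \<subseteq> f ` (M \<inter> B)" using \<delta>(2) by auto
  have "continuous_on (f ` (M \<inter> B)) g" using hom by (simp add: homeomorphism_def)
  then have "continuous_on ?J g" using J by (rule continuous_on_subset)
  then have "open (?J \<inter> g -` interior B)"
    by (rule continuous_open_preimage) auto
  moreover have "g (f p) = p" using hom pB unfolding homeomorphism_def by blast
  then have "f p \<in> ?J \<inter> g -` interior B" using \<delta>(1) p(2) by simp
  ultimately obtain \<epsilon> where \<epsilon>: "\<epsilon> > 0" "ball (f p) \<epsilon> \<subseteq> ?J \<inter> g -` interior B"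
    by (meson open_contains_ball)
  let ?U = "interior B \<inter> f -` ball (f p) \<epsilon>"
  have "open ?U"
    using f(1) by (intro open_Int open_interior) (simp add: continuous_on_open_vimage)
  moreover have "p \<in> ?U" using p(2) \<epsilon>(1) by simp
  moreover have "?U \<subseteq> B" using interior_subset by blast
  moreover have "homeomorphism (M \<inter> ?U) (ball (f p) \<epsilon>) f g"
  proof (rule homeomorphism_of_subsets[OF hom])
    show "M \<inter> ?U \<subseteq> M \<inter> B" using interior_subset by blast
    show "f ` (M \<inter> ?U) = ball (f p) \<epsilon>"
    proof
      show "ball (f p) \<epsilon> \<subseteq> f ` (M \<inter> ?U)"
      proof
        fix y assume y: "y \<in> ball (f p) \<epsilon>"
        then have "y \<in> f ` (M \<inter> B)" "g y \<in> interior B" using \<epsilon>(2) J by auto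
        then have "g y \<in> M \<inter> B" "f (g y) = y"
          using hom unfolding homeomorphism_def by blast+
        then show "y \<in> f ` (M \<inter> ?U)" using \<open>g y \<in> interior B\<close> y by (intro image_eqI[of _ _ "g y"]) auto
      qed
    qed auto
  qed (use \<epsilon>(2) J in auto)
  then have "(M \<inter> ?U) homeomorphic ball (f p) \<epsilon>" unfolding homeomorphic_def by blast
  then have "(M \<inter> ?U) homeomorphic {0<..<1::real}"
    by (rule homeomorphic_trans)
      (use homeomorphic_balls(1)[OF \<epsilon>(1), of "1/2" "f p" "1/2 :: real"] greaterThanLessThan_eq_ball[of 0 "1::real"] in simp)
  ultimately show ?thesis by blast
qed

lemma DERIV_max_0:
  assumes "(f has_real_derivative l) (at x)" "\<forall>\<^sub>F y in at x. f y \<le> f x" shows "l = (0::real)"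
proof -
  obtain \<delta> where "\<delta> > 0" "\<And>y. y \<noteq> x \<Longrightarrow> dist y x < \<delta> \<Longrightarrow> f y \<le> f x"
    using assms(2) unfolding eventually_at by blast
  then show ?thesis
    using DERIV_local_max[OF assms(1), of \<delta>] by (metis abs_minus_commute dist_real_def order_refl)
qed

lemma DERIV_const_0:
  assumes "(f has_real_derivative l) (at x)" "\<forall>\<^sub>F y in at x. f y = f x" shows "l = (0::real)"
  by (rule DERIV_max_0[OF assms(1)]) (use assms(2) in eventually_elim, simp)

context generic_polygon
begin

text \<open>
  The two vertices fix \<open>w\<close>, and corners 2 and 3 then give two linear equations for \<open>r\<close>; \<open>adj_nz\<close> says that
  they are incompatible.
\<close>

lemma no_two_vertices_adjacent:
  assumes R: "R \<in> I" "R $ 0 \<in> V" "R $ 1 \<in> V" shows False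
proof -
  obtain p w r where r: "w \<noteq> 0" "r > 0" "R = rect p w r" using R(1) by (rule inscribedE)
  obtain i j where ij: "i < N" "j < N" "p = v i" "p + w = v j" using R(2,3) r by auto
  have w: "w = v j - v i" using ij by (metis add_diff_cancel_left')
  have ne: "i \<noteq> j" using w r(1) by auto
  obtain k a b c where car: "carried k a b c R" using inscribed_carried[OF R(1)] by blast
  then have N: "b < N" "c < N" and "v j + r *\<^sub>R perp w \<in> E b" "v i + r *\<^sub>R perp w \<in> E c"
    using r(3) ij by (auto simp: carried_def)
  then have "e b (v j + r *\<^sub>R perp w) = 0" "e c (v i + r *\<^sub>R perp w) = 0" by (auto dest: side_edge)
  then have b: "e b (v j) = r * (d b \<bullet> w)" and c: "e c (v i) = r * (d c \<bullet> w)"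
    by (simp_all add: side_shift cross2_simps)
  have 1: "b \<noteq> c"
  proof
    assume "b = c"
    have x: "cross2 (d b) w = e b (v i) - e b (v j)"
      by (simp add: w side_def cross2_simps)
    then have "cross2 (d b) w = 0" using b c \<open>b = c\<close> by simp
    then have *: "b \<in> {prv N i, i} \<and> b \<in> {prv N j, j}" using par_nz[OF N(1) ij(2,1)] ne w by blast
    then have "e b (v j) = 0" using vertex_in_edge[OF ij(2)] side_edge by blast
    then have "d b \<bullet> w = 0" using b r(2) by simp
    then show False using dir_det[OF N(1) \<open>cross2 (d b) w = 0\<close>] r(1) by blast
  qed
  have nz: "d b \<bullet> w \<noteq> 0" "d c \<bullet> w \<noteq> 0" using perp_nz[OF N(1) ij(2,1)] perp_nz[OF N(2) ij(2,1)] ne w by auto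
  have 2: "b \<notin> {prv N j, j}"
    using vertex_in_edge[OF ij(2)] side_edge b nz r(2) by fastforce
  have 3: "c \<notin> {prv N i, i}"
    using vertex_in_edge[OF ij(1)] side_edge c nz r(2) by fastforce
  have "e b (v j) * (d c \<bullet> w) - e c (v i) * (d b \<bullet> w) = 0" unfolding b c by simp
  then show False using adj_nz[OF ij(1,2) ne N 1 2 3] w by simp
qed

text \<open>
  The line of corner 1 and the point reflection of the line of corner 3 in the centre intersect in
  corner 1, which must be on the circle with the given diagonal; \<open>diag_nz\<close> says that it is not.
\<close>

lemma no_two_vertices_diagonal:
  assumes R: "R \<in> I" "R $ 0 \<in> V" "R $ 2 \<in> V" shows False
proof -
  obtain p w r where r: "w \<noteq> 0" "r > 0" "R = rect p w r" using R(1) by (rule inscribedE)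
  obtain i j where ij: "i < N" "j < N" "p = v i" "p + w + r *\<^sub>R perp w = v j" using R(2,3) r by auto
  have z: "v j - v i = w + r *\<^sub>R perp w" unfolding ij(3)[symmetric] ij(4)[symmetric] by simp
  have zw: "(v j - v i) \<bullet> w = w \<bullet> w" unfolding z by (simp add: inner_add_left inner_commute[of "perp w"] cross2_simps)
  have ne: "i \<noteq> j"
  proof
    assume "i = j"
    then have "w \<bullet> w = 0" using zw by simp
    then show False using r(1) by simp
  qed
  obtain k a b' b where car: "carried k a b' b R" using inscribed_carried[OF R(1)] by blast
  then have N: "a < N" "b < N" and "v i + w \<in> E a" "v i + r *\<^sub>R perp w \<in> E b"
    using r(3) ij by (auto simp: carried_def)
  then have on: "e a (v i + w) = 0" "e b (v i + r *\<^sub>R perp w) = 0" by (auto dest: side_edge)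
  have a: "e a (v i) = cross2 (d a) w" using on by (simp add: side_shift)
  have "v i + r *\<^sub>R perp w = v j + (- w)" using z by (simp add: algebra_simps)
  then have b: "e b (v j) = - cross2 (d b) w"
    using on(2) side_shift[of b "v j" "- w"] by (simp only: cross2_simps)
  have diff: "e l (v i) - e l (v j) = cross2 (d l) w + r * (d l \<bullet> w)" for l
  proof -
    have "e l (v i) - e l (v j) = cross2 (d l) (v j - v i)" by (simp add: side_def cross2_simps)
    then show ?thesis by (simp add: z cross2_simps)
  qed
  have edge0: "x \<in> {prv N i, i} \<Longrightarrow> e x (v i) = 0" "x \<in> {prv N j, j} \<Longrightarrow> e x (v j) = 0" for x
    using vertex_in_edge ij(1,2) side_edge by blast+
  have a1: "cross2 (d a) w = 0" if "a \<in> {prv N i, i}" using a edge0(1)[OF that] by simp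
  have a2: "d a \<bullet> w = 0" if "a \<in> {prv N j, j}" using a edge0(2)[OF that] diff[of a] r(2) by simp
  have b1: "d b \<bullet> w = 0" if "b \<in> {prv N i, i}" using b edge0(1)[OF that] diff[of b] r(2) by simp
  have b2: "cross2 (d b) w = 0" if "b \<in> {prv N j, j}" using b edge0(2)[OF that] by simp
  have H1: "\<not> (a \<in> {prv N i, i} \<and> a \<in> {prv N j, j})" using a1 a2 dir_det[OF N(1)] r(1) by blast
  have H2: "\<not> (b \<in> {prv N i, i} \<and> b \<in> {prv N j, j})" using b1 b2 dir_det[OF N(2)] r(1) by blast
  have ab: "a \<noteq> b"
  proof
    assume "a = b"
    then have "e a (v i) + e a (v j) = 0" using a b by simp
    then show False using mid_nz[OF N(1) ij(1,2) ne H1] by simp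
  qed
  have H3: "\<not> (a \<in> {prv N i, i, prv N j, j} \<and> b \<in> {prv N i, i, prv N j, j})"
  proof
    assume *: "a \<in> {prv N i, i, prv N j, j} \<and> b \<in> {prv N i, i, prv N j, j}"
    then consider "a \<in> {prv N i, i}" "b \<in> {prv N i, i}" | "a \<in> {prv N i, i}" "b \<in> {prv N j, j}"
      | "a \<in> {prv N j, j}" "b \<in> {prv N i, i}" | "a \<in> {prv N j, j}" "b \<in> {prv N j, j}" by blast
    then show False
    proof cases
      case 1 then show ?thesis using a1 b1 skew_dirs[OF N r(1)] by blast
    next
      case 2 then show ?thesis using a1 b2 parallel_dirs[OF N r(1)] ab by blast
    next
      case 3 then show ?thesis using a2 b1 perp_dirs[OF N r(1)] ab by blast
    next
      case 4 then show ?thesis using a2 b2 skew_dirs[OF N(2,1) r(1)] by blast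
    qed
  qed
  let ?D = "cross2 (d a) (d b)"
  have W: "e a (v i) *\<^sub>R d b + e b (v j) *\<^sub>R d a = ?D *\<^sub>R w"
    unfolding a b by (simp add: eq2_iff cross2_def algebra_simps)
  have "?D * ((v j - v i) \<bullet> (?D *\<^sub>R w)) - (?D *\<^sub>R w) \<bullet> (?D *\<^sub>R w) = 0"
    using zw by simp
  then show False using diag_nz[OF ij(1,2) ne N ab H1 H2 H3] unfolding W by blast
qed

lemma one_vertex:
  assumes R: "R \<in> I" "R $ 0 \<in> V" shows "R $ 1 \<notin> V" "R $ 2 \<notin> V" "R $ 3 \<notin> V"
  using no_two_vertices_adjacent[OF R] no_two_vertices_diagonal[OF R]
    no_two_vertices_adjacent[of "cyc (cyc (cyc R))"] R by (auto simp: inscribed_rectangles_cyc)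

text \<open>The two edges at vertex \<open>j\<close>, unfolded to a line.\<close>

definition hinge :: "nat \<Rightarrow> real \<Rightarrow> real^2" where
  "hinge j s = v j + max s 0 *\<^sub>R d j + min s 0 *\<^sub>R d (prv N j)"

definition unhinge :: "nat \<Rightarrow> real^2 \<Rightarrow> real" where
  "unhinge j q = cross2 (q - v j) (d (prv N j) - d j) / cross2 (d j) (d (prv N j))"

lemma prv_lt: "prv N j < N"
  by (rule prv_less[OF N0])

lemma prv_ne: "j < N \<Longrightarrow> prv N j \<noteq> j"
  by (rule prv_neq(1)[OF N3])

lemma corner_cross: "j < N \<Longrightarrow> cross2 (d j) (d (prv N j)) \<noteq> 0"
  using cross_nz[OF _ prv_lt] prv_ne by metis

lemma unhinge_hinge: "j < N \<Longrightarrow> unhinge j (hinge j s) = s"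
  using corner_cross[of j] cross2_commute[of "d (prv N j)" "d j"]
  by (auto simp: unhinge_def hinge_def cross2_simps max_def min_def field_simps)

lemma hinge_range:
  assumes "j < N" shows "q \<in> E j \<union> E (prv N j) \<longleftrightarrow> (\<exists>s. \<bar>s\<bar> \<le> 1 \<and> q = hinge j s)"
proof
  assume "q \<in> E j \<union> E (prv N j)"
  then show "\<exists>s. \<bar>s\<bar> \<le> 1 \<and> q = hinge j s"
  proof
    assume "q \<in> E j"
    then obtain s where "0 \<le> s" "s \<le> 1" "q = v j + s *\<^sub>R d j" using edge_param by blast
    then show ?thesis by (intro exI[of _ s]) (simp add: hinge_def)
  next
    assume "q \<in> E (prv N j)"
    then obtain s where s: "0 \<le> s" "s \<le> 1" "q = v (prv N j) + s *\<^sub>R d (prv N j)" using edge_param by blast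
    have "v j = v (prv N j) + d (prv N j)" using Suc_prv[OF assms] by (simp add: dir_def)
    then have "q = hinge j (s - 1)" using s by (simp add: hinge_def algebra_simps)
    then show ?thesis using s by (intro exI[of _ "s - 1"]) simp
  qed
next
  assume "\<exists>s. \<bar>s\<bar> \<le> 1 \<and> q = hinge j s"
  then obtain s where s: "\<bar>s\<bar> \<le> 1" "q = hinge j s" by blast
  have "v j = v (prv N j) + d (prv N j)" using Suc_prv[OF assms] by (simp add: dir_def)
  then have "q = v (prv N j) + (1 + s) *\<^sub>R d (prv N j)" if "s < 0"
    using s that by (simp add: hinge_def algebra_simps)
  then show "q \<in> E j \<union> E (prv N j)"
    using s edge_paramI[of s j] edge_paramI[of "1 + s" "prv N j"]
    by (cases "s < 0") (auto simp: hinge_def)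
qed

lemma unhinge_continuous: "continuous_on UNIV (unhinge j)"
  unfolding unhinge_def[abs_def] divide_inverse by (intro continuous_intros)

lemma hinge_continuous: "continuous_on UNIV (hinge j)"
  unfolding hinge_def[abs_def] by (intro continuous_intros)

lemma inscribed_locally_compact:
  assumes R: "R \<in> I" "open U" "R \<in> U"
  obtains \<epsilon> where "\<epsilon> > 0" "cball R \<epsilon> \<subseteq> U" "compact (I \<inter> cball R \<epsilon>)"
proof -
  define C where "C = {S :: real^2^4. S $ 1 - S $ 0 = S $ 2 - S $ 3} \<inter> {S. (S $ 1 - S $ 0) \<bullet> (S $ 2 - S $ 1) = 0}
    \<inter> (\<Inter>i. {S. S $ i \<in> \<gamma>})"
  define Q where "Q = {S :: real^2^4. 0 < cross2 (S $ 1 - S $ 0) (S $ 2 - S $ 1)}"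
  have I: "I = C \<inter> Q" by (auto simp: inscribed_rectangles_def ccw_rectangle_def C_def Q_def cross2_def)
  have "closed {S :: real^2^4. S $ i \<in> \<gamma>}" for i
    using compact_imp_closed[OF curve_compact] closed_vimage_vec_nth[of \<gamma> i] by (simp add: vimage_def)
  then have C: "closed C"
    unfolding C_def by (intro closed_Int closed_INT closed_Collect_eq continuous_intros ballI)
  have "open Q" unfolding Q_def by (intro open_Collect_less continuous_intros)
  then have "open (U \<inter> Q)" "R \<in> U \<inter> Q" using R I by auto
  then obtain \<epsilon> where \<epsilon>: "\<epsilon> > 0" "cball R \<epsilon> \<subseteq> U \<inter> Q" by (meson open_contains_cball)
  then have "I \<inter> cball R \<epsilon> = C \<inter> cball R \<epsilon>" using I by auto
  then have "compact (I \<inter> cball R \<epsilon>)" using C by (simp add: closed_Int_compact)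
  then show ?thesis using that \<epsilon> by auto
qed

definition cornered :: "nat \<Rightarrow> nat \<Rightarrow> nat \<Rightarrow> nat \<Rightarrow> real^2^4 \<Rightarrow> bool" where
  "cornered j a b c S \<longleftrightarrow> a < N \<and> b < N \<and> c < N \<and>
     S $ 0 \<in> E j \<union> E (prv N j) \<and> S $ 1 \<in> E a \<and> S $ 2 \<in> E b \<and> S $ 3 \<in> E c"

text \<open>
  Near a rectangle with corner 0 at vertex \<open>j\<close>, being inscribed means that corner 0 is on one of the two
  edges at \<open>j\<close> and the other corners are on fixed lines.
\<close>

lemma local_cornered:
  assumes R: "R \<in> I" and j: "j < N" "R $ 0 = v j"
  shows "\<exists>U a b c. open U \<and> R \<in> U \<and> cornered j a b c R \<and> (\<forall>S\<in>U. S \<in> I \<longrightarrow> cornered j a b c S) \<and>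
    (\<forall>S\<in>U. S $ 0 \<in> E j \<union> E (prv N j) \<longrightarrow> e a (S $ 1) = 0 \<longrightarrow> e b (S $ 2) = 0 \<longrightarrow> e c (S $ 3) = 0 \<longrightarrow> cornered j a b c S) \<and>
    (\<forall>S\<in>U. S $ 1 \<noteq> S $ 0 \<and> (S $ 0 \<in> V \<longrightarrow> S $ 0 = v j) \<and> S $ 1 \<notin> V \<and> S $ 2 \<notin> V \<and> S $ 3 \<notin> V)"
proof -
  obtain k a b c where car: "carried k a b c R" using inscribed_carried[OF R] by blast
  then have N: "a < N" "b < N" "c < N" and on: "R $ 1 \<in> E a" "R $ 2 \<in> E b" "R $ 3 \<in> E c" by (auto simp: carried_def)
  have "R $ 0 \<in> V" using j by auto
  note nv = one_vertex[OF R this]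
  obtain W0 where W0: "open W0" "v j \<in> W0" "\<And>k x. k < N \<Longrightarrow> x \<in> W0 \<Longrightarrow> x \<in> E k \<Longrightarrow> v j \<in> E k"
    using local_edges[of "v j"] by blast
  obtain W1 where W1: "open W1" "R $ 1 \<in> W1" "\<And>x. x \<in> W1 \<Longrightarrow> x \<in> \<gamma> \<Longrightarrow> x \<in> E a" "\<And>x. x \<in> W1 \<Longrightarrow> e a x = 0 \<Longrightarrow> x \<in> E a" "W1 \<inter> V = {}"
    using nonvertex_neighbourhood[OF N(1) on(1) nv(1)] by blast
  obtain W2 where W2: "open W2" "R $ 2 \<in> W2" "\<And>x. x \<in> W2 \<Longrightarrow> x \<in> \<gamma> \<Longrightarrow> x \<in> E b" "\<And>x. x \<in> W2 \<Longrightarrow> e b x = 0 \<Longrightarrow> x \<in> E b" "W2 \<inter> V = {}"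
    using nonvertex_neighbourhood[OF N(2) on(2) nv(2)] by blast
  obtain W3 where W3: "open W3" "R $ 3 \<in> W3" "\<And>x. x \<in> W3 \<Longrightarrow> x \<in> \<gamma> \<Longrightarrow> x \<in> E c" "\<And>x. x \<in> W3 \<Longrightarrow> e c x = 0 \<Longrightarrow> x \<in> E c" "W3 \<inter> V = {}"
    using nonvertex_neighbourhood[OF N(3) on(3) nv(3)] by blast
  define W0' where "W0' = W0 - (V - {v j})"
  have W0': "open W0'" "v j \<in> W0'" unfolding W0'_def using W0(1,2) by (auto intro!: open_Diff finite_imp_closed)
  define U where "U = ((\<lambda>S. S $ 0) -` W0' \<inter> (\<lambda>S. S $ 1) -` W1 \<inter> (\<lambda>S. S $ 2) -` W2 \<inter> (\<lambda>S. S $ 3) -` W3) \<inter> {S. S $ 1 \<noteq> S $ (0::4)}"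
  have "open U" unfolding U_def
    using W0'(1) W1(1) W2(1) W3(1) by (intro open_Int open_vimage_vec_nth open_Collect_neq continuous_intros)
  moreover have "R \<in> U"
  proof -
    have "R $ 1 \<noteq> R $ 0" using inscribedE[OF R] by fastforce
    then show ?thesis using W0' W1 W2 W3 j by (simp add: U_def)
  qed
  moreover have vj: "v j \<in> E k \<Longrightarrow> k < N \<Longrightarrow> k \<in> {prv N j, j}" for k
    using vertex_on_line[OF j(1)] side_edge by blast
  have "cornered j a b c S" if S: "S \<in> U" "S \<in> I" for S
  proof -
    have g: "S $ i \<in> \<gamma>" for i using S(2) by (simp add: inscribed_rectangles_def)
    obtain k where k: "k < N" "S $ 0 \<in> E k" using g[of 0] unfolding curve_eq by blast
    have "S $ 0 \<in> W0" using S(1) by (simp add: U_def W0'_def)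
    then have "v j \<in> E k" using W0(3) k by blast
    then have "k \<in> {prv N j, j}" using vj k by blast
    then have "S $ 0 \<in> E j \<union> E (prv N j)" using k by auto
    then show ?thesis using S(1) g N W1(3) W2(3) W3(3) by (simp add: cornered_def U_def)
  qed
  moreover from this have "cornered j a b c R" using \<open>R \<in> U\<close> R by blast
  moreover have "cornered j a b c S" if "S \<in> U" "S $ 0 \<in> E j \<union> E (prv N j)" "e a (S $ 1) = 0" "e b (S $ 2) = 0" "e c (S $ 3) = 0" for S
    using that N W1(4) W2(4) W3(4) by (simp add: cornered_def U_def)
  moreover have "S $ 1 \<noteq> S $ 0 \<and> (S $ 0 \<in> V \<longrightarrow> S $ 0 = v j) \<and> S $ 1 \<notin> V \<and> S $ 2 \<notin> V \<and> S $ 3 \<notin> V" if "S \<in> U" for S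
    using that W1(5) W2(5) W3(5) by (auto simp: U_def W0'_def)
  ultimately show ?thesis
    by (intro exI[of _ U] exI[of _ a] exI[of _ b] exI[of _ c]) simp
qed

text \<open>
  Corner 0 is on both edges at the vertex, so both choices of its edge are restricted by
  \<open>carried_allowed\<close>; neighbouring corners on the two edges would make them perpendicular.
\<close>

lemma cornered_pattern:
  assumes R: "R \<in> I" and j: "j < N" "R $ 0 = v j" and co: "cornered j a b c R"
  shows "corner_pattern j a b c"
proof -
  obtain p w r where r: "w \<noteq> 0" "r > 0" "R = rect p w r" using R by (rule inscribedE)
  have N: "a < N" "b < N" "c < N" and on: "R $ 1 \<in> E a" "R $ 2 \<in> E b" "R $ 3 \<in> E c"
    using co by (auto simp: cornered_def)
  have e0: "R $ 0 \<in> E k" if "k \<in> {prv N j, j}" for k using vertex_in_edge[OF j(1) that] j by simp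
  have al: "allowed k a b c" if "k \<in> {prv N j, j}" for k
  proof (rule carried_allowed[OF r(3,1,2)])
    show "carried k a b c R" using e0[OF that] that N on prv_lt j by (auto simp: carried_def)
  qed
  have "allowed j a b c" by (rule al) simp
  then have 1: "\<not> (a = b \<and> b = c)" unfolding allowed_def by blast
  have 2: "a = b \<longrightarrow> k \<noteq> a \<and> k \<noteq> c" "b = c \<longrightarrow> k \<noteq> b \<and> k \<noteq> a" "a = c \<longrightarrow> k \<noteq> a" if "k \<in> {prv N j, j}" for k
    using al[OF that] unfolding allowed_def by blast+
  have "\<not> (a \<in> {prv N j, j} \<and> c \<in> {prv N j, j})"
  proof
    assume *: "a \<in> {prv N j, j} \<and> c \<in> {prv N j, j}"
    have z: "e a p = 0" "e a (p + w) = 0" "e c p = 0" "e c (p + r *\<^sub>R perp w) = 0"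
      using on[THEN side_edge] e0[THEN side_edge] * unfolding r(3) rect_nth by simp_all
    show False using skew_dirs[OF N(1,3) r(1) same_line(1)[OF r(2) z(1,2)]] same_line(4)[OF r(2) z(3,4)] by simp
  qed
  then show ?thesis
    unfolding corner_pattern_def using 1 2[of j] 2[of "prv N j"] by auto
qed

end

lemma continuous_on_rect [continuous_intros]:
  assumes "continuous_on S p" "continuous_on S w" "continuous_on S r"
  shows "continuous_on S (\<lambda>x. rect (p x) (w x) (r x))"
proof -
  have "\<forall>i. continuous_on S (\<lambda>x. rect (p x) (w x) (r x) $ i)"
    unfolding forall_4' rect_nth using assms by (intro conjI continuous_intros)
  then have "continuous_on S (\<lambda>x. \<chi> i. rect (p x) (w x) (r x) $ i)"
    by (intro continuous_on_vec_lambda) auto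
  then show ?thesis by simp
qed

lemma IVT_sign:
  fixes f :: "real \<Rightarrow> real"
  assumes "a \<le> b" "continuous_on {a..b} f" "f a * f b < 0"
  shows "\<exists>x\<in>{a..b}. f x = 0"
proof (cases "f a < 0")
  case True
  then have "f b > 0" using assms(3) by (simp add: mult_less_0_iff)
  then show ?thesis using IVT'[of f a 0 b] True assms(1,2) by auto
next
  case False
  then have "f a > 0" "f b < 0" using assms(3) by (auto simp: mult_less_0_iff)
  then show ?thesis using IVT2'[of f b 0 a] assms(1,2) by auto
qed

context generic_polygon
begin

lemma pt_continuous:
  "continuous_on S (\<lambda>q. ptA N v q a b c)" "continuous_on S (\<lambda>q. ptB N v q a b c)" "continuous_on S (\<lambda>q. ptC N v q a b c)"
  unfolding ptA_def ptB_def ptC_def quadA_def quadB_def quadC_def side_def by (intro continuous_intros)+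

lemma corner_equations:
  assumes R: "R \<in> I" "R = rect p w r" "w \<noteq> 0" "r > 0" and co: "cornered j a b c R"
  shows "w = side_of p a c r" "phi p a b c r = 0"
proof -
  have "e a (R $ 1) = 0" "e b (R $ 2) = 0" "e c (R $ 3) = 0" "a < N" "c < N"
    using co side_edge by (auto simp: cornered_def)
  then show "w = side_of p a c r" "phi p a b c r = 0"
    using on_lines_iff[OF _ _ R(4), of a c p w b] unfolding R(2) rect_nth by blast+
qed

text \<open>
  At a root the square of the derivative of a quadratic polynomial is its discriminant.
\<close>

lemma corner_simple_root:
  assumes R: "R \<in> I" "R = rect p w r" "w \<noteq> 0" "r > 0" and j: "j < N" "R $ 0 = v j" and co: "cornered j a b c R"
  shows "2 * ptA N v (v j) a b c * r + ptB N v (v j) a b c \<noteq> 0"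
proof -
  let ?A = "ptA N v (v j) a b c" and ?B = "ptB N v (v j) a b c" and ?C = "ptC N v (v j) a b c"
  have p: "p = v j" using j R(2) by simp
  have "?A * r\<^sup>2 + ?B * r + ?C = 0"
    using corner_equations(2)[OF R co] unfolding phi_def p .
  then have "(2 * ?A * r + ?B)\<^sup>2 = ?B\<^sup>2 - 4 * ?A * ?C" by algebra
  moreover have "?B\<^sup>2 - 4 * ?A * ?C \<noteq> 0"
    using disc_nz[OF j(1) _ _ _ cornered_pattern[OF R(1) j co]] co by (simp add: cornered_def)
  ultimately show ?thesis by auto
qed

lemma hinge_0 [simp]: "hinge j 0 = v j"
  by (simp add: hinge_def)

text \<open>
  The chart is the position of corner 0 on the two unfolded edges. Since the root is simple, the equation
  \<open>phi q = 0\<close> has exactly one root near \<open>r\<close> for each \<open>q\<close> near the vertex: existence follows from a change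
  of sign, uniqueness from the factorization of the difference \<open>phi q s - phi q t\<close>.
\<close>

lemma corner_chart:
  assumes R: "R \<in> I" and j: "j < N" "R $ 0 = v j"
  shows "\<exists>U. open U \<and> R \<in> U \<and> (I \<inter> U) homeomorphic {0<..<1::real} \<and> (\<forall>S\<in>I \<inter> U. S \<noteq> R \<longrightarrow> (\<forall>i. S $ i \<notin> V))"
proof -
  obtain U a b c where U: "open U" "R \<in> U" and co: "cornered j a b c R"
    and U': "\<forall>S\<in>U. S \<in> I \<longrightarrow> cornered j a b c S"
      "\<forall>S\<in>U. S $ 0 \<in> E j \<union> E (prv N j) \<longrightarrow> e a (S $ 1) = 0 \<longrightarrow> e b (S $ 2) = 0 \<longrightarrow> e c (S $ 3) = 0 \<longrightarrow> cornered j a b c S"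
      "\<forall>S\<in>U. S $ 1 \<noteq> S $ 0 \<and> (S $ 0 \<in> V \<longrightarrow> S $ 0 = v j) \<and> S $ 1 \<notin> V \<and> S $ 2 \<notin> V \<and> S $ 3 \<notin> V"
    using local_cornered[OF R j] by (elim exE conjE) (rule that; assumption)
  have UI: "\<And>S. S \<in> U \<Longrightarrow> S \<in> I \<Longrightarrow> cornered j a b c S"
    and UL: "\<And>S. S \<in> U \<Longrightarrow> S $ 0 \<in> E j \<union> E (prv N j) \<Longrightarrow> e a (S $ 1) = 0 \<Longrightarrow> e b (S $ 2) = 0 \<Longrightarrow> e c (S $ 3) = 0 \<Longrightarrow> cornered j a b c S"
    and U10: "\<And>S. S \<in> U \<Longrightarrow> S $ 1 \<noteq> S $ 0" and UV: "\<And>S. S \<in> U \<Longrightarrow> S $ 0 \<in> V \<Longrightarrow> S $ 0 = v j"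
    and UV': "\<And>S. S \<in> U \<Longrightarrow> S $ 1 \<notin> V \<and> S $ 2 \<notin> V \<and> S $ 3 \<notin> V"
    using U' by blast+
  have N: "a < N" "b < N" "c < N" using co by (auto simp: cornered_def)
  obtain p w r where r: "w \<noteq> 0" "r > 0" "R = rect p w r" using R by (rule inscribedE)
  have p: "p = v j" using j r by simp
  note eqs = corner_equations[OF R r(3,1,2) co, unfolded p]
  define A B where "A q = ptA N v q a b c" and "B q = ptB N v q a b c" for q
  define \<kappa> where "\<kappa> = 2 * A (v j) * r + B (v j)"
  have \<kappa>: "\<kappa> \<noteq> 0" using corner_simple_root[OF R r(3,1,2) j co] by (simp add: \<kappa>_def A_def B_def)
  have phi_diff: "phi q a b c \<rho> - phi q a b c \<rho>' = (\<rho> - \<rho>') * (A q * (\<rho> + \<rho>') + B q)" for q \<rho> \<rho>'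
    by (simp add: phi_def A_def B_def power2_eq_square algebra_simps)
  \<comment> \<open>near \<open>R\<close> the corner on the two edges at the vertex determines the rectangle\<close>
  define g where "g = (\<lambda>x :: (real^2^4) \<times> (real^2^4).
    A (fst x $ 0) * (aspect_ratio (fst x) + aspect_ratio (snd x)) + B (fst x $ 0))"
  have "continuous_on (U \<times> U) g"
    unfolding g_def A_def B_def aspect_ratio_def
    by (intro continuous_intros continuous_on_compose2[OF pt_continuous(1)[of UNIV]] continuous_on_compose2[OF pt_continuous(2)[of UNIV]])
      (use U10 in auto)
  then have "open ((U \<times> U) \<inter> g -` (- {0}))"
    by (rule continuous_open_preimage) (auto simp: U(1) open_Times)
  moreover have "(R, R) \<in> (U \<times> U) \<inter> g -` (- {0})"
    using U(2) \<kappa> r j by (simp add: g_def \<kappa>_def aspect_ratio_rect)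
  ultimately obtain U1 U2 where U12: "open U1" "open U2" "(R, R) \<in> U1 \<times> U2" "U1 \<times> U2 \<subseteq> (U \<times> U) \<inter> g -` (- {0})"
    by (rule open_prod_elim)
  have U12': "open (U1 \<inter> U2)" "R \<in> U1 \<inter> U2" using U12 by auto
  obtain \<epsilon> where \<epsilon>: "\<epsilon> > 0" "cball R \<epsilon> \<subseteq> U1 \<inter> U2" "compact (I \<inter> cball R \<epsilon>)"
    using inscribed_locally_compact[OF R U12'] by blast
  have BU: "S \<in> U" if "S \<in> cball R \<epsilon>" for S
  proof -
    have "(S, R) \<in> U1 \<times> U2" using that \<epsilon>(2) U12(3) by auto
    then show ?thesis using U12(4) by auto
  qed
  have inj0: "S = S'" if S: "S \<in> I" "S' \<in> I" "S \<in> cball R \<epsilon>" "S' \<in> cball R \<epsilon>" "S $ 0 = S' $ 0" for S S'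
  proof -
    obtain q w \<rho> where r1: "w \<noteq> 0" "\<rho> > 0" "S = rect q w \<rho>" using S(1) by (rule inscribedE)
    obtain q' w' \<rho>' where r2: "w' \<noteq> 0" "\<rho>' > 0" "S' = rect q' w' \<rho>'" using S(2) by (rule inscribedE)
    have q: "q' = q" using S(5) r1 r2 by simp
    note e1 = corner_equations[OF S(1) r1(3,1,2) UI[OF BU[OF S(3)] S(1)]]
    note e2 = corner_equations[OF S(2) r2(3,1,2) UI[OF BU[OF S(4)] S(2)], unfolded q]
    have "(S, S') \<in> U1 \<times> U2" using S(3,4) \<epsilon>(2) by auto
    then have "g (S, S') \<noteq> 0" using U12(4) by auto
    then have "A q * (\<rho> + \<rho>') + B q \<noteq> 0"
      using r1 r2 by (simp add: g_def aspect_ratio_rect)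
    then have "\<rho> = \<rho>'" using phi_diff[of q \<rho> \<rho>'] e1(2) e2(2) by simp
    then show ?thesis using r1(3) r2(3) q e1(1) e2(1) by simp
  qed
  let ?f = "\<lambda>S :: real^2^4. unhinge j (S $ 0)"
  have inj: "inj_on ?f (I \<inter> cball R \<epsilon>)"
  proof (rule inj_onI)
    fix S S' assume S: "S \<in> I \<inter> cball R \<epsilon>" "S' \<in> I \<inter> cball R \<epsilon>" and eq: "?f S = ?f S'"
    have "cornered j a b c S" "cornered j a b c S'" using S UI BU by auto
    then obtain s s' where "S $ 0 = hinge j s" "S' $ 0 = hinge j s'"
      using hinge_range[OF j(1)] unfolding cornered_def by metis
    then have "S $ 0 = S' $ 0" using eq unhinge_hinge[OF j(1)] by simp
    then show "S = S'" using inj0 S by blast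
  qed
  have contf: "continuous_on UNIV ?f"
    by (rule continuous_on_compose2[OF unhinge_continuous]) (auto intro!: continuous_intros)
  have f0: "?f R = 0" using unhinge_hinge[OF j(1), of 0] j by simp
  \<comment> \<open>the simple root persists, and so does the rectangle, when the corner moves along the edges\<close>
  define F where "F = (\<lambda>x :: (real^2) \<times> real. rect (fst x) (side_of (fst x) a c (snd x)) (snd x))"
  have "continuous_on (UNIV \<times> {0<..}) F"
    unfolding F_def side_of_def side_vec_def side_def divide_inverse by (intro continuous_intros) auto
  then have "open ((UNIV \<times> {0<..}) \<inter> F -` ball R \<epsilon>)"
    by (rule continuous_open_preimage) (auto simp: open_Times)
  moreover have "(v j, r) \<in> (UNIV \<times> {0<..}) \<inter> F -` ball R \<epsilon>"
    using \<epsilon>(1) r p eqs(1) by (simp add: F_def)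
  ultimately obtain Q1 T where QT: "open Q1" "open T" "(v j, r) \<in> Q1 \<times> T" "Q1 \<times> T \<subseteq> (UNIV \<times> {0<..}) \<inter> F -` ball R \<epsilon>"
    by (rule open_prod_elim)
  then obtain \<eta> where \<eta>: "\<eta> > 0" "ball r \<eta> \<subseteq> T" by (meson open_contains_ball mem_Sigma_iff)
  \<comment> \<open>within \<open>t\<close> of the root the linear term of \<open>phi (v j)\<close> dominates, so the sign changes\<close>
  define t where "t = min (\<eta> / 2) (\<bar>\<kappa>\<bar> / (2 * (\<bar>A (v j)\<bar> + 1)))"
  have t: "t > 0" "t < \<eta>" "\<bar>A (v j)\<bar> * t < \<bar>\<kappa>\<bar>"
  proof -
    show "t > 0" "t < \<eta>" using \<eta>(1) \<kappa> by (auto simp: t_def)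
    have "\<bar>A (v j)\<bar> * t \<le> \<bar>A (v j)\<bar> * (\<bar>\<kappa>\<bar> / (2 * (\<bar>A (v j)\<bar> + 1)))"
      by (intro mult_left_mono) (auto simp: t_def)
    also have "\<dots> < \<bar>\<kappa>\<bar>" using \<kappa> by (simp add: field_simps) (smt (verit) mult_nonneg_nonneg abs_ge_zero zero_less_abs_iff)
    finally show "\<bar>A (v j)\<bar> * t < \<bar>\<kappa>\<bar>" .
  qed
  have "\<bar>A (v j) * t\<bar> < \<bar>\<kappa>\<bar>" using t by (simp add: abs_mult)
  then have "(A (v j) * t)\<^sup>2 < \<kappa>\<^sup>2" using abs_le_square_iff[of \<kappa> "A (v j) * t"] by linarith
  moreover have "phi (v j) a b c (r + t) * phi (v j) a b c (r - t) = t\<^sup>2 * ((A (v j) * t)\<^sup>2 - \<kappa>\<^sup>2)"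
  proof -
    have "phi (v j) a b c (r + t) = t * (A (v j) * t + \<kappa>)"
      using phi_diff[of "v j" "r + t" r] eqs(2) by (simp add: \<kappa>_def algebra_simps)
    moreover have "phi (v j) a b c (r - t) = t * (A (v j) * t - \<kappa>)"
      using phi_diff[of "v j" "r - t" r] eqs(2) by (simp add: \<kappa>_def algebra_simps)
    ultimately show ?thesis by (simp only:) (simp add: power2_eq_square algebra_simps)
  qed
  ultimately have neg: "phi (v j) a b c (r - t) * phi (v j) a b c (r + t) < 0"
    using t(1) by (simp add: mult.commute mult_less_0_iff)
  define Q2 where "Q2 = {q. phi q a b c (r - t) * phi q a b c (r + t) < 0}"
  have Q2: "open Q2" "v j \<in> Q2"
    unfolding Q2_def phi_def using neg[unfolded phi_def]
    by (auto intro!: open_Collect_less continuous_intros pt_continuous)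
  have "open (hinge j -` (Q1 \<inter> Q2))"
    using hinge_continuous Q2(1) QT(1) by (simp add: continuous_on_open_vimage open_Int)
  moreover have "0 \<in> hinge j -` (Q1 \<inter> Q2)" using Q2 QT(3) by simp
  ultimately obtain \<delta>0 where \<delta>0: "\<delta>0 > 0" "ball 0 \<delta>0 \<subseteq> hinge j -` (Q1 \<inter> Q2)" by (meson open_contains_ball)
  define \<delta> where "\<delta> = min (\<delta>0 / 2) 1"
  have \<delta>: "\<delta> > 0" "\<delta> \<le> 1" "\<delta> < \<delta>0" using \<delta>0(1) by (auto simp: \<delta>_def)
  have surj: "s \<in> ?f ` (I \<inter> cball R \<epsilon>)" if s: "\<bar>s\<bar> \<le> \<delta>" for s
  proof -
    define q where "q = hinge j s"
    have q: "q \<in> Q1" "q \<in> Q2" using \<delta>0(2) s \<delta> by (auto simp: q_def subset_iff)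
    have "continuous_on {r - t..r + t} (phi q a b c)"
      unfolding phi_def[abs_def] by (intro continuous_intros)
    then obtain \<rho> where \<rho>: "\<rho> \<in> {r - t..r + t}" "phi q a b c \<rho> = 0"
      using IVT_sign[of "r - t" "r + t" "phi q a b c"] q(2) t(1) by (auto simp: Q2_def)
    then have "\<bar>r - \<rho>\<bar> < \<eta>" using t(1,2) by auto
    then have "\<rho> \<in> T" using \<eta>(2) by (auto simp: dist_real_def)
    then have \<rho>0: "\<rho> > 0" and Fb: "F (q, \<rho>) \<in> ball R \<epsilon>" using QT(4) q(1) by auto
    define S where "S = F (q, \<rho>)"
    have S: "S \<in> cball R \<epsilon>" "S $ 0 = q" "S = rect q (side_of q a c \<rho>) \<rho>" using Fb by (auto simp: S_def F_def)
    have q_edge: "S $ 0 \<in> E j \<union> E (prv N j)"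
      unfolding S(2) hinge_range[OF j(1)] q_def using s \<delta>(2) by (intro exI[of _ s]) simp
    have "e a (S $ 1) = 0" "e b (S $ 2) = 0" "e c (S $ 3) = 0"
      using on_lines_iff[OF N(1,3) \<rho>0, of q "side_of q a c \<rho>" b] \<rho>(2) unfolding S(3) rect_nth by blast+
    with UL[OF BU[OF S(1)] q_edge] have co': "cornered j a b c S" by blast
    then have "carried j a b c S \<or> carried (prv N j) a b c S"
      using j(1) prv_lt by (auto simp: cornered_def carried_def)
    moreover have "side_of q a c \<rho> \<noteq> 0" using U10[OF BU[OF S(1)]] unfolding S(3) rect_nth by auto
    then have "ccw_rectangle S" unfolding S(3) using \<rho>0 by (rule ccw_rectangle_rect)
    ultimately have "S \<in> I" using carried_inscribed by blast
    moreover have "?f S = s" unfolding S(2) q_def by (rule unhinge_hinge[OF j(1)])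
    ultimately show ?thesis using S(1) by blast
  qed
  have "{?f R - \<delta>..?f R + \<delta>} \<subseteq> ?f ` (I \<inter> cball R \<epsilon>)"
  proof
    fix s assume "s \<in> {?f R - \<delta>..?f R + \<delta>}"
    then have "\<bar>s\<bar> \<le> \<delta>" unfolding f0 by auto
    then show "s \<in> ?f ` (I \<inter> cball R \<epsilon>)" by (rule surj)
  qed
  from chart_from_function[OF R _ \<epsilon>(3) contf inj \<delta>(1) this]
  obtain W where W: "open W" "R \<in> W" "W \<subseteq> cball R \<epsilon>" "(I \<inter> W) homeomorphic {0<..<1::real}"
    using \<epsilon>(1) by auto
  have "\<forall>i. S $ i \<notin> V" if S: "S \<in> I \<inter> W" "S \<noteq> R" for S
  proof -
    have SB: "S \<in> cball R \<epsilon>" using S W(3) by auto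
    have "S $ 0 \<notin> V"
    proof
      assume "S $ 0 \<in> V"
      then have "S $ 0 = R $ 0" using UV[OF BU[OF SB]] j by simp
      then show False using inj0[of S R] S SB R \<epsilon>(1) by simp
    qed
    then show ?thesis using UV'[OF BU[OF SB]] unfolding forall_4' by blast
  qed
  then show ?thesis using W by blast
qed

text \<open>
  Consider an infinitesimal motion of the rectangle that fixes corner 0 and keeps the other corners on
  their lines and the angle right; \<open>x\<close> and \<open>y\<close> are the velocities of corners 1 and 3. It changes the
  aspect ratio at a rate \<open>\<sigma>\<close>, and the equations say that \<open>\<sigma>\<close> times the derivative of the quadratic
  polynomial vanishes.
\<close>

lemma simple_root_rigid:
  assumes N: "a < N" "c < N" and w: "w \<noteq> 0" "r > 0" "w = side_of p a c r" "phi p a b c r = 0"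
    and simple: "2 * ptA N v p a b c * r + ptB N v p a b c \<noteq> 0"
    and lin: "cross2 (d a) x = 0" "cross2 (d b) (x + y) = 0" "cross2 (d c) y = 0" "x \<bullet> (r *\<^sub>R perp w) + w \<bullet> y = 0"
  shows "x = 0" "y = 0"
proof -
  have "w \<bullet> (y - r *\<^sub>R perp x) = 0"
    using lin(4) by (simp add: inner_diff_right cross2_simps cross2_commute[of w x])
  then have "cross2 (perp w) (y - r *\<^sub>R perp x) = 0"
    by (simp add: plane_simps)
  moreover have "perp w \<noteq> 0" using w(1) by (metis norm_perp norm_eq_zero)
  ultimately obtain \<sigma> where \<sigma>: "y - r *\<^sub>R perp x = \<sigma> *\<^sub>R perp w" by (rule cross2_eq_0_imp_parallel)
  then have y: "y = r *\<^sub>R perp x + \<sigma> *\<^sub>R perp w" by (simp add: algebra_simps)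
  have sys: "cross2 (d a) x = 0 \<and> cross2 (d b) x + r * (d b \<bullet> x) = - \<sigma> * (d b \<bullet> w) \<and> r * (d c \<bullet> x) = - \<sigma> * (d c \<bullet> w)"
    using lin(1-3) unfolding y by (simp add: cross2_simps)
  have r0: "r \<noteq> 0" using w(2) by simp
  note tl = three_lines_iff[OF dot_nz[OF N] r0]
  note xq = tl[THEN iffD1, OF sys]
  have es: "e a p = cross2 (d a) w" "e b p = cross2 (d b) w + r * (d b \<bullet> w)" "e c p = r * (d c \<bullet> w)"
    using on_lines_iff[OF N w(2), of p w b] w(3,4) by (auto simp: side_shift cross2_simps)
  have "quadA (d a) (d b) (d c) 0 (- \<sigma> * (d b \<bullet> w)) (- \<sigma> * (d c \<bullet> w)) * r\<^sup>2 +
     quadB (d a) (d b) (d c) 0 (- \<sigma> * (d b \<bullet> w)) (- \<sigma> * (d c \<bullet> w)) * r +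
     quadC (d a) (d b) (d c) 0 (- \<sigma> * (d b \<bullet> w)) (- \<sigma> * (d c \<bullet> w))
     = \<sigma> * (2 * ptA N v p a b c * r + ptB N v p a b c)"
    unfolding ptA_def ptB_def es quadA_def quadB_def quadC_def plane_simps
    by (simp add: power2_eq_square algebra_simps)
  from trans[OF this[symmetric] conjunct2[OF xq]]
  have "\<sigma> * (2 * ptA N v p a b c * r + ptB N v p a b c) = 0" .
  then have "\<sigma> = 0" using simple by simp
  then show "x = 0" using xq by (simp add: side_vec_def)
  then show "y = 0" using y \<open>\<sigma> = 0\<close> by (simp add: perp_0)
qed

text \<open>
  The cross products of the position of corner 0 relative to the vertex with the two edge directions have
  constant sign along the curve and vanish at the vertex. Hence so do their derivatives, and corner 0
  has velocity zero; \<open>simple_root_rigid\<close> does the rest.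
\<close>

lemma corner_not_smooth:
  assumes R: "R \<in> I" and j: "j < N" "R $ 0 = v j"
  shows "\<not> smooth_point I R"
proof
  assume "smooth_point I R"
  then obtain W \<beta> \<beta>' where W: "open W" "R \<in> W" and hom: "homeomorphism {0<..<1} (I \<inter> W) \<beta> \<beta>'"
    and smooth: "smooth_curve_on \<beta> {0<..<1}" and nz: "\<forall>t\<in>{0<..<1}. vector_derivative \<beta> (at t) \<noteq> 0"
    unfolding smooth_point_def by blast
  obtain U a b c where U: "open U" "R \<in> U" and co: "cornered j a b c R"
    and UI: "\<And>S. S \<in> U \<Longrightarrow> S \<in> I \<Longrightarrow> cornered j a b c S"
    using local_cornered[OF R j] by metis
  have N: "a < N" "b < N" "c < N" using co by (auto simp: cornered_def)
  obtain p w r where r: "w \<noteq> 0" "r > 0" "R = rect p w r" using R by (rule inscribedE)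
  have p: "p = v j" using j r by simp
  define t0 where "t0 = \<beta>' R"
  have t0: "t0 \<in> {0<..<1}" "\<beta> t0 = R"
    using hom R W(2) unfolding homeomorphism_def t0_def by blast+
  obtain \<tau> where \<tau>: "(\<beta> has_vector_derivative \<tau>) (at t0)"
    using smooth t0(1) unfolding smooth_curve_on_def by metis
  then have \<tau>0: "\<tau> \<noteq> 0" using nz t0(1) vector_derivative_at by metis
  have "isCont \<beta> t0" using \<tau> has_vector_derivative_continuous by blast
  then have "\<forall>\<^sub>F t in at t0. \<beta> t \<in> U"
    using U t0(2) by (metis continuous_within topological_tendstoD)
  moreover have "\<forall>\<^sub>F t in at t0. t \<in> {0<..<1}"
    using t0(1) by (intro eventually_at_in_open') auto
  ultimately have ev: "\<forall>\<^sub>F t in at t0. cornered j a b c (\<beta> t) \<and> \<beta> t \<in> I"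
  proof eventually_elim
    case (elim t)
    then have "\<beta> t \<in> I" using hom unfolding homeomorphism_def by blast
    then show ?case using UI elim by blast
  qed
  have nth: "((\<lambda>t. \<beta> t $ i) has_vector_derivative \<tau> $ i) (at t0)" for i
    by (rule nth_has_vector_derivative[OF \<tau>])
  have nth2: "((\<lambda>t. \<beta> t $ i $ k) has_real_derivative \<tau> $ i $ k) (at t0)" for i k
    using nth_has_vector_derivative[OF nth] by (simp add: has_real_derivative_iff_has_vector_derivative)
  have cr: "((\<lambda>t. cross2 u (\<beta> t $ i - z)) has_real_derivative cross2 u (\<tau> $ i)) (at t0)" for u i z
    unfolding cross2_def vector_minus_component by (auto intro!: derivative_eq_intros nth2)
  \<comment> \<open>both quotients attain their maximum \<open>0\<close> at the vertex, whichever edge the corner is on\<close>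
  let ?p = "prv N j"
  have h: "\<forall>\<^sub>F t in at t0. cross2 (d j) (\<beta> t $ 0 - v j) / cross2 (d j) (d ?p) \<le> 0 \<and>
      cross2 (d ?p) (\<beta> t $ 0 - v j) / cross2 (d j) (d ?p) \<le> 0"
    using ev
  proof eventually_elim
    case (elim t)
    then obtain s where s: "\<beta> t $ 0 = hinge j s"
      using hinge_range[OF j(1)] by (auto simp: cornered_def)
    have "cross2 (d j) (\<beta> t $ 0 - v j) = min s 0 * cross2 (d j) (d ?p)"
      "cross2 (d ?p) (\<beta> t $ 0 - v j) = - max s 0 * cross2 (d j) (d ?p)"
      unfolding s hinge_def by (simp_all add: cross2_simps cross2_commute[of "d ?p" "d j"])
    then show ?case using corner_cross[OF j(1)] by simp
  qed
  have X: "cross2 (d j) (d ?p) \<noteq> 0" by (rule corner_cross[OF j(1)])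
  have "cross2 (d j) (\<tau> $ 0) / cross2 (d j) (d ?p) = 0"
    by (rule DERIV_max_0[OF DERIV_cdivide[OF cr[of "d j" 0 "v j"]]])
      (use h in \<open>eventually_elim, simp add: t0 j cross2_simps\<close>)
  moreover have "cross2 (d ?p) (\<tau> $ 0) / cross2 (d j) (d ?p) = 0"
    by (rule DERIV_max_0[OF DERIV_cdivide[OF cr[of "d ?p" 0 "v j"]]])
      (use h in \<open>eventually_elim, simp add: t0 j cross2_simps\<close>)
  ultimately have "cross2 (d j) (\<tau> $ 0) = 0" "cross2 (d ?p) (\<tau> $ 0) = 0" using X by simp_all
  then have T0: "\<tau> $ 0 = 0" using parallel_dirs[OF j(1) prv_lt] prv_ne[OF j(1)] by metis
  \<comment> \<open>the remaining conditions are equations that hold along the curve, so they can be differentiated\<close>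
  have on: "cross2 (d l) (\<tau> $ i) = 0" if "\<forall>\<^sub>F t in at t0. \<beta> t $ i \<in> E l" "R $ i \<in> E l" for l i
  proof (rule DERIV_const_0[OF cr[of "d l" i "v l"]])
    have z: "cross2 (d l) (q - v l) = 0" if "q \<in> E l" for q
      using side_edge[OF that] by (simp add: side_def cross2_simps)
    show "\<forall>\<^sub>F t in at t0. cross2 (d l) (\<beta> t $ i - v l) = cross2 (d l) (\<beta> t0 $ i - v l)"
      using that(1) by eventually_elim (simp add: z t0 that(2))
  qed
  have Ta: "cross2 (d a) (\<tau> $ 1) = 0" and Tb: "cross2 (d b) (\<tau> $ 2) = 0" and Tc: "cross2 (d c) (\<tau> $ 3) = 0"
    using co by (auto intro!: on eventually_mono[OF ev] simp: cornered_def)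
  have rect: "\<beta> t $ 1 - \<beta> t $ 0 = \<beta> t $ 2 - \<beta> t $ 3" "(\<beta> t $ 1 - \<beta> t $ 0) \<bullet> (\<beta> t $ 2 - \<beta> t $ 1) = 0" if "\<beta> t \<in> I" for t
    using that unfolding inscribed_rectangles_def ccw_rectangle_def by blast+
  have "\<tau> $ 1 $ k - \<tau> $ 0 $ k - \<tau> $ 2 $ k + \<tau> $ 3 $ k = 0" for k
  proof (rule DERIV_const_0)
    show "((\<lambda>t. \<beta> t $ 1 $ k - \<beta> t $ 0 $ k - \<beta> t $ 2 $ k + \<beta> t $ 3 $ k) has_real_derivative
      \<tau> $ 1 $ k - \<tau> $ 0 $ k - \<tau> $ 2 $ k + \<tau> $ 3 $ k) (at t0)"
      by (intro derivative_intros nth2)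
    have "S $ 1 $ k - S $ 0 $ k - S $ 2 $ k + S $ 3 $ k = 0" if "S \<in> I" for S
    proof -
      have "S $ 1 - S $ 0 = S $ 2 - S $ 3" using that unfolding inscribed_rectangles_def ccw_rectangle_def by blast
      then have "(S $ 1 - S $ 0) $ k = (S $ 2 - S $ 3) $ k" by (rule arg_cong)
      then show ?thesis by simp
    qed
    then show "\<forall>\<^sub>F t in at t0. \<beta> t $ 1 $ k - \<beta> t $ 0 $ k - \<beta> t $ 2 $ k + \<beta> t $ 3 $ k =
      \<beta> t0 $ 1 $ k - \<beta> t0 $ 0 $ k - \<beta> t0 $ 2 $ k + \<beta> t0 $ 3 $ k"
      using R t0 by (intro eventually_mono[OF ev]) simp
  qed
  then have "\<tau> $ 2 $ k = \<tau> $ 1 $ k + \<tau> $ 3 $ k" for k using T0 by (smt (verit) zero_index)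
  then have T2: "\<tau> $ 2 = \<tau> $ 1 + \<tau> $ 3" by (simp add: vec_eq_iff)
  have "(\<tau> $ 1 - \<tau> $ 0) \<bullet> (R $ 2 - R $ 1) + (R $ 1 - R $ 0) \<bullet> (\<tau> $ 2 - \<tau> $ 1) = 0"
  proof (rule DERIV_const_0)
    show "((\<lambda>t. (\<beta> t $ 1 - \<beta> t $ 0) \<bullet> (\<beta> t $ 2 - \<beta> t $ 1)) has_real_derivative
      (\<tau> $ 1 - \<tau> $ 0) \<bullet> (R $ 2 - R $ 1) + (R $ 1 - R $ 0) \<bullet> (\<tau> $ 2 - \<tau> $ 1)) (at t0)"
      unfolding inner2 vector_minus_component
      by (auto intro!: derivative_eq_intros nth2 simp: t0 algebra_simps)
    show "\<forall>\<^sub>F t in at t0. (\<beta> t $ 1 - \<beta> t $ 0) \<bullet> (\<beta> t $ 2 - \<beta> t $ 1) = (\<beta> t0 $ 1 - \<beta> t0 $ 0) \<bullet> (\<beta> t0 $ 2 - \<beta> t0 $ 1)"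
      using R t0 rect(2) by (intro eventually_mono[OF ev]) metis
  qed
  then have perp: "\<tau> $ 1 \<bullet> (r *\<^sub>R perp w) + w \<bullet> \<tau> $ 3 = 0" using T0 T2 r by simp
  have "2 * ptA N v p a b c * r + ptB N v p a b c \<noteq> 0"
    using corner_simple_root[OF R r(3,1,2) j co] p by simp
  note rigid = simple_root_rigid[OF N(1,3) r(1,2) corner_equations[OF R r(3,1,2) co] this Ta Tb[unfolded T2] Tc perp]
  have "\<forall>i. \<tau> $ i = 0" unfolding forall_4' using T0 T2 rigid by simp
  then show False using \<tau>0 by (simp add: vec_eq_iff)
qed

end

section \<open>Relabeling and the local structure\<close>

lemma bounded_linear_cyc: "bounded_linear cyc"
  using linear_cyc by (rule linear_conv_bounded_linear[THEN iffD1])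

lemma continuous_on_cyc [continuous_intros]: "continuous_on S f \<Longrightarrow> continuous_on S (\<lambda>x. cyc (f x))"
  by (rule bounded_linear.continuous_on[OF bounded_linear_cyc])

lemma homeomorphism_cyc:
  assumes "homeomorphism T A c c'" shows "homeomorphism T (cyc ` A) (\<lambda>t. cyc (c t)) (\<lambda>S. c' (cyc (cyc (cyc S))))"
proof (rule homeomorphismI)
  have c: "continuous_on T c" "continuous_on A c'" "c ` T = A" "c' ` A = T" "\<And>t. t \<in> T \<Longrightarrow> c' (c t) = t" "\<And>S. S \<in> A \<Longrightarrow> c (c' S) = S"
    using assms unfolding homeomorphism_def by auto
  show "continuous_on T (\<lambda>t. cyc (c t))" by (intro continuous_intros c)
  show "continuous_on (cyc ` A) (\<lambda>S. c' (cyc (cyc (cyc S))))"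
    by (rule continuous_on_compose2[OF c(2)]) (auto intro!: continuous_intros)
qed (use assms in \<open>auto simp: homeomorphism_def\<close>)

lemma open_cyc_vimage: "open U \<Longrightarrow> open {S. cyc S \<in> U}"
  using open_vimage[of U cyc] continuous_on_cyc[OF continuous_on_id[of UNIV]] by (simp add: vimage_def)

lemma smooth_point_cyc:
  assumes inv: "cyc ` M = M" and R: "smooth_point M R"
  shows "smooth_point M (cyc R)"
proof -
  obtain U c c' where U: "open U" "R \<in> U" and hom: "homeomorphism {0<..<1} (M \<inter> U) c c'"
    and sm: "smooth_curve_on c {0<..<1}" and nz: "\<forall>t\<in>{0<..<1}. vector_derivative c (at t) \<noteq> 0" and RM: "R \<in> M"
    using R unfolding smooth_point_def by blast
  let ?U = "{S. cyc (cyc (cyc S)) \<in> U}"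
  have "open ?U" using open_cyc_vimage[OF open_cyc_vimage[OF open_cyc_vimage[OF U(1)]]] by simp
  moreover have "cyc R \<in> ?U" using U(2) by simp
  moreover have "cyc ` (M \<inter> U) = M \<inter> ?U"
  proof
    show "cyc ` (M \<inter> U) \<subseteq> M \<inter> ?U" using inv by auto
    show "M \<inter> ?U \<subseteq> cyc ` (M \<inter> U)"
    proof
      fix S assume S: "S \<in> M \<inter> ?U"
      have "cyc (cyc (cyc S)) \<in> M" using S inv by (metis IntD1 imageI)
      then show "S \<in> cyc ` (M \<inter> U)" using S by (intro image_eqI[of _ _ "cyc (cyc (cyc S))"]) auto
    qed
  qed
  then have "homeomorphism {0<..<1} (M \<inter> ?U) (\<lambda>t. cyc (c t)) (\<lambda>S. c' (cyc (cyc (cyc S))))"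
    using homeomorphism_cyc[OF hom] by simp
  moreover have "smooth_curve_on (\<lambda>t. cyc (c t)) {0<..<1}"
  proof -
    obtain D where "D 0 = c" "\<forall>n::nat. \<forall>t\<in>{0<..<1}. (D n has_vector_derivative D (Suc n) t) (at t)"
      using sm unfolding smooth_curve_on_def by blast
    then show ?thesis
      unfolding smooth_curve_on_def
      by (intro exI[of _ "\<lambda>n t. cyc (D n t)"]) (auto intro: bounded_linear.has_vector_derivative[OF bounded_linear_cyc])
  qed
  moreover have "vector_derivative (\<lambda>t. cyc (c t)) (at t) \<noteq> 0" if t: "t \<in> {0<..<1}" for t
  proof -
    obtain x where x: "(c has_vector_derivative x) (at t)"
      using sm t unfolding smooth_curve_on_def by metis
    have "vector_derivative (\<lambda>t. cyc (c t)) (at t) = cyc x"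
      by (rule vector_derivative_at[OF bounded_linear.has_vector_derivative[OF bounded_linear_cyc x]])
    moreover have "x \<noteq> 0" using nz t vector_derivative_at[OF x] by blast
    moreover have "cyc 0 = 0" using linear_cyc by (rule linear_0)
    ultimately show ?thesis using inj_cyc by metis
  qed
  moreover have "cyc R \<in> M" using RM inv by blast
  ultimately show ?thesis unfolding smooth_point_def by blast
qed

context generic_polygon
begin

lemma cyc_I: "R \<in> I \<Longrightarrow> cyc R \<in> I"
  by (rule inscribed_rectangles_cyc)

text \<open>
  The second part makes corner rectangles isolated among the non-smooth points.
\<close>

definition has_chart :: "real^2^4 \<Rightarrow> bool" where
  "has_chart R \<longleftrightarrow> (\<exists>U. open U \<and> R \<in> U \<and> (I \<inter> U) homeomorphic {0<..<1::real} \<and> (\<forall>S\<in>I \<inter> U. S \<noteq> R \<longrightarrow> (\<forall>i. S $ i \<notin> V)))"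

lemma all_corners_cyc: "(\<forall>i. cyc S $ i \<notin> V) \<longleftrightarrow> (\<forall>i. S $ i \<notin> V)"
  unfolding forall_4' by auto

lemma has_chart_cyc:
  assumes "has_chart (cyc R)" shows "has_chart R"
proof -
  obtain U where U: "open U" "cyc R \<in> U" "(I \<inter> U) homeomorphic {0<..<1::real}"
    "\<forall>S\<in>I \<inter> U. S \<noteq> cyc R \<longrightarrow> (\<forall>i. S $ i \<notin> V)"
    using assms unfolding has_chart_def by blast
  let ?U = "{S. cyc S \<in> U}"
  have "homeomorphism (I \<inter> ?U) (I \<inter> U) cyc (\<lambda>S. cyc (cyc (cyc S)))"
    by (rule homeomorphismI) (auto intro!: continuous_intros cyc_I)
  then have "(I \<inter> ?U) homeomorphic {0<..<1::real}"
    using U(3) homeomorphic_trans unfolding homeomorphic_def[of "I \<inter> ?U" "I \<inter> U"] by (metis (no_types, lifting) homeomorphic_def)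
  moreover have "\<forall>i. S $ i \<notin> V" if S: "S \<in> I \<inter> ?U" "S \<noteq> R" for S
  proof -
    have "cyc S \<in> I \<inter> U" "cyc S \<noteq> cyc R" using S cyc_I inj_cyc by auto
    then show ?thesis using U(4) all_corners_cyc by blast
  qed
  ultimately show ?thesis unfolding has_chart_def using U(1,2) open_cyc_vimage by blast
qed

lemma cyc_pow_I: "R \<in> I \<Longrightarrow> (cyc ^^ n) R \<in> I"
  by (induction n) (auto intro: cyc_I)

lemma vertex_cornerE:
  assumes "R $ i \<in> V" obtains n j where "j < N" "(cyc ^^ n) R $ 0 = v j"
proof -
  have "\<exists>n. (cyc ^^ n) R $ 0 \<in> V"
  proof (rule ccontr)
    assume *: "\<nexists>n. (cyc ^^ n) R $ 0 \<in> V"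
    have "(cyc ^^ 0) R $ 0 \<notin> V" "(cyc ^^ 1) R $ 0 \<notin> V" "(cyc ^^ 2) R $ 0 \<notin> V" "(cyc ^^ 3) R $ 0 \<notin> V"
      using * by blast+
    then have "\<forall>i. R $ i \<notin> V" unfolding forall_4' by (simp add: eval_nat_numeral)
    then show False using assms by blast
  qed
  then show ?thesis using that by auto
qed

lemma vertex_corner_chart:
  assumes "R \<in> I" "R $ i \<in> V" shows "has_chart R"
proof -
  obtain n j where j: "j < N" "(cyc ^^ n) R $ 0 = v j" using vertex_cornerE[OF assms(2)] .
  have "has_chart ((cyc ^^ n) R)"
    using corner_chart[OF cyc_pow_I[OF assms(1)] j] unfolding has_chart_def .
  then show ?thesis by (induction n) (auto dest: has_chart_cyc)
qed

lemma vertex_corner_not_smooth: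
  assumes "R \<in> I" "R $ i \<in> V" shows "\<not> smooth_point I R"
proof
  assume s: "smooth_point I R"
  obtain n j where j: "j < N" "(cyc ^^ n) R $ 0 = v j" using vertex_cornerE[OF assms(2)] .
  have "smooth_point I ((cyc ^^ n) R)"
    by (induction n) (use s in \<open>auto intro: smooth_point_cyc[OF cyc_image_inscribed]\<close>)
  then show False using corner_not_smooth[OF cyc_pow_I[OF assms(1)] j] by blast
qed

lemma aspect_cyc: "R \<in> I \<Longrightarrow> aspect_ratio (cyc R) = 1 / aspect_ratio R"
  by (simp add: inscribed_rectangles_def aspect_ratio_cyc)

lemma aspect_pos: "R \<in> I \<Longrightarrow> aspect_ratio R > 0"
  by (auto elim!: inscribedE simp: aspect_ratio_rect)

text \<open>
  At a square with corner 0 at a vertex, 1 would be a root of the quadratic.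
\<close>

lemma square_no_vertex:
  assumes "R \<in> I" "aspect_ratio R = 1" shows "R $ i \<notin> V"
proof
  assume "R $ i \<in> V"
  then obtain n j where j: "j < N" "(cyc ^^ n) R $ 0 = v j" using vertex_cornerE by blast
  let ?S = "(cyc ^^ n) R"
  have S: "?S \<in> I" by (rule cyc_pow_I[OF assms(1)])
  have as: "aspect_ratio ?S = 1"
    by (induction n) (use assms in \<open>auto simp: aspect_cyc cyc_pow_I\<close>)
  obtain p w r where r: "w \<noteq> 0" "r > 0" "?S = rect p w r" using S by (rule inscribedE)
  have "r = 1" using as r by (simp add: aspect_ratio_rect)
  obtain U a b c where co: "cornered j a b c ?S" using local_cornered[OF S j] by blast
  have "p = v j" using r j by simp
  then have "phi (v j) a b c 1 = 0" using corner_equations(2)[OF S r(3,1,2) co] \<open>r = 1\<close> by simp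
  moreover have "a < N" "b < N" "c < N" using co by (auto simp: cornered_def)
  ultimately show False
    using square_nz[OF j(1) _ _ _ cornered_pattern[OF S j co]] by (simp add: phi_def)
qed

lemma inscribed_piecewise_smooth: "piecewise_smooth_1_manifold I"
proof -
  have chart: "\<exists>U. open U \<and> R \<in> U \<and> (I \<inter> U) homeomorphic {0<..<1::real} \<and> finite {q \<in> I \<inter> U. \<not> smooth_point I q}" if R: "R \<in> I" for R
  proof (cases "\<exists>i. R $ i \<in> V")
    case True
    then have "has_chart R" using vertex_corner_chart[OF R] by blast
    then obtain U where U: "open U" "R \<in> U" "(I \<inter> U) homeomorphic {0<..<1::real}" "\<forall>S\<in>I \<inter> U. S \<noteq> R \<longrightarrow> (\<forall>i. S $ i \<notin> V)"
      unfolding has_chart_def by blast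
    have "{q \<in> I \<inter> U. \<not> smooth_point I q} \<subseteq> {R}"
      using U(4) nonvertex_smooth(1) by blast
    then have "finite {q \<in> I \<inter> U. \<not> smooth_point I q}" by (rule finite_subset) simp
    then show ?thesis using U by blast
  next
    case False
    then have "smooth_point I R" using nonvertex_smooth(1)[OF R] by blast
    then obtain U c c' where U: "open U" "R \<in> U" and hom: "homeomorphism {0<..<1} (I \<inter> U) c c'"
      and sm: "smooth_curve_on c {0<..<1}" "\<forall>t\<in>{0<..<1}. vector_derivative c (at t) \<noteq> 0"
      unfolding smooth_point_def by blast
    have "smooth_point I q" if "q \<in> I \<inter> U" for q
      unfolding smooth_point_def using that by (intro conjI exI[of _ U] exI[of _ c] exI[of _ c'] U(1) hom sm) auto
    then have "{q \<in> I \<inter> U. \<not> smooth_point I q} = {}" by blast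
    then have "finite {q \<in> I \<inter> U. \<not> smooth_point I q}" by (simp only: finite.emptyI)
    moreover have "(I \<inter> U) homeomorphic {0<..<1::real}"
      using hom homeomorphic_sym unfolding homeomorphic_def by blast
    ultimately show ?thesis using U by blast
  qed
  show ?thesis
    unfolding piecewise_smooth_1_manifold_def topological_1_manifold_def using chart by blast
qed

lemma inscribed_smooth_points:
  "smooth_point I R \<Longrightarrow> \<exists>U. open U \<and> R \<in> U \<and> inj_on aspect_ratio (I \<inter> U)"
  "R \<in> I \<Longrightarrow> aspect_ratio R = 1 \<Longrightarrow> smooth_point I R"
proof -
  assume s: "smooth_point I R"
  then have R: "R \<in> I" by (simp add: smooth_point_def)
  with s vertex_corner_not_smooth have "\<And>i. R $ i \<notin> V" by blast
  then show "\<exists>U. open U \<and> R \<in> U \<and> inj_on aspect_ratio (I \<inter> U)" by (rule nonvertex_smooth(2)[OF R])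
qed (use nonvertex_smooth(1) square_no_vertex in blast)

end

section \<open>The ends of arcs of rectangles\<close>

text \<open>
  The degenerate rectangle to which rectangles converge when the aspect ratio tends to \<open>0\<close>.
\<close>

definition flat :: "real^2 \<Rightarrow> real^2 \<Rightarrow> real^2^4" where
  "flat a b = (\<chi> i. if i = 0 \<or> i = 3 then a else b)"

lemma flat_nth [simp]: "flat a b $ 0 = a" "flat a b $ 1 = b" "flat a b $ 2 = b" "flat a b $ 3 = a"
  by (simp_all add: flat_def)

lemma flat_cyc2: "cyc (cyc (flat a b)) = flat b a"
  by (simp add: vec_eq_iff forall_4')

lemma range_4: "range (f :: 4 \<Rightarrow> 'a) = {f 0, f 1, f 2, f 3}"
proof -
  have "\<forall>i::4. i \<in> {0, 1, 2, 3}" unfolding forall_4' by simp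
  then have U: "UNIV = {0, 1, 2, 3::4}" by blast
  show ?thesis unfolding U by simp
qed

lemma range_cyc: "range (\<lambda>i. cyc S $ i) = range (\<lambda>i. S $ i)"
  unfolding range_4 by auto

text \<open>
  The points within \<open>\<epsilon>\<close> of a convex set form a convex set.
\<close>

lemma hull_close:
  fixes f g :: "'i \<Rightarrow> 'a::real_normed_vector"
  assumes "\<And>i. dist (f i) (g i) < \<epsilon>" "x \<in> convex hull (range f)"
  shows "\<exists>y \<in> convex hull (range g). dist x y < \<epsilon>"
proof -
  let ?C = "{x. \<exists>y \<in> convex hull (range g). dist x y < \<epsilon>}"
  have "convex ?C"
  proof (rule convexI)
    fix x x' u w
    assume "x \<in> ?C" "x' \<in> ?C" and uw: "0 \<le> u" "0 \<le> w" "u + w = (1::real)"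
    then obtain y y' where y: "y \<in> convex hull (range g)" "dist x y < \<epsilon>" "y' \<in> convex hull (range g)" "dist x' y' < \<epsilon>"
      by auto
    have "norm ((u *\<^sub>R x + w *\<^sub>R x') - (u *\<^sub>R y + w *\<^sub>R y')) = norm (u *\<^sub>R (x - y) + w *\<^sub>R (x' - y'))"
      by (simp add: algebra_simps)
    also have "\<dots> \<le> u * norm (x - y) + w * norm (x' - y')"
      using norm_triangle_ineq[of "u *\<^sub>R (x - y)" "w *\<^sub>R (x' - y')"] uw by simp
    also have "\<dots> < \<epsilon>" using y(2,4) uw by (intro convex_bound_lt) (auto simp: dist_norm)
    finally have "dist (u *\<^sub>R x + w *\<^sub>R x') (u *\<^sub>R y + w *\<^sub>R y') < \<epsilon>" by (simp add: dist_norm)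
    moreover have "u *\<^sub>R y + w *\<^sub>R y' \<in> convex hull (range g)"
      using y uw convexD[OF convex_convex_hull] by blast
    ultimately show "u *\<^sub>R x + w *\<^sub>R x' \<in> ?C" by blast
  qed
  moreover have "range f \<subseteq> ?C"
    using assms(1) hull_inc[of _ "range g" convex] by blast
  ultimately have "convex hull (range f) \<subseteq> ?C" by (rule hull_minimal[rotated])
  then show ?thesis using assms(2) by blast
qed

lemma hausdorff_hull:
  fixes c :: "'t \<Rightarrow> real^2^4"
  assumes "(c \<longlongrightarrow> flat a b) F"
  shows "hausdorff_tendsto (\<lambda>t. convex hull (range (\<lambda>i. c t $ i))) (closed_segment a b) F"
  unfolding hausdorff_tendsto_def
proof (intro allI impI)
  fix \<epsilon> :: real assume \<epsilon>: "\<epsilon> > 0"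
  have K: "convex hull (range (\<lambda>i. flat a b $ i)) = closed_segment a b"
    unfolding range_4 segment_convex_hull by (simp add: insert_commute)
  have "\<forall>\<^sub>F t in F. dist (c t) (flat a b) < \<epsilon>" using assms \<epsilon> by (rule tendstoD)
  then show "\<forall>\<^sub>F t in F. (\<forall>x\<in>convex hull (range (\<lambda>i. c t $ i)). \<exists>y\<in>closed_segment a b. dist x y < \<epsilon>) \<and>
      (\<forall>y\<in>closed_segment a b. \<exists>x\<in>convex hull (range (\<lambda>i. c t $ i)). dist y x < \<epsilon>)"
  proof eventually_elim
    case (elim t)
    have d: "dist (c t $ i) (flat a b $ i) < \<epsilon>" for i
      using elim dist_vec_nth_le[of "c t" i "flat a b"] by linarith
    then have d': "dist (flat a b $ i) (c t $ i) < \<epsilon>" for i by (simp add: dist_commute)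
    show ?case
      unfolding K[symmetric]
      using hull_close[of "\<lambda>i. c t $ i" "\<lambda>i. flat a b $ i", OF d] hull_close[of "\<lambda>i. flat a b $ i" "\<lambda>i. c t $ i", OF d']
      by blast
  qed
qed

context generic_polygon
begin

text \<open>
  A small rectangle would have its corners on at most two edges, which is impossible.
\<close>

lemma at_most_two_edges:
  assumes "carried k a b c R" "R \<in> I" "q \<in> E k" "q \<in> E a" "q \<in> E b" "q \<in> E c" shows False
proof -
  have N: "k < N" "a < N" "b < N" "c < N" using assms(1) by (auto simp: carried_def)
  have al: "allowed k a b c" using carried_allowed inscribedE[OF assms(2)] assms(1) by metis
  have "\<exists>x y. k \<in> {x, y} \<and> a \<in> {x, y} \<and> b \<in> {x, y} \<and> c \<in> {x, y}"
  proof (cases "q \<in> V")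
    case True
    then obtain j where j: "j < N" "q = v j" by auto
    have "l \<in> {prv N j, j}" if "l < N" "q \<in> E l" for l
      using vertex_on_line[OF j(1) that(1)] side_edge[OF that(2)] j(2) by simp
    then show ?thesis using N assms(3-6) by (intro exI[of _ "prv N j"] exI[of _ j]) simp
  next
    case False
    have "a = k" "b = k" "c = k" using unique_edge[OF _ _ _ _ False] N assms(3-6) by metis+
    then show ?thesis by blast
  qed
  then obtain x y where xy: "k \<in> {x, y} \<and> a \<in> {x, y} \<and> b \<in> {x, y} \<and> c \<in> {x, y}" by blast
  then have "k = x \<or> k = y" "a = x \<or> a = y" "b = x \<or> b = y" "c = x \<or> c = y" by simp_all
  then show False using al unfolding allowed_def by (elim disjE) simp_all
qed

lemma no_small:
  obtains U where "open U" "q \<in> U" "\<And>R. R \<in> I \<Longrightarrow> (\<And>i. R $ i \<in> U) \<Longrightarrow> False"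
proof -
  obtain U where U: "open U" "q \<in> U" "\<And>k x. k < N \<Longrightarrow> x \<in> U \<Longrightarrow> x \<in> E k \<Longrightarrow> q \<in> E k"
    using local_edges[of q] by blast
  have False if R: "R \<in> I" "\<And>i. R $ i \<in> U" for R
  proof -
    obtain k a b c where car: "carried k a b c R" using inscribed_carried[OF R(1)] by blast
    then show False using at_most_two_edges[OF car R(1)] U(3) R(2) by (auto simp: carried_def)
  qed
  then show ?thesis using that U(1,2) by blast
qed

text \<open>
  The candidates for endpoints of limit chords: vertices, and feet of perpendiculars from vertices to the
  lines of edges.
\<close>

definition feet :: "(real^2) set" where
  "feet = V \<union> (\<Union>i<N. \<Union>f<N. {q. e f q = 0 \<and> d f \<bullet> (q - v i) = 0})"

lemma finite_feet: "finite feet"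
proof -
  have "finite {q. e f q = 0 \<and> d f \<bullet> (q - v i) = 0}" if "f < N" for i f
  proof -
    have "q = q'" if "e f q = 0" "d f \<bullet> (q - v i) = 0" "e f q' = 0" "d f \<bullet> (q' - v i) = 0" for q q'
    proof -
      have "cross2 (d f) (q - q') = 0" "d f \<bullet> (q - q') = 0"
        using that by (simp_all add: side_def cross2_simps inner_diff_right)
      then show ?thesis using dir_det[OF \<open>f < N\<close>] by fastforce
    qed
    then have "\<exists>x. {q. e f q = 0 \<and> d f \<bullet> (q - v i) = 0} \<subseteq> {x}" by blast
    then show ?thesis using finite_subset by blast
  qed
  then show ?thesis unfolding feet_def by simp
qed

lemma segment_in_edge:
  assumes "a \<in> E k" "b \<in> E k" "d k \<bullet> (b - a) = 0" "k < N" shows "a = b"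
proof -
  have "cross2 (d k) (b - a) = 0" using assms(1,2)[THEN side_edge] by (simp add: side_def cross2_simps)
  then show ?thesis using dir_det[OF assms(4) _ assms(3)] by simp
qed

lemma same_edge_perp:
  assumes "R \<in> I" shows "k < N \<Longrightarrow> R $ 1 \<in> E k \<Longrightarrow> R $ 2 \<in> E k \<Longrightarrow> d k \<bullet> (R $ 1 - R $ 0) = 0"
    "k < N \<Longrightarrow> R $ 0 \<in> E k \<Longrightarrow> R $ 3 \<in> E k \<Longrightarrow> d k \<bullet> (R $ 1 - R $ 0) = 0"
proof -
  obtain p w r where r: "w \<noteq> 0" "r > 0" "R = rect p w r" using assms by (rule inscribedE)
  show "k < N \<Longrightarrow> R $ 1 \<in> E k \<Longrightarrow> R $ 2 \<in> E k \<Longrightarrow> d k \<bullet> (R $ 1 - R $ 0) = 0"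
    "k < N \<Longrightarrow> R $ 0 \<in> E k \<Longrightarrow> R $ 3 \<in> E k \<Longrightarrow> d k \<bullet> (R $ 1 - R $ 0) = 0"
    using same_line(2)[OF r(2), of k p w] same_line(4)[OF r(2), of k p w] side_edge unfolding r(3) rect_nth by auto
qed

lemma inscribed_on_curve: "R \<in> I \<Longrightarrow> R $ i \<in> \<gamma>"
  by (simp add: inscribed_rectangles_def)

lemma nonvertex_curve:
  assumes "q \<in> \<gamma>" "q \<notin> V"
  obtains f W where "f < N" "q \<in> E f" "open W" "q \<in> W" "\<And>x. x \<in> W \<Longrightarrow> x \<in> \<gamma> \<Longrightarrow> x \<in> E f"
proof -
  obtain f where f: "f < N" "q \<in> E f" using assms(1) unfolding curve_eq by blast
  then show ?thesis using nonvertex_neighbourhood[OF f assms(2)] that by metis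
qed

text \<open>
  Near a degenerate limit the long side is almost the chord, which is not perpendicular to the edges
  at its endpoint \<open>a\<close>; so the two corners near \<open>a\<close> lie on different edges, and the orientation
  decides which is which.
\<close>

lemma flat_same_edges:
  assumes ab: "a \<in> \<gamma>" "b \<in> \<gamma>" "a \<noteq> b"
  shows "\<exists>U. open U \<and> flat a b \<in> U \<and> (\<forall>R\<in>I \<inter> U. \<forall>R'\<in>I \<inter> U.
    \<exists>k<N. \<exists>c<N. R $ 0 \<in> E k \<and> R' $ 0 \<in> E k \<and> R $ 3 \<in> E c \<and> R' $ 3 \<in> E c)"
proof (cases "a \<in> V")
  case False
  obtain f W where f: "f < N" "a \<in> E f" "open W" "a \<in> W" "\<And>x. x \<in> W \<Longrightarrow> x \<in> \<gamma> \<Longrightarrow> x \<in> E f"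
    using nonvertex_curve[OF ab(1) False] by metis
  let ?U = "(\<lambda>S :: real^2^4. S $ 0) -` W \<inter> (\<lambda>S. S $ 3) -` W"
  have "open ?U" using f(3) by (intro open_Int open_vimage_vec_nth)
  moreover have "flat a b \<in> ?U" using f(4) by simp
  moreover have "R $ 0 \<in> E f \<and> R $ 3 \<in> E f" if "R \<in> I \<inter> ?U" for R
    using that f(5) inscribed_on_curve by auto
  ultimately show ?thesis using f(1) by metis
next
  case True
  then obtain j where j: "j < N" "a = v j" by auto
  obtain W where W: "open W" "a \<in> W" "\<And>k x. k < N \<Longrightarrow> x \<in> W \<Longrightarrow> x \<in> E k \<Longrightarrow> a \<in> E k"
    using local_edges[of a] by blast
  have at_a: "x \<in> E j \<or> x \<in> E (prv N j)" if x: "x \<in> W" "x \<in> \<gamma>" for x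
  proof -
    obtain k where k: "k < N" "x \<in> E k" using x(2) unfolding curve_eq by blast
    then have "k \<in> {prv N j, j}" using W(3)[OF k(1) x(1) k(2)] vertex_on_line[OF j(1)] side_edge j(2) by blast
    then show ?thesis using k by auto
  qed
  have "\<exists>U. open U \<and> flat a b \<in> U \<and> (I \<inter> U = {} \<or> (d j \<bullet> (b - a) \<noteq> 0 \<and> d (prv N j) \<bullet> (b - a) \<noteq> 0))"
  proof (cases "b \<in> V")
    case True
    then obtain i where "i < N" "b = v i" by auto
    then have "d j \<bullet> (b - a) \<noteq> 0 \<and> d (prv N j) \<bullet> (b - a) \<noteq> 0"
      using perp_nz[OF j(1), of i j] perp_nz[OF prv_lt, of i j j] ab(3) j by auto
    then show ?thesis by (intro exI[of _ UNIV]) auto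
  next
    case False
    obtain f X where f: "f < N" "b \<in> E f" "open X" "b \<in> X" "\<And>x. x \<in> X \<Longrightarrow> x \<in> \<gamma> \<Longrightarrow> x \<in> E f"
      using nonvertex_curve[OF ab(2) False] by metis
    show ?thesis
    proof (cases "d f \<bullet> (b - a) = 0")
      case True
      have "d l \<bullet> (b - a) \<noteq> 0" if l: "l < N" "a \<in> E l" for l
      proof
        assume "d l \<bullet> (b - a) = 0"
        then have "l = f" using perp_dirs[OF l(1) f(1), of "b - a"] True ab(3) by simp
        then show False using segment_in_edge[OF _ f(2) True f(1), of] l ab(3) by blast
      qed
      then have "d j \<bullet> (b - a) \<noteq> 0 \<and> d (prv N j) \<bullet> (b - a) \<noteq> 0"
        using j prv_lt vertex_in_edge[OF j(1)] by blast
      then show ?thesis by (intro exI[of _ UNIV]) auto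
    next
      case False
      \<comment> \<open>rectangles near the limit have both corners near \<open>b\<close> on one edge, to which the chord is not
        perpendicular, so there are none\<close>
      let ?U = "(\<lambda>S :: real^2^4. S $ 1) -` X \<inter> (\<lambda>S. S $ 2) -` X \<inter> {S. d f \<bullet> (S $ 1 - S $ 0) \<noteq> 0}"
      have "open ?U" using f(3) by (intro open_Int open_vimage_vec_nth open_Collect_neq continuous_intros)
      moreover have "flat a b \<in> ?U" using f(4) False by simp
      moreover have "I \<inter> ?U = {}"
        using same_edge_perp(1)[OF _ f(1)] f(5) inscribed_on_curve by blast
      ultimately show ?thesis by blast
    qed
  qed
  then obtain U0 where U0: "open U0" "flat a b \<in> U0" "I \<inter> U0 = {} \<or> (d j \<bullet> (b - a) \<noteq> 0 \<and> d (prv N j) \<bullet> (b - a) \<noteq> 0)"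
    by blast
  let ?p = "prv N j"
  let ?s = "\<lambda>l (S :: real^2^4). (d l \<bullet> (b - a)) * (d l \<bullet> (S $ 1 - S $ 0))"
  show ?thesis
  proof (cases "I \<inter> U0 = {}")
    case True
    then show ?thesis using U0(1,2) by blast
  next
    case False
    with U0(3) have nz: "d j \<bullet> (b - a) \<noteq> 0" "d ?p \<bullet> (b - a) \<noteq> 0" by auto
    let ?U = "(\<lambda>S :: real^2^4. S $ 0) -` W \<inter> (\<lambda>S. S $ 3) -` W \<inter> {S. 0 < ?s j S} \<inter> {S. 0 < ?s ?p S}"
    have "open ?U" using W(1) by (intro open_Int open_vimage_vec_nth open_Collect_less continuous_intros)
    moreover have "flat a b \<in> ?U" using W(2) nz by (auto simp: zero_less_mult_iff)
    moreover have dich: "(R $ 0 \<in> E j \<and> R $ 3 \<in> E ?p) \<or> (R $ 0 \<in> E ?p \<and> R $ 3 \<in> E j)" if R: "R \<in> I \<inter> ?U" for R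
    proof -
      have "R $ 0 \<in> E j \<or> R $ 0 \<in> E ?p" "R $ 3 \<in> E j \<or> R $ 3 \<in> E ?p"
        using R at_a inscribed_on_curve by auto
      moreover have "\<not> (R $ 0 \<in> E j \<and> R $ 3 \<in> E j)" "\<not> (R $ 0 \<in> E ?p \<and> R $ 3 \<in> E ?p)"
        using R same_edge_perp(2)[of R] j(1) prv_lt by auto
      ultimately show ?thesis by blast
    qed
    moreover have mix: False if R: "R \<in> I \<inter> ?U" "R' \<in> I \<inter> ?U" and h: "R $ 0 \<in> E j" "R $ 3 \<in> E ?p" "R' $ 0 \<in> E ?p" "R' $ 3 \<in> E j" for R R'
    proof -
      have RI: "R \<in> I" "R' \<in> I" using R by simp_all
      obtain p w r where r: "w \<noteq> 0" "r > 0" "R = rect p w r" using RI(1) by (rule inscribedE)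
      obtain p' w' r' where r': "w' \<noteq> 0" "r' > 0" "R' = rect p' w' r'" using RI(2) by (rule inscribedE)
      obtain x where x: "0 \<le> x" "R $ 0 = v j + x *\<^sub>R d j" using edge_param h(1) by blast
      obtain x' where x': "0 \<le> x'" "R' $ 3 = v j + x' *\<^sub>R d j" using edge_param h(4) by blast
      have vj: "v j \<in> E ?p" using vertex_in_edge[OF j(1)] by blast
      have z: "cross2 (d ?p) (q - v j) = 0" if "q \<in> E ?p" for q
        using side_edge[OF that] side_edge[OF vj] by (simp add: side_def cross2_simps)
      have "r *\<^sub>R perp w = (R $ 3 - v j) - x *\<^sub>R d j" using r(3) x(2) by simp
      then have "cross2 (d ?p) (r *\<^sub>R perp w) = - x * cross2 (d ?p) (d j)" using z[OF h(2)] by (simp add: cross2_simps)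
      then have 1: "x * cross2 (d ?p) (d j) = - r * (d ?p \<bullet> w)" by (simp add: cross2_simps)
      have "r' *\<^sub>R perp w' = x' *\<^sub>R d j - (R' $ 0 - v j)" using r'(3) x'(2) by (simp add: algebra_simps)
      then have "cross2 (d ?p) (r' *\<^sub>R perp w') = x' * cross2 (d ?p) (d j)" using z[OF h(3)] by (simp add: cross2_simps)
      then have 2: "x' * cross2 (d ?p) (d j) = r' * (d ?p \<bullet> w')" by (simp add: cross2_simps)
      have s: "0 < (d ?p \<bullet> (b - a)) * (d ?p \<bullet> w)" "0 < (d ?p \<bullet> (b - a)) * (d ?p \<bullet> w')"
        using R r(3) r'(3) by auto
      have "0 < ((d ?p \<bullet> (b - a)) * (d ?p \<bullet> w)) * ((d ?p \<bullet> (b - a)) * (d ?p \<bullet> w'))"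
        using s by (rule mult_pos_pos)
      also have "\<dots> = (d ?p \<bullet> (b - a))\<^sup>2 * ((d ?p \<bullet> w) * (d ?p \<bullet> w'))" by (simp add: power2_eq_square algebra_simps)
      finally have "0 < (d ?p \<bullet> w) * (d ?p \<bullet> w')" by (simp add: zero_less_mult_iff)
      then have "0 < (r * r') * ((d ?p \<bullet> w) * (d ?p \<bullet> w'))" using r(2) r'(2) by simp
      also have "\<dots> = - ((x * cross2 (d ?p) (d j)) * (x' * cross2 (d ?p) (d j)))" unfolding 1 2 by simp
      also have "\<dots> = - (x * x' * (cross2 (d ?p) (d j))\<^sup>2)" by (simp add: power2_eq_square)
      finally have "x * x' * (cross2 (d ?p) (d j))\<^sup>2 < 0" by simp
      moreover have "0 \<le> x * x' * (cross2 (d ?p) (d j))\<^sup>2" using x(1) x'(1) by simp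
      ultimately show False by simp
    qed
    have "\<exists>k<N. \<exists>c<N. R $ 0 \<in> E k \<and> R' $ 0 \<in> E k \<and> R $ 3 \<in> E c \<and> R' $ 3 \<in> E c"
      if R: "R \<in> I \<inter> ?U" "R' \<in> I \<inter> ?U" for R R'
      using dich[OF R(1)]
    proof
      assume 1: "R $ 0 \<in> E j \<and> R $ 3 \<in> E ?p"
      then have "R' $ 0 \<in> E j \<and> R' $ 3 \<in> E ?p" using dich[OF R(2)] mix[OF R] by blast
      then show ?thesis using 1 j(1) prv_lt by blast
    next
      assume 1: "R $ 0 \<in> E ?p \<and> R $ 3 \<in> E j"
      then have "R' $ 0 \<in> E ?p \<and> R' $ 3 \<in> E j" using dich[OF R(2)] mix[OF R(2,1)] by blast
      then show ?thesis using 1 j(1) prv_lt by blast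
    qed
    ultimately show ?thesis by (intro exI[of _ ?U]) blast
  qed
qed

text \<open>
  Rectangles near the limit use the same four edges, on which the aspect ratio determines them.
\<close>

lemma flat_inj:
  assumes ab: "a \<in> \<gamma>" "b \<in> \<gamma>" "a \<noteq> b"
  obtains U where "open U" "flat a b \<in> U" "inj_on aspect_ratio (I \<inter> U)"
proof -
  obtain U where U: "open U" "flat a b \<in> U" "\<And>R R'. R \<in> I \<inter> U \<Longrightarrow> R' \<in> I \<inter> U \<Longrightarrow>
    \<exists>k<N. \<exists>c<N. R $ 0 \<in> E k \<and> R' $ 0 \<in> E k \<and> R $ 3 \<in> E c \<and> R' $ 3 \<in> E c"
    using flat_same_edges[OF ab] by blast
  obtain W where W: "open W" "flat b a \<in> W" "\<And>R R'. R \<in> I \<inter> W \<Longrightarrow> R' \<in> I \<inter> W \<Longrightarrow>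
    \<exists>k<N. \<exists>c<N. R $ 0 \<in> E k \<and> R' $ 0 \<in> E k \<and> R $ 3 \<in> E c \<and> R' $ 3 \<in> E c"
    using flat_same_edges[OF ab(2,1)] ab(3) by metis
  let ?U = "U \<inter> {S. cyc (cyc S) \<in> W}"
  have "open ?U" using U(1) open_cyc_vimage[OF open_cyc_vimage[OF W(1)]] by auto
  moreover have "flat a b \<in> ?U" using U(2) W(2) flat_cyc2 by simp
  moreover have "inj_on aspect_ratio (I \<inter> ?U)"
  proof (rule inj_onI)
    fix R R' assume R: "R \<in> I \<inter> ?U" "R' \<in> I \<inter> ?U" and eq: "aspect_ratio R = aspect_ratio R'"
    obtain k c where kc: "k < N" "c < N" "R $ 0 \<in> E k" "R' $ 0 \<in> E k" "R $ 3 \<in> E c" "R' $ 3 \<in> E c"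
      using U(3)[of R R'] R by blast
    have "cyc (cyc R) \<in> I \<inter> W" "cyc (cyc R') \<in> I \<inter> W" using R cyc_I by auto
    from W(3)[OF this] obtain b a where "b < N" "a < N" "R $ 2 \<in> E b" "R' $ 2 \<in> E b" "R $ 1 \<in> E a" "R' $ 1 \<in> E a"
      by auto
    then have "carried k a b c R" "carried k a b c R'" using kc by (simp_all add: carried_def)
    then show "R = R'" using same_aspect_eq R eq by blast
  qed
  ultimately show ?thesis using that by blast
qed

end

lemma at_left_1: "at_left (1::real) = filtermap (\<lambda>t. 1 - t) (at_right 0)"
  unfolding filter_eq_iff eventually_filtermap eventually_at_left_field eventually_at_right_field
proof (intro allI iffI)
  fix P :: "real \<Rightarrow> bool"
  assume "\<exists>b<1. \<forall>y>b. y < 1 \<longrightarrow> P y"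
  then obtain b where "b < 1" "\<forall>y>b. y < 1 \<longrightarrow> P y" by blast
  then show "\<exists>b>0. \<forall>y>0. y < b \<longrightarrow> P (1 - y)" by (intro exI[of _ "1 - b"]) auto
next
  fix P :: "real \<Rightarrow> bool"
  assume "\<exists>b>0. \<forall>y>0. y < b \<longrightarrow> P (1 - y)"
  then obtain b where b: "b > 0" "\<forall>y>0. y < b \<longrightarrow> P (1 - y)" by blast
  have "P y" if "y > 1 - b" "y < 1" for y using b(2)[rule_format, of "1 - y"] that by simp
  then show "\<exists>b<1. \<forall>y>b. y < 1 \<longrightarrow> P y" using b(1) by (intro exI[of _ "1 - b"]) auto
qed

text \<open>
  Without a fixed point \<open>f\<close> moves all points to the same side, and so does its fourth iterate.
\<close>

lemma fixed_point_of_finite_order: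
  fixes f :: "real \<Rightarrow> real"
  assumes cont: "continuous_on {0<..<1} f" and maps: "\<And>t. t \<in> {0<..<1} \<Longrightarrow> f t \<in> {0<..<1}"
    and order: "\<And>t. t \<in> {0<..<1} \<Longrightarrow> f (f (f (f t))) = t"
  shows "\<exists>t\<in>{0<..<1}. f t = t"
proof (rule ccontr)
  assume no: "\<not> ?thesis"
  then have no': "\<forall>t\<in>{0<..<1}. f t \<noteq> t" by blast
  let ?g = "\<lambda>t. f t - t"
  have conn: "connected (?g ` {0<..<1})"
    by (intro connected_continuous_image continuous_intros cont) simp
  have sign: "\<not> (?g s < 0 \<and> ?g t > 0)" if "s \<in> {0<..<1}" "t \<in> {0<..<1}" for s t
  proof
    assume "?g s < 0 \<and> ?g t > 0"
    then have "0 \<in> ?g ` {0<..<1}"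
      using connectedD_interval[OF conn, of "?g s" "?g t" 0] that by (simp add: less_imp_le)
    then show False using no by force
  qed
  have half: "(1/2 :: real) \<in> {0<..<1}" by simp
  show False
  proof (cases "f (1/2) < 1/2")
    case True
    have "f t < t" if "t \<in> {0<..<1}" for t
      using sign[OF half that] bspec[OF no' that] True by linarith
    then have "f (f (f (f (1/2)))) < 1/2" using maps half by (meson order_less_trans)
    then show False using order[OF half] by simp
  next
    case False
    then have "f (1/2) > 1/2" using bspec[OF no' half] by linarith
    have "t < f t" if "t \<in> {0<..<1}" for t
      using sign[OF that half] bspec[OF no' that] \<open>f (1/2) > 1/2\<close> by linarith
    then have "1/2 < f (f (f (f (1/2))))" using maps half by (meson order_less_trans)
    then show False using order[OF half] by simp
  qed
qed

context generic_polygon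
begin

lemma bounded_I: "\<exists>B. I \<subseteq> cball 0 B"
proof -
  obtain B where B: "\<And>q. q \<in> \<gamma> \<Longrightarrow> norm q \<le> B"
    using compact_imp_bounded[OF curve_compact] unfolding bounded_iff by blast
  have "norm R \<le> (\<Sum>i\<in>(UNIV::4 set). B)" if "R \<in> I" for R
  proof -
    have "norm R \<le> (\<Sum>i\<in>UNIV. norm (R $ i))" by (simp add: norm_vec_def L2_set_le_sum)
    also have "\<dots> \<le> (\<Sum>i\<in>(UNIV::4 set). B)" using B inscribed_on_curve[OF that] by (intro sum_mono) blast
    finally show ?thesis .
  qed
  then show ?thesis by (auto simp: subset_iff)
qed

lemma aspect_mult: "R \<in> I \<Longrightarrow> norm (R $ 2 - R $ 1) = aspect_ratio R * norm (R $ 1 - R $ 0)"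
  by (auto elim!: inscribedE simp: aspect_ratio_rect)

lemma inscribed_iff:
  "R \<in> I \<longleftrightarrow> R $ 1 - R $ 0 = R $ 2 - R $ 3 \<and> (R $ 1 - R $ 0) \<bullet> (R $ 2 - R $ 1) = 0 \<and>
     0 < cross2 (R $ 1 - R $ 0) (R $ 2 - R $ 1) \<and> (\<forall>i. R $ i \<in> \<gamma>)"
  by (simp only: inscribed_rectangles_def ccw_rectangle_def cross2_def mem_Collect_eq conj_assoc)

text \<open>
  A limit of inscribed rectangles satisfies the closed conditions and is not a single point.
\<close>

lemma limit_properties:
  assumes S: "\<And>n. S n \<in> I" and lim: "S \<longlonglongrightarrow> l"
  shows "l $ i \<in> \<gamma>" "l $ 1 - l $ 0 = l $ 2 - l $ 3" "(l $ 1 - l $ 0) \<bullet> (l $ 2 - l $ 1) = 0"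
    "0 \<le> cross2 (l $ 1 - l $ 0) (l $ 2 - l $ 1)" "l $ 1 = l $ 0 \<Longrightarrow> l $ 2 = l $ 1 \<Longrightarrow> False"
proof -
  note nth = tendsto_vec_nth[OF lim]
  show "l $ i \<in> \<gamma>" for i
    by (rule closed_sequentially[OF compact_imp_closed[OF curve_compact] _ nth]) (rule inscribed_on_curve[OF S])
  have ccw: "S n $ 1 - S n $ 0 = S n $ 2 - S n $ 3" "(S n $ 1 - S n $ 0) \<bullet> (S n $ 2 - S n $ 1) = 0"
    "0 < cross2 (S n $ 1 - S n $ 0) (S n $ 2 - S n $ 1)" for n
    using S[of n] unfolding inscribed_iff by blast+
  show par: "l $ 1 - l $ 0 = l $ 2 - l $ 3"
    using LIMSEQ_unique[OF tendsto_diff[OF nth nth] tendsto_diff[OF nth nth, of 2 3, folded ccw(1)]] .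
  have "(\<lambda>n. (S n $ 1 - S n $ 0) \<bullet> (S n $ 2 - S n $ 1)) \<longlonglongrightarrow> (l $ 1 - l $ 0) \<bullet> (l $ 2 - l $ 1)"
    by (intro tendsto_intros nth)
  then show "(l $ 1 - l $ 0) \<bullet> (l $ 2 - l $ 1) = 0"
    unfolding ccw(2) using LIMSEQ_unique tendsto_const by blast
  have "(\<lambda>n. cross2 (S n $ 1 - S n $ 0) (S n $ 2 - S n $ 1)) \<longlonglongrightarrow> cross2 (l $ 1 - l $ 0) (l $ 2 - l $ 1)"
    unfolding cross2_def by (intro tendsto_intros nth)
  then show "0 \<le> cross2 (l $ 1 - l $ 0) (l $ 2 - l $ 1)"
    by (rule LIMSEQ_le_const) (use ccw(3) less_imp_le in blast)
  assume eq: "l $ 1 = l $ 0" "l $ 2 = l $ 1"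
  then have "l $ 3 = l $ 0" using par by simp
  obtain U where U: "open U" "l $ 0 \<in> U" "\<And>R. R \<in> I \<Longrightarrow> (\<And>i. R $ i \<in> U) \<Longrightarrow> False"
    using no_small by metis
  have l: "\<forall>i. l $ i \<in> U" unfolding forall_4' using eq \<open>l $ 3 = l $ 0\<close> U(2) by simp
  have "\<forall>\<^sub>F n in sequentially. \<forall>i. S n $ i \<in> U"
    unfolding forall_4' using l by (intro eventually_conj topological_tendstoD[OF nth U(1)]) auto
  then have "\<exists>n. \<forall>i. S n $ i \<in> U" by (rule eventually_happens'[OF sequentially_bot])
  then show False using U(3) S by blast
qed

text \<open>
  Bounds on the aspect ratio prevent one side from collapsing without the other.
\<close>

lemma compact_aspect:
  assumes "0 < m" shows "compact {R \<in> I. m \<le> aspect_ratio R \<and> aspect_ratio R \<le> M}"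
proof -
  let ?K = "{R \<in> I. m \<le> aspect_ratio R \<and> aspect_ratio R \<le> M}"
  have "l \<in> ?K" if S: "\<And>n. S n \<in> ?K" and lim: "S \<longlonglongrightarrow> l" for S l
  proof -
    have SI: "\<And>n. S n \<in> I" using S by blast
    note L = limit_properties[OF SI lim]
    note nth = tendsto_vec_nth[OF lim]
    have w: "(\<lambda>n. norm (S n $ 1 - S n $ 0)) \<longlonglongrightarrow> norm (l $ 1 - l $ 0)"
      and x: "(\<lambda>n. norm (S n $ 2 - S n $ 1)) \<longlonglongrightarrow> norm (l $ 2 - l $ 1)"
      by (intro tendsto_intros nth)+
    have lo: "m * norm (l $ 1 - l $ 0) \<le> norm (l $ 2 - l $ 1)"
      by (rule LIMSEQ_le[OF tendsto_mult[OF tendsto_const w] x]) (use S in \<open>auto simp: aspect_mult mult_right_mono\<close>)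
    have hi: "norm (l $ 2 - l $ 1) \<le> M * norm (l $ 1 - l $ 0)"
      by (rule LIMSEQ_le[OF x tendsto_mult[OF tendsto_const w]]) (use S in \<open>auto simp: aspect_mult mult_right_mono\<close>)
    have w0: "l $ 1 - l $ 0 \<noteq> 0"
    proof
      assume "l $ 1 - l $ 0 = 0"
      moreover from this have "l $ 2 - l $ 1 = 0" using hi by simp
      ultimately show False using L(5) by simp
    qed
    then have "0 < norm (l $ 2 - l $ 1)" using lo assms by (smt (verit) mult_pos_pos zero_less_norm_iff)
    then have "cross2 (l $ 1 - l $ 0) (l $ 2 - l $ 1) \<noteq> 0"
      using lagrange2[of "l $ 1 - l $ 0" "l $ 2 - l $ 1"] L(3) w0 by auto
    then have "0 < cross2 (l $ 1 - l $ 0) (l $ 2 - l $ 1)" using L(4) by simp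
    then have "l \<in> I"
      using L(1-3) unfolding inscribed_iff by blast
    moreover have "m \<le> aspect_ratio l" "aspect_ratio l \<le> M"
      using lo hi w0 unfolding aspect_ratio_def by (simp_all add: field_simps)
    ultimately show ?thesis by simp
  qed
  then have "closed ?K" unfolding closed_sequential_limits by blast
  moreover have "bounded ?K" using bounded_I bounded_cball bounded_subset by (metis (no_types, lifting) mem_Collect_eq subsetD subsetI)
  ultimately show ?thesis by (simp add: compact_eq_bounded_closed)
qed

text \<open>
  If \<open>b\<close> is not a vertex, both corners near it are on the same edge, so the long side is perpendicular to
  this edge; likewise for \<open>a\<close>. Both cannot happen, since the two edges would be parallel.
\<close>

lemma limit_flat:
  assumes S: "\<And>n. S n \<in> I" and lim: "S \<longlonglongrightarrow> l" and as: "(\<lambda>n. aspect_ratio (S n)) \<longlonglongrightarrow> 0"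
  shows "\<exists>a\<in>feet \<inter> \<gamma>. \<exists>b\<in>feet \<inter> \<gamma>. a \<noteq> b \<and> l = flat a b"
proof -
  note L = limit_properties[OF S lim]
  note nth = tendsto_vec_nth[OF lim]
  have "(\<lambda>n. norm (S n $ 2 - S n $ 1)) \<longlonglongrightarrow> 0 * norm (l $ 1 - l $ 0)"
    unfolding aspect_mult[OF S] by (intro tendsto_intros as nth)
  moreover have "(\<lambda>n. norm (S n $ 2 - S n $ 1)) \<longlonglongrightarrow> norm (l $ 2 - l $ 1)"
    by (intro tendsto_intros nth)
  ultimately have "norm (l $ 2 - l $ 1) = 0" using LIMSEQ_unique by fastforce
  then have l21: "l $ 2 = l $ 1" by simp
  define a b where "a = l $ 0" and "b = l $ 1"
  have l3: "l $ 3 = a" using L(2) l21 by (simp add: a_def)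
  have flat: "l = flat a b" unfolding vec_eq_iff forall_4' using l21 l3 by (simp add: a_def b_def)
  have ne: "a \<noteq> b" using L(5) l21 by (auto simp: a_def b_def)
  have on: "a \<in> \<gamma>" "b \<in> \<gamma>" using L(1) by (simp_all add: a_def b_def)
  have w: "(\<lambda>n. d f \<bullet> (S n $ 1 - S n $ 0)) \<longlonglongrightarrow> d f \<bullet> (b - a)" for f
    unfolding a_def b_def by (intro tendsto_intros nth)
  have perp: "d f \<bullet> (b - a) = 0" if "\<forall>\<^sub>F n in sequentially. d f \<bullet> (S n $ 1 - S n $ 0) = 0" for f
    using LIMSEQ_unique[OF w[of f] tendsto_eventually[OF that]] .
  have foot_b: "\<exists>f<N. b \<in> E f \<and> d f \<bullet> (b - a) = 0" if bV: "b \<notin> V"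
  proof -
    obtain f W where f: "f < N" "b \<in> E f" "open W" "b \<in> W" "\<And>x. x \<in> W \<Longrightarrow> x \<in> \<gamma> \<Longrightarrow> x \<in> E f"
      using nonvertex_curve[OF on(2) bV] by metis
    have "\<forall>\<^sub>F n in sequentially. S n $ 1 \<in> W" "\<forall>\<^sub>F n in sequentially. S n $ 2 \<in> W"
      using topological_tendstoD[OF nth f(3)] f(4) l21 by (simp_all add: b_def)
    then have "\<forall>\<^sub>F n in sequentially. d f \<bullet> (S n $ 1 - S n $ 0) = 0"
      by eventually_elim (use same_edge_perp(1)[OF S f(1)] f(5) inscribed_on_curve[OF S] in blast)
    then show ?thesis using perp f by blast
  qed
  have foot_a: "\<exists>f<N. a \<in> E f \<and> d f \<bullet> (b - a) = 0" if aV: "a \<notin> V"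
  proof -
    obtain f W where f: "f < N" "a \<in> E f" "open W" "a \<in> W" "\<And>x. x \<in> W \<Longrightarrow> x \<in> \<gamma> \<Longrightarrow> x \<in> E f"
      using nonvertex_curve[OF on(1) aV] by metis
    have "\<forall>\<^sub>F n in sequentially. S n $ 0 \<in> W" "\<forall>\<^sub>F n in sequentially. S n $ 3 \<in> W"
      using topological_tendstoD[OF nth f(3)] f(4) l3 by (simp_all add: a_def)
    then have "\<forall>\<^sub>F n in sequentially. d f \<bullet> (S n $ 1 - S n $ 0) = 0"
      by eventually_elim (use same_edge_perp(2)[OF S f(1)] f(5) inscribed_on_curve[OF S] in blast)
    then show ?thesis using perp f by blast
  qed
  have "a \<in> V \<or> b \<in> V"
  proof (rule ccontr)
    assume "\<not> ?thesis"
    then obtain f g where f: "f < N" "a \<in> E f" "d f \<bullet> (b - a) = 0" and g: "g < N" "b \<in> E g" "d g \<bullet> (b - a) = 0"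
      using foot_a foot_b by blast
    then have "f = g" using perp_dirs[of f g "b - a"] ne by auto
    then show False using segment_in_edge[OF f(2) _ f(3,1)] g(2) ne by blast
  qed
  moreover have "b \<in> feet" if "a \<in> V"
  proof (cases "b \<in> V")
    case False
    then obtain f where "f < N" "b \<in> E f" "d f \<bullet> (b - a) = 0" using foot_b by blast
    then show ?thesis using that side_edge unfolding feet_def by blast
  qed (simp add: feet_def)
  moreover have "a \<in> feet" if "b \<in> V"
  proof (cases "a \<in> V")
    case False
    then obtain f where f: "f < N" "a \<in> E f" "d f \<bullet> (b - a) = 0" using foot_a by blast
    then have "d f \<bullet> (a - b) = 0" by (simp add: inner_diff_right)
    then show ?thesis using f that side_edge unfolding feet_def by blast
  qed (simp add: feet_def)
  moreover have "V \<subseteq> feet" by (auto simp: feet_def)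
  ultimately have "a \<in> feet" "b \<in> feet" by blast+
  then show ?thesis using flat ne on by blast
qed

lemma component_cyc: "A \<in> components I \<Longrightarrow> cyc ` A \<in> components I"
  unfolding in_components_maximal
proof (intro conjI allI impI)
  assume A: "A \<noteq> {} \<and> A \<subseteq> I \<and> connected A \<and> (\<forall>d. d \<noteq> {} \<and> A \<subseteq> d \<and> d \<subseteq> I \<and> connected d \<longrightarrow> d = A)"
  have ca: "connected (cyc ` T)" if "connected T" for T
    using that by (intro connected_continuous_image continuous_intros)
  have sub: "cyc ` T \<subseteq> I" if "T \<subseteq> I" for T using that cyc_I by blast
  show "cyc ` A \<noteq> {}" "cyc ` A \<subseteq> I" "connected (cyc ` A)" using A ca sub by simp_all
  fix D assume D: "D \<noteq> {} \<and> cyc ` A \<subseteq> D \<and> D \<subseteq> I \<and> connected D"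
  let ?D = "cyc ` cyc ` cyc ` D"
  have "cyc ` cyc ` cyc ` cyc ` A \<subseteq> ?D" using D by blast
  then have "A \<subseteq> ?D" by (simp add: image_image)
  moreover have "?D \<noteq> {}" "?D \<subseteq> I" "connected ?D" using D by (simp_all add: ca sub)
  ultimately have "?D = A" using A by simp
  then have "cyc ` ?D = cyc ` A" by simp
  then show "D = cyc ` A" by (simp add: image_image)
qed

lemma aspect_continuous: "continuous_on I aspect_ratio"
  unfolding aspect_ratio_def by (intro continuous_intros) (auto elim!: inscribedE)

text \<open>A rotation that maps an arc component to itself would have a fixed point.\<close>

lemma no_rotation:
  assumes A: "A \<in> components I" and hom: "homeomorphism {0<..<1::real} A c c'"
    and t: "t \<in> {0<..<1}" "t' \<in> {0<..<1}" "c t = (cyc ^^ q) (c t')"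
  shows "t = t'"
proof -
  have c: "continuous_on {0<..<1} c" "continuous_on A c'" "c ` {0<..<1} = A" "c' ` A = {0<..<1}"
    "\<And>t. t \<in> {0<..<1} \<Longrightarrow> c' (c t) = t" "\<And>S. S \<in> A \<Longrightarrow> c (c' S) = S"
    using hom unfolding homeomorphism_def by auto
  have AI: "A \<subseteq> I" using A in_components_subset by blast
  have red: "(cyc ^^ q) R = (cyc ^^ (q mod 4)) R" for R
  proof -
    have "(cyc ^^ 4) R = R" by (simp add: eval_nat_numeral)
    then show ?thesis by (rule funpow_mod_eq[symmetric])
  qed
  have comp: "(cyc ^^ n) ` A \<in> components I" for n
  proof (induction n)
    case (Suc n)
    then show ?case using component_cyc[OF Suc] by (simp add: image_comp o_def)
  qed (simp add: A)
  have "(cyc ^^ q) ` A \<inter> A \<noteq> {}" using t c(3) by blast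
  then have eq: "(cyc ^^ q) ` A = A" using components_nonoverlap[OF comp A] by blast
  define f where "f t = c' ((cyc ^^ q) (c t))" for t
  have cf: "c (f t) = (cyc ^^ q) (c t)" "f t \<in> {0<..<1}" if "t \<in> {0<..<1}" for t
  proof -
    have "(cyc ^^ q) (c t) \<in> A" using eq that c(3) by blast
    then show "c (f t) = (cyc ^^ q) (c t)" "f t \<in> {0<..<1}" using c(4,6) by (auto simp: f_def)
  qed
  have cont: "continuous_on {0<..<1} f"
  proof -
    have "continuous_on S (cyc ^^ n)" for S n
      by (induction n) (auto simp: o_def id_def intro!: continuous_intros)
    then have "continuous_on {0<..<1} (\<lambda>t. (cyc ^^ q) (c t))"
      using c(1) continuous_on_compose2 by blast
    then show ?thesis
      unfolding f_def using c(2) eq c(3) by (intro continuous_on_compose2[OF c(2)]) auto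
  qed
  have id4: "((cyc ^^ 4) ^^ n) x = x" for n x by (induction n) (simp_all add: eval_nat_numeral)
  have "f (f (f (f s))) = s" if s: "s \<in> {0<..<1}" for s
  proof -
    have "c (f (f (f (f s)))) = (cyc ^^ q) ((cyc ^^ q) ((cyc ^^ q) ((cyc ^^ q) (c s))))"
      using cf s by simp
    also have "\<dots> = (cyc ^^ (q * 4)) (c s)"
    proof -
      have "q * 4 = q + (q + (q + q))" by simp
      then show ?thesis by (simp only: funpow_add o_apply)
    qed
    also have "\<dots> = ((cyc ^^ 4) ^^ q) (c s)" by (simp add: funpow_mult mult.commute)
    also have "\<dots> = c s" by (rule id4)
    finally have "c (f (f (f (f s)))) = c s" .
    then show ?thesis using c(5) cf s by metis
  qed
  then obtain s where s: "s \<in> {0<..<1}" "f s = s"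
    using fixed_point_of_finite_order[OF cont cf(2)] by blast
  then have fixed: "(cyc ^^ (q mod 4)) (c s) = c s" using cf(1) red by metis
  have csI: "c s \<in> I" using s c(3) AI by blast
  obtain p w r where r: "w \<noteq> 0" "r > 0" "c s = rect p w r" using csI by (rule inscribedE)
  have ne: "c s $ 1 \<noteq> c s $ 0" "c s $ 2 \<noteq> c s $ 0" "c s $ 3 \<noteq> c s $ 0"
  proof -
    have "perp w \<noteq> 0" using r(1) by (metis norm_perp norm_eq_zero)
    moreover have "w + r *\<^sub>R perp w \<noteq> 0"
    proof
      assume "w + r *\<^sub>R perp w = 0"
      then have "w \<bullet> (w + r *\<^sub>R perp w) = 0" by simp
      then show False using r(1) by (simp add: inner_add_right cross2_simps)
    qed
    ultimately show "c s $ 1 \<noteq> c s $ 0" "c s $ 2 \<noteq> c s $ 0" "c s $ 3 \<noteq> c s $ 0"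
      using r(1,2) unfolding r(3) by (simp_all add: add.assoc)
  qed
  have "q mod 4 < 4" by simp
  then consider "q mod 4 = 0" | "q mod 4 = 1" | "q mod 4 = 2" | "q mod 4 = 3" by linarith
  then have "q mod 4 = 0"
  proof cases
    case 2
    then have "cyc (c s) $ 0 = c s $ 0" using fixed by simp
    then show ?thesis using ne by simp
  next
    case 3
    have "(cyc ^^ 2) (c s) = cyc (cyc (c s))" by (simp add: eval_nat_numeral)
    then have "cyc (cyc (c s)) $ 0 = c s $ 0" using fixed 3 by metis
    then show ?thesis using ne by simp
  next
    case 4
    have "(cyc ^^ 3) (c s) = cyc (cyc (cyc (c s)))" by (simp add: eval_nat_numeral)
    then have "cyc (cyc (cyc (c s))) $ 0 = c s $ 0" using fixed 4 by metis
    then show ?thesis using ne by simp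
  qed
  then have "c t = c t'" using t(3) red by simp
  then show "t = t'" using c(5) t by metis
qed

text \<open>
  A component is closed in \<open>I\<close>, so its part with aspect ratio in a compact interval is compact and the arc
  leaves it for good; which side it leaves to is constant by connectedness.
\<close>

lemma end_dichotomy:
  assumes A: "A \<in> components I" and hom: "homeomorphism {0<..<1::real} A c c'"
  shows "((\<lambda>t. aspect_ratio (c t)) \<longlongrightarrow> 0) (at_right 0) \<or> filterlim (\<lambda>t. aspect_ratio (c t)) at_top (at_right 0)"
proof -
  have c: "continuous_on {0<..<1} c" "continuous_on A c'" "c ` {0<..<1} = A" "c' ` A = {0<..<1}"
    "\<And>t. t \<in> {0<..<1} \<Longrightarrow> c' (c t) = t" "\<And>S. S \<in> A \<Longrightarrow> c (c' S) = S"
    using hom unfolding homeomorphism_def by auto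
  have AI: "A \<subseteq> I" using A in_components_subset by blast
  obtain T where T: "closed T" "A = I \<inter> T" using closedin_component[OF A] unfolding closedin_closed by blast
  let ?f = "\<lambda>t. aspect_ratio (c t)"
  have pos: "?f t > 0" if "t \<in> {0<..<1}" for t using aspect_pos AI c(3) that by blast
  have contf: "continuous_on {0<..<1} ?f"
    by (rule continuous_on_compose2[OF aspect_continuous c(1)]) (use AI c(3) in auto)
  have leave: "\<exists>s>0. s < 1 \<and> (\<forall>t. 0 < t \<and> t < s \<longrightarrow> ?f t < m \<or> M < ?f t)" if "0 < m" for m M
  proof -
    let ?K = "{R \<in> I. m \<le> aspect_ratio R \<and> aspect_ratio R \<le> M} \<inter> T"
    have "compact ?K" by (intro compact_Int_closed compact_aspect that T)
    moreover have KA: "?K \<subseteq> A" using T by blast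
    ultimately have "compact (c' ` ?K)"
      using compact_continuous_image[OF continuous_on_subset[OF c(2)]] by blast
    then have "open (- (c' ` ?K))" by (intro open_Compl compact_imp_closed)
    moreover have "c' ` ?K \<subseteq> {0<..<1}" using image_mono[OF KA, of c'] unfolding c(4) .
    then have "0 \<in> - (c' ` ?K)" by (simp add: subset_iff) blast
    ultimately obtain s where s: "s > 0" "ball 0 s \<subseteq> - (c' ` ?K)"
      using open_contains_ball by blast
    have "?f t < m \<or> M < ?f t" if t: "0 < t" "t < min s (1/2)" for t
    proof (rule ccontr)
      assume *: "\<not> ?thesis"
      have "t \<in> {0<..<1}" using t by simp
      then have "c t \<in> A" using c(3) by blast
      then have "c t \<in> ?K" using T(2) * by simp
      then have "c' (c t) \<in> c' ` ?K" by blast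
      then have "t \<in> c' ` ?K" unfolding c(5)[OF \<open>t \<in> {0<..<1}\<close>] .
      moreover have "t \<in> ball 0 s" using t by (simp add: dist_real_def)
      ultimately show False using s(2) by blast
    qed
    then show ?thesis using s(1) by (intro exI[of _ "min s (1/2)"]) auto
  qed
  obtain s0 where s0: "s0 > 0" "s0 < 1" "\<forall>t. 0 < t \<and> t < s0 \<longrightarrow> ?f t < 1 \<or> 1 < ?f t"
    using leave[of 1 1] by auto
  have "connected (?f ` {0<..<s0})"
    by (intro connected_continuous_image continuous_on_subset[OF contf]) (use s0 in auto)
  then have split: "\<not> (?f s < 1 \<and> 1 < ?f t)" if "s \<in> {0<..<s0}" "t \<in> {0<..<s0}" for s t
    using connectedD_interval[of "?f ` {0<..<s0}" "?f s" "?f t" 1] that s0(3) by fastforce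
  show ?thesis
  proof (cases "?f (s0 / 2) < 1")
    case True
    have lt1: "?f t < 1" if "t \<in> {0<..<s0}" for t
      using split[of "s0 / 2" t] True s0(1,3) that by auto
    have "((\<lambda>t. ?f t) \<longlongrightarrow> 0) (at_right 0)"
    proof (rule tendstoI)
      fix \<epsilon> :: real assume \<epsilon>: "\<epsilon> > 0"
      obtain s where s: "s > 0" "s < 1" "\<forall>t. 0 < t \<and> t < s \<longrightarrow> ?f t < \<epsilon> \<or> 1 < ?f t" using leave[OF \<epsilon>, of 1] by blast
      have "dist (?f t) 0 < \<epsilon>" if "0 < t" "t < min s s0" for t
        using that s lt1[of t] pos[of t] s0 by (auto simp: dist_real_def)
      then show "\<forall>\<^sub>F t in at_right 0. dist (?f t) 0 < \<epsilon>"
        unfolding eventually_at_right_field using s(1) s0(1) by (intro exI[of _ "min s s0"]) auto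
    qed
    then show ?thesis by blast
  next
    case False
    have gt1: "1 < ?f t" if "t \<in> {0<..<s0}" for t
    proof -
      have "1 < ?f (s0 / 2)" using False s0 by (metis field_sum_of_halves half_gt_zero less_add_same_cancel1)
      then show ?thesis using split[of t "s0 / 2"] s0(1,3) that by auto
    qed
    have "filterlim ?f at_top (at_right 0)"
      unfolding filterlim_at_top
    proof
      fix Z :: real
      obtain s where s: "s > 0" "s < 1" "\<forall>t. 0 < t \<and> t < s \<longrightarrow> ?f t < 1 \<or> Z < ?f t" using leave[of 1 Z] by auto
      have "Z \<le> ?f t" if "0 < t" "t < min s s0" for t
        using that s gt1[of t] by force
      then show "\<forall>\<^sub>F t in at_right 0. Z \<le> ?f t"
        unfolding eventually_at_right_field using s(1) s0(1) by (intro exI[of _ "min s s0"]) auto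
    qed
    then show ?thesis by blast
  qed
qed

text \<open>
  The arc eventually stays in small disjoint balls around the finitely many possible limits, hence in one
  of them.
\<close>

lemma end_limit:
  assumes A: "A \<in> components I" and hom: "homeomorphism {0<..<1::real} A c c'"
    and as: "((\<lambda>t. aspect_ratio (c t)) \<longlongrightarrow> 0) (at_right 0)"
  shows "\<exists>a\<in>\<gamma>. \<exists>b\<in>\<gamma>. a \<noteq> b \<and> (c \<longlongrightarrow> flat a b) (at_right 0)"
proof -
  have c: "continuous_on {0<..<1} c" "c ` {0<..<1} = A" using hom unfolding homeomorphism_def by auto
  have cI: "c t \<in> I" if "t \<in> {0<..<1}" for t using c(2) that A in_components_subset by blast
  define \<Lambda> where "\<Lambda> = (\<lambda>(a, b). flat a b) ` (feet \<times> feet)"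
  have fin: "finite \<Lambda>" unfolding \<Lambda>_def using finite_feet by simp
  obtain B where B: "I \<subseteq> cball 0 B" using bounded_I by blast
  have cluster: "\<exists>r l a b. strict_mono r \<and> (\<lambda>n. c (t (r n))) \<longlonglongrightarrow> l \<and> a \<in> \<gamma> \<and> b \<in> \<gamma> \<and> a \<noteq> b \<and> l = flat a b \<and> l \<in> \<Lambda>"
    if t: "\<And>n. t n \<in> {0<..<1}" "t \<longlonglongrightarrow> 0" for t :: "nat \<Rightarrow> real"
  proof -
    have "\<forall>n. c (t n) \<in> cball 0 B" using B cI t(1) by blast
    then obtain l r where lr: "strict_mono r" "((\<lambda>n. c (t n)) \<circ> r) \<longlonglongrightarrow> l"
      using compact_cball[of "0::real^2^4" B] unfolding compact_def by metis
    have "filterlim (\<lambda>n. t (r n)) (at_right 0) sequentially"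
    proof -
      have "t (r n) \<in> {0<..} \<and> t (r n) \<noteq> 0" for n using t(1)[of "r n"] by auto
      then show ?thesis
        using LIMSEQ_subseq_LIMSEQ[OF t(2) lr(1)] by (simp add: filterlim_at o_def)
    qed
    then have "(\<lambda>n. aspect_ratio (c (t (r n)))) \<longlonglongrightarrow> 0" by (rule filterlim_compose[OF as])
    then obtain a b where "a \<in> feet \<inter> \<gamma>" "b \<in> feet \<inter> \<gamma>" "a \<noteq> b" "l = flat a b"
      using limit_flat[of "\<lambda>n. c (t (r n))" l] cI t(1) lr(2) by (auto simp: o_def)
    then show ?thesis using lr unfolding \<Lambda>_def o_def by blast
  qed
  have lim: "(\<lambda>n. 1 / (real n + 2)) \<longlonglongrightarrow> 0"
    using LIMSEQ_ignore_initial_segment[OF lim_1_over_n[where 'a=real], of 2] by (simp add: add.commute)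
  have near: "\<exists>s>0. s < 1 \<and> (\<forall>t. 0 < t \<and> t < s \<longrightarrow> (\<exists>l\<in>\<Lambda>. dist l (c t) < \<epsilon>))" if \<epsilon>: "\<epsilon> > 0" for \<epsilon>
  proof (rule ccontr)
    assume no: "\<not> ?thesis"
    have "\<exists>t. 0 < t \<and> t < 1 / (real n + 2) \<and> (\<forall>l\<in>\<Lambda>. \<epsilon> \<le> dist l (c t))" for n
    proof -
      have "0 < 1 / (real n + 2)" "1 / (real n + 2) < 1" by simp_all
      then show ?thesis using no by (meson not_le)
    qed
    then obtain t where t: "\<And>n. 0 < t n \<and> t n < 1 / (real n + 2) \<and> (\<forall>l\<in>\<Lambda>. \<epsilon> \<le> dist l (c (t n)))" by metis
    have "t n < 1" for n
    proof -
      have "1 / (real n + 2) < 1" by simp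
      then show ?thesis using t[of n] by linarith
    qed
    then have t01: "\<And>n. t n \<in> {0<..<1}" using t by auto
    have "t \<longlonglongrightarrow> 0"
      by (rule tendsto_sandwich[OF _ _ tendsto_const lim]) (use t less_imp_le in \<open>auto intro!: always_eventually\<close>)
    from cluster[OF t01 this] obtain r l where rl: "(\<lambda>n. c (t (r n))) \<longlonglongrightarrow> l" "l \<in> \<Lambda>" by blast
    from tendstoD[OF rl(1) \<epsilon>] obtain n where "dist (c (t (r n))) l < \<epsilon>"
      using eventually_happens'[OF sequentially_bot] by blast
    then show False using t[of "r n"] rl(2) by (auto simp: dist_commute)
  qed
  define t where "t n = 1 / (real n + 2)" for n
  have t: "t n \<in> {0<..<1}" for n by (simp add: t_def)
  have t_eq: "t = (\<lambda>n. 1 / (real n + 2))" by (simp add: t_def fun_eq_iff)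
  have t0: "t \<longlonglongrightarrow> 0" unfolding t_eq by (rule lim)
  obtain r a b where r: "strict_mono r" "(\<lambda>n. c (t (r n))) \<longlonglongrightarrow> flat a b" "a \<in> \<gamma>" "b \<in> \<gamma>" "a \<noteq> b"
    using cluster[OF t t0] by blast
  let ?l = "flat a b"
  obtain D where D: "D > 0" "\<And>x. x \<in> \<Lambda> \<Longrightarrow> x \<noteq> ?l \<Longrightarrow> D \<le> dist ?l x"
    using finite_set_avoid[OF fin, of ?l] by blast
  have "(c \<longlongrightarrow> ?l) (at_right 0)"
  proof (rule tendstoI)
    fix \<epsilon>0 :: real assume "\<epsilon>0 > 0"
    define \<epsilon> where "\<epsilon> = min \<epsilon>0 (D / 2)"
    have \<epsilon>: "\<epsilon> > 0" "\<epsilon> \<le> \<epsilon>0" "\<epsilon> \<le> D / 2" using \<open>\<epsilon>0 > 0\<close> D(1) by (auto simp: \<epsilon>_def)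
    obtain s where s: "s > 0" "s < 1" "\<forall>t. 0 < t \<and> t < s \<longrightarrow> (\<exists>l\<in>\<Lambda>. dist l (c t) < \<epsilon>)" using near[OF \<epsilon>(1)] by blast
    let ?J = "c ` {0<..<s}" and ?P = "ball ?l \<epsilon>" and ?Q = "\<Union>x\<in>\<Lambda> - {?l}. ball x \<epsilon>"
    have conn: "connected ?J"
      by (intro connected_continuous_image continuous_on_subset[OF c(1)]) (use s in auto)
    have cover: "?J \<subseteq> ?P \<union> ?Q" using s(3) by fastforce
    have disj: "?P \<inter> ?Q = {}"
    proof (rule ccontr)
      assume "?P \<inter> ?Q \<noteq> {}"
      then obtain y where y: "y \<in> ?P" "y \<in> ?Q" by blast
      then obtain x where "x \<in> \<Lambda>" "x \<noteq> ?l" "y \<in> ball x \<epsilon>" by blast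
      moreover from this y have "dist ?l y < \<epsilon>" "dist x y < \<epsilon>" by simp_all
      ultimately have "dist ?l x < D" using dist_triangle2[of ?l x y] \<epsilon>(3) by linarith
      then show False using D(2) \<open>x \<in> \<Lambda>\<close> \<open>x \<noteq> ?l\<close> by force
    qed
    have meets: "?P \<inter> ?J \<noteq> {}"
    proof -
      have "\<forall>\<^sub>F n in sequentially. dist (c (t (r n))) ?l < \<epsilon>" by (rule tendstoD[OF r(2) \<epsilon>(1)])
      moreover have "\<forall>\<^sub>F n in sequentially. t (r n) < s"
        using LIMSEQ_subseq_LIMSEQ[OF t0 r(1)] s(1) by (auto simp: o_def intro: order_tendstoD)
      ultimately have "\<forall>\<^sub>F n in sequentially. dist (c (t (r n))) ?l < \<epsilon> \<and> t (r n) < s" by (rule eventually_conj)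
      then obtain n where "dist (c (t (r n))) ?l < \<epsilon>" "t (r n) < s"
        using eventually_happens'[OF sequentially_bot] by blast
      then have "c (t (r n)) \<in> ?P" "c (t (r n)) \<in> ?J" using t[of "r n"] by (auto simp: dist_commute)
      then show ?thesis by blast
    qed
    have "?Q \<inter> ?J = {}"
      using connectedD[OF conn open_ball, of ?Q ?l \<epsilon>] cover disj meets by blast
    then have "?J \<subseteq> ?P" using cover by blast
    then have "dist (c t) ?l < \<epsilon>0" if "0 < t" "t < s" for t
      using that \<epsilon>(2) by (force simp: dist_commute)
    then show "\<forall>\<^sub>F t in at_right 0. dist (c t) ?l < \<epsilon>0"
      unfolding eventually_at_right_field using s(1) by blast
  qed
  then show ?thesis using r(3-5) by blast
qed

text \<open>
  If the aspect ratio tends to \<open>\<infinity>\<close>, one relabeling makes it tend to \<open>0\<close>; \<open>n\<close> counts it.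
\<close>

lemma end_structure:
  assumes A: "A \<in> components I" and hom: "homeomorphism {0<..<1::real} A c c'"
  obtains n a b where "n = 0 \<or> n = (1::nat)" "a \<in> \<gamma>" "b \<in> \<gamma>" "a \<noteq> b"
    "((\<lambda>t. aspect_ratio ((cyc ^^ n) (c t))) \<longlongrightarrow> 0) (at_right 0)"
    "((\<lambda>t. (cyc ^^ n) (c t)) \<longlongrightarrow> flat a b) (at_right 0)"
    "ends_at_chord \<gamma> c (at_right 0) (closed_segment a b)"
proof -
  have cI: "c t \<in> I" if "t \<in> {0<..<1}" for t
    using hom that in_components_subset[OF A] unfolding homeomorphism_def by blast
  from end_dichotomy[OF A hom] show ?thesis
  proof
    assume as: "((\<lambda>t. aspect_ratio (c t)) \<longlongrightarrow> 0) (at_right 0)"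
    then obtain a b where ab: "a \<in> \<gamma>" "b \<in> \<gamma>" "a \<noteq> b" "(c \<longlongrightarrow> flat a b) (at_right 0)"
      using end_limit[OF A hom] by blast
    have "ends_at_chord \<gamma> c (at_right 0) (closed_segment a b)"
      unfolding ends_at_chord_def chord_def using as ab hausdorff_hull[OF ab(4)] by blast
    then show ?thesis using that[of 0 a b] ab as by simp
  next
    assume as: "filterlim (\<lambda>t. aspect_ratio (c t)) at_top (at_right 0)"
    have ev: "\<forall>\<^sub>F t in at_right 0. 1 / aspect_ratio (c t) = aspect_ratio (cyc (c t))"
      unfolding eventually_at_right_field using cI by (intro exI[of _ 1]) (auto simp: aspect_cyc)
    have "((\<lambda>t. inverse (aspect_ratio (c t))) \<longlongrightarrow> 0) (at_right 0)"
      by (rule tendsto_inverse_0_at_top[OF as])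
    then have as': "((\<lambda>t. aspect_ratio (cyc (c t))) \<longlongrightarrow> 0) (at_right 0)"
      using Lim_transform_eventually ev by (simp add: inverse_eq_divide tendsto_cong[OF ev, symmetric])
    then obtain a b where ab: "a \<in> \<gamma>" "b \<in> \<gamma>" "a \<noteq> b" "((\<lambda>t. cyc (c t)) \<longlongrightarrow> flat a b) (at_right 0)"
      using end_limit[OF component_cyc[OF A] homeomorphism_cyc[OF hom]] by blast
    have "ends_at_chord \<gamma> c (at_right 0) (closed_segment a b)"
      unfolding ends_at_chord_def chord_def using as ab hausdorff_hull[OF ab(4)] by (auto simp: range_cyc)
    then show ?thesis using that[of 1 a b] ab as' by simp
  qed
qed

lemma small_values:
  fixes f :: "real \<Rightarrow> real"
  assumes f: "continuous_on {0<..<1} f" "(f \<longlongrightarrow> (0::real)) (at_right 0)" and s: "0 < s" "s < 1" "0 < y" "y < f s"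
  shows "\<exists>t. 0 < t \<and> t \<le> s \<and> f t = y"
proof -
  have "\<forall>\<^sub>F t in at_right 0. f t < y" using f(2) s(3) by (rule order_tendstoD)
  then obtain b where b: "b > 0" "\<forall>t>0. t < b \<longrightarrow> f t < y" unfolding eventually_at_right_field by blast
  let ?t = "min (b / 2) (s / 2)"
  have t: "0 < ?t" "?t < b" "?t \<le> s" using b(1) s by auto
  have "continuous_on {?t..s} f" by (rule continuous_on_subset[OF f(1)]) (use t s in auto)
  moreover have "f ?t \<le> y" using b(2) t by (simp add: less_imp_le)
  ultimately obtain x where "?t \<le> x" "x \<le> s" "f x = y" using IVT'[of f ?t y s] s(4) t(3) by auto
  then show ?thesis using less_le_trans[OF t(1), of x] by blast
qed

text \<open>
  If the chords at the two ends coincide, two further relabelings make the limits at both ends equal as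
  labeled quadruples. Close to the ends some aspect ratio is then attained on both sides, and by
  \<open>flat_inj\<close> at the same rectangle up to relabeling, contrary to \<open>no_rotation\<close>.
\<close>

lemma arcs_proper:
  assumes "A \<in> arc_components I" shows "proper_arc \<gamma> A"
proof -
  have A: "A \<in> components I" using assms by (simp add: arc_components_def)
  have "{0<..<1::real} homeomorphic A" using assms homeomorphic_sym by (auto simp: arc_components_def)
  then obtain c c' where hom: "homeomorphism {0<..<1::real} A c c'" unfolding homeomorphic_def by blast
  have hom': "homeomorphism {0<..<1} A (\<lambda>t. c (1 - t)) (\<lambda>S. 1 - c' S)"
  proof (rule homeomorphismI)
    have c: "continuous_on {0<..<1} c" "continuous_on A c'" "c ` {0<..<1} = A" "c' ` A = {0<..<1}"
      "\<And>t. t \<in> {0<..<1} \<Longrightarrow> c' (c t) = t" "\<And>S. S \<in> A \<Longrightarrow> c (c' S) = S"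
      using hom unfolding homeomorphism_def by auto
    show "continuous_on {0<..<1} (\<lambda>t. c (1 - t))"
      by (rule continuous_on_compose2[OF c(1)]) (auto intro!: continuous_intros)
    show "continuous_on A (\<lambda>S. 1 - c' S)" by (intro continuous_intros c)
    show "(\<lambda>t. c (1 - t)) ` {0<..<1} \<subseteq> A" using c(3) by auto
    show "(\<lambda>S. 1 - c' S) ` A \<subseteq> {0<..<1}" using c(4) by force
  qed (use hom in \<open>auto simp: homeomorphism_def\<close>)
  obtain n a b where 1: "n = 0 \<or> n = (1::nat)" "a \<in> \<gamma>" "b \<in> \<gamma>" "a \<noteq> b"
    "((\<lambda>t. aspect_ratio ((cyc ^^ n) (c t))) \<longlongrightarrow> 0) (at_right 0)"
    "((\<lambda>t. (cyc ^^ n) (c t)) \<longlongrightarrow> flat a b) (at_right 0)"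
    "ends_at_chord \<gamma> c (at_right 0) (closed_segment a b)"
    using end_structure[OF A hom] by metis
  obtain n' a' b' where 2: "n' = 0 \<or> n' = (1::nat)" "a' \<in> \<gamma>" "b' \<in> \<gamma>" "a' \<noteq> b'"
    "((\<lambda>t. aspect_ratio ((cyc ^^ n') (c (1 - t)))) \<longlongrightarrow> 0) (at_right 0)"
    "((\<lambda>t. (cyc ^^ n') (c (1 - t))) \<longlongrightarrow> flat a' b') (at_right 0)"
    "ends_at_chord \<gamma> (\<lambda>t. c (1 - t)) (at_right 0) (closed_segment a' b')"
    using end_structure[OF A hom'] by metis
  have end1: "ends_at_chord \<gamma> c (at_left 1) (closed_segment a' b')"
    using 2(7) unfolding ends_at_chord_def hausdorff_tendsto_def at_left_1 filterlim_filtermap eventually_filtermap .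
  have cI: "c t \<in> I" if "t \<in> {0<..<1}" for t
    using hom that in_components_subset[OF A] unfolding homeomorphism_def by blast
  have "closed_segment a b \<noteq> closed_segment a' b'"
  proof
    assume eq: "closed_segment a b = closed_segment a' b'"
    have "\<exists>m. ((\<lambda>t. aspect_ratio ((cyc ^^ m) (c (1 - t)))) \<longlongrightarrow> 0) (at_right 0) \<and>
      ((\<lambda>t. (cyc ^^ m) (c (1 - t))) \<longlongrightarrow> flat a b) (at_right 0)"
    proof (cases "a' = a")
      case True
      then have "b' = b" using eq by (auto simp: doubleton_eq_iff)
      then show ?thesis using 2(5,6) True by blast
    next
      case False
      then have ab: "a' = b" "b' = a" using eq by (auto simp: doubleton_eq_iff)
      have "((\<lambda>t. cyc (cyc ((cyc ^^ n') (c (1 - t))))) \<longlongrightarrow> cyc (cyc (flat a' b'))) (at_right 0)"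
        by (intro bounded_linear.tendsto[OF bounded_linear_cyc] 2(6))
      moreover have "\<forall>\<^sub>F t in at_right 0. aspect_ratio ((cyc ^^ n') (c (1 - t))) = aspect_ratio (cyc (cyc ((cyc ^^ n') (c (1 - t)))))"
        unfolding eventually_at_right_field
        by (intro exI[of _ 1]) (auto simp: aspect_cyc cyc_I cyc_pow_I cI)
      then have "((\<lambda>t. aspect_ratio (cyc (cyc ((cyc ^^ n') (c (1 - t)))))) \<longlongrightarrow> 0) (at_right 0)"
        by (rule Lim_transform_eventually[OF 2(5)])
      ultimately show ?thesis using ab by (intro exI[of _ "Suc (Suc n')"]) (simp add: flat_cyc2)
    qed
    then obtain m where m: "((\<lambda>t. aspect_ratio ((cyc ^^ m) (c (1 - t)))) \<longlongrightarrow> 0) (at_right 0)"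
      "((\<lambda>t. (cyc ^^ m) (c (1 - t))) \<longlongrightarrow> flat a b) (at_right 0)" by blast
    obtain U where U: "open U" "flat a b \<in> U" "inj_on aspect_ratio (I \<inter> U)" using flat_inj[OF 1(2-4)] by metis
    have "\<forall>\<^sub>F t in at_right 0. (cyc ^^ n) (c t) \<in> U \<and> (cyc ^^ m) (c (1 - t)) \<in> U"
      using topological_tendstoD[OF 1(6) U(1,2)] topological_tendstoD[OF m(2) U(1,2)] by (rule eventually_conj)
    then obtain s0 where s0: "s0 > 0" "\<forall>t>0. t < s0 \<longrightarrow> (cyc ^^ n) (c t) \<in> U \<and> (cyc ^^ m) (c (1 - t)) \<in> U"
      unfolding eventually_at_right_field by blast
    \<comment> \<open>the bound \<open>1/4\<close> keeps the parameters found at the two ends apart\<close>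
    define s where "s = min (s0 / 2) (1 / 4)"
    have s: "0 < s" "s < s0" "s \<le> 1 / 4" using s0(1) by (auto simp: s_def)
    let ?f = "\<lambda>t. aspect_ratio ((cyc ^^ n) (c t))" and ?g = "\<lambda>t. aspect_ratio ((cyc ^^ m) (c (1 - t)))"
    have cyc_cont: "continuous_on S (cyc ^^ k)" for S k
      by (induction k) (auto simp: o_def id_def intro!: continuous_intros)
    have cont: "continuous_on {0<..<1} (\<lambda>t. aspect_ratio ((cyc ^^ k) (h t)))"
      if "continuous_on {0<..<1} h" "h ` {0<..<1} \<subseteq> I" for k h
    proof (rule continuous_on_compose2[OF aspect_continuous])
      show "continuous_on {0<..<1} (\<lambda>t. (cyc ^^ k) (h t))"
        by (rule continuous_on_compose2[OF cyc_cont that(1)]) auto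
      show "(\<lambda>t. (cyc ^^ k) (h t)) ` {0<..<1} \<subseteq> I" using that(2) cyc_pow_I by blast
    qed
    have cf: "continuous_on {0<..<1} ?f" "continuous_on {0<..<1} ?g"
      using hom hom' cI by (auto intro!: cont simp: homeomorphism_def)
    have "s \<in> {0<..<1}" "1 - s \<in> {0<..<1}" using s by auto
    then have fg: "?f s > 0" "?g s > 0" using aspect_pos[OF cyc_pow_I[OF cI]] by blast+
    define y where "y = min (?f s) (?g s) / 2"
    have y: "0 < y" "y < ?f s" "y < ?g s" using fg by (auto simp: y_def)
    obtain t where t: "0 < t" "t \<le> s" "?f t = y" using small_values[OF cf(1) 1(5), of s y] s y by auto
    obtain t' where t': "0 < t'" "t' \<le> s" "?g t' = y" using small_values[OF cf(2) m(1), of s y] s y by auto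
    have tt: "t \<in> {0<..<1}" "1 - t' \<in> {0<..<1}" using t t' s by auto
    have "(cyc ^^ n) (c t) = (cyc ^^ m) (c (1 - t'))"
    proof (rule inj_onD[OF U(3)])
      show "?f t = aspect_ratio ((cyc ^^ m) (c (1 - t')))" using t t' by simp
      have "t < s0" "t' < s0" using t t' s by linarith+
      then show "(cyc ^^ n) (c t) \<in> I \<inter> U" "(cyc ^^ m) (c (1 - t')) \<in> I \<inter> U"
        using cyc_pow_I[OF cI[OF tt(1)]] cyc_pow_I[OF cI[OF tt(2)]] s0(2) t(1) t'(1) by simp_all
    qed
    then have "(cyc ^^ (4 - n)) ((cyc ^^ n) (c t)) = (cyc ^^ (4 - n)) ((cyc ^^ m) (c (1 - t')))" by simp
    moreover have "(cyc ^^ (4 - n)) ((cyc ^^ n) (c t)) = c t" using 1(1) by (auto simp: eval_nat_numeral)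
    ultimately have "c t = (cyc ^^ (4 - n + m)) (c (1 - t'))" by (simp add: funpow_add)
    then have "t = 1 - t'" by (rule no_rotation[OF A hom tt])
    then show False using t t' s by simp
  qed
  then show ?thesis unfolding proper_arc_def using hom 1(7) end1 by blast
qed

end

theorem theorem1p5:
  shows "\<exists>P :: nat \<Rightarrow> (nat \<Rightarrow> real^2) set. \<forall>N\<ge>3.
    openin (polygon_space N) (P N) \<and>
    polygon_space N closure_of P N = topspace (polygon_space N) \<and>
    (\<forall>v\<in>P N. let I = inscribed_rectangles (polygon_curve N v) in
       piecewise_smooth_1_manifold I \<and>
       (\<forall>A\<in>arc_components I. proper_arc (polygon_curve N v) A) \<and>
       (\<forall>R. smooth_point I R \<longrightarrow> (\<exists>U. open U \<and> R \<in> U \<and> inj_on aspect_ratio (I \<inter> U))) \<and>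
       (\<forall>R\<in>I. aspect_ratio R = 1 \<longrightarrow> smooth_point I R))"
proof (intro exI allI impI conjI ballI)
  fix N :: nat assume N: "3 \<le> N"
  show "openin (polygon_space N) {v. generic N v}"
    "polygon_space N closure_of {v. generic N v} = topspace (polygon_space N)"
    by (rule open_dense_generic[OF N])+
  fix v assume "v \<in> {v. generic N v}"
  then interpret generic_polygon N v using N by unfold_locales simp_all
  show "let I = inscribed_rectangles (polygon_curve N v) in
       piecewise_smooth_1_manifold I \<and>
       (\<forall>A\<in>arc_components I. proper_arc (polygon_curve N v) A) \<and>
       (\<forall>R. smooth_point I R \<longrightarrow> (\<exists>U. open U \<and> R \<in> U \<and> inj_on aspect_ratio (I \<inter> U))) \<and>
       (\<forall>R\<in>I. aspect_ratio R = 1 \<longrightarrow> smooth_point I R)"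
    unfolding Let_def using inscribed_piecewise_smooth arcs_proper inscribed_smooth_points by blast
qed

end
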